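(* Let $D=(D_{i,j})_{1\le i<j\le k}$ be an allowed summation divisor adapted to $A_0$, and let $U=(U_{i,j})$, $V=(V_{i,j})\in\prod_{1\le i<j\le k}M_{r_i,r_j}(\mathbf{C}(\{z\}))$. (i) There exists a unique $F\in\mathfrak{G}(\mathcal{M}(\mathbf{C}^*,0))$ such that $F[A_U]=A_V$ and, for $1\le i<j\le k$, $\mathrm{div}_{\mathbf{E}_q}(F_{i,j})\ge -D_{i,j}$. (ii) If $A_U$ and $A_V$ are in polynomial normal form, then $F\in\mathfrak{G}(\mathcal{M}(\mathbf{C}^* ))$.
   Context: Fix $q\in\mathbf{C}$ with $|q|>1$; $\sigma_q f(z)=f(qz)$, applied entrywise to matrices. $\mathbf{C}(\{z\})$ is the fraction field of the ring of convergent power series; $\mathcal{M}(\mathbf{C}^*,0)$ (resp. $\mathcal{O}(\mathbf{C}^*,0)$) is the field (resp. ring) of germs of meromorphic (resp. holomorphic) functions in a punctured neighbourhood of $0$ (essential singularities at $0$ allowed); $\mathcal{M}(\mathbf{C}^* )$ is the field of meromorphic functions on $\mathbf{C}^*$. Fix integers $\mu_1>\cdots>\mu_k$, ranks $r_1,\dots,r_k\ge1$, matrices $A_i\in GL_{r_i}(\mathbf{C})$; $n=r_1+\cdots+r_k$. For a family $U=(U_{i,j})_{1\le i<j\le k}$ of $r_i\times r_j$ matrices of functions, $A_U$ is the block upper triangular matrix with diagonal blocks $z^{-\mu_i}A_i$ and $(i,j)$-block $U_{i,j}$ for $i<j$; $A_0$ is the block diagonal one ($U=0$). $A_U$ is in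 polynomial normal form if for all $i<j$ all entries of $U_{i,j}$ lie in $\sum_{\mu_j\le l<\mu_i}\mathbf{C}z^l$. $\mathfrak{G}$ is the algebraic subgroup of $GL_n$ of block upper triangular matrices with diagonal blocks $I_{r_1},\dots,I_{r_k}$; the over-diagonal blocks of $F\in\mathfrak{G}$ are written $F_{i,j}$. Gauge action: $F[A]=(\sigma_qF)AF^{-1}$. $\mathbf{E}_q=\mathbf{C}^*/q^{\mathbf{Z}}$ is the elliptic curve, with group law induced by multiplication in $\mathbf{C}^*$; $\overline{a}$ (resp. $\overline{X}$) is the image of $a\in\mathbf{C}^*$ (resp. $X\subset\mathbf{C}^*$) in $\mathbf{E}_q$. For a divisor $D=\sum n_i[\alpha_i]$ on $\mathbf{E}_q$, $ev_{\mathbf{E}_q}(D)\in\mathbf{E}_q$ is the sum $\sum n_i\alpha_i$ for the group law. A summation divisor adapted to $A_0$ is a family $(D_{i,j})_{1\le i<j\le k}$ of effective divisors on $\mathbf{E}_q$, $D_{i,j}$ of degree $\mu_{i,j}=\mu_i-\mu_j$, with $D_{i,j}=D_{i,l}+D_{l,j}$ for all $i<l<j$. It is allowed if for all $i<j$: $ev_{\mathbf{E}_q}(D_{i,j})\notin\overline{(-1)^{\mu_{i,j}}\,Sp(A_i)/Sp(A_j)}$, where $Sp$ is the spectrum and $S/T=\{s/t: s\in S,t\in T\}$. The condition $\mathrm{div}_{\mathbf{E}_q}(F_{i,j})\ge-D_{i,j}$ means: at every point $z_0$ (of some punctured neighbourhood of $0$), each entry of $F_{i,j}$ has a pole of order at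 most the multiplicity of $\overline{z_0}$ in $D_{i,j}$. *)

theory Defs
  imports
    "HOL-Complex_Analysis.Complex_Analysis"
    "HOL-Library.Multiset"
    "HOL-Algebra.Coset"
    "HOL-Algebra.FiniteProduct"
    "Jordan_Normal_Form.Matrix"
    "Jordan_Normal_Form.Gauss_Jordan_Elimination"
    "Jordan_Normal_Form.Spectral_Radius"
begin

text \<open>Formal Laurent series and matrices both use the infix notation for entries; only the
  matrix one is used below.\<close>
no_notation fls_nth (infixl "$$" 75)

section \<open>Functions and germs\<close>

text \<open>
  Elements of the function fields are represented by functions \<open>complex \<Rightarrow> complex\<close>, whose
  values on a discrete set (in particular at poles) are irrelevant; two representatives are
  identified by \<open>germ_eq\<close>.
\<close>

definition conv_laurent :: "(complex \<Rightarrow> complex) set" where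
  "conv_laurent = {f. \<exists>g h. g analytic_on {0} \<and> h analytic_on {0} \<and>
      (\<forall>\<^sub>F z in at 0. h z \<noteq> 0) \<and> (\<forall>\<^sub>F z in at 0. f z = g z / h z)}"

definition mero_germs :: "(complex \<Rightarrow> complex) set" where
  "mero_germs = {f. \<exists>\<rho>>0. f meromorphic_on (ball 0 \<rho> - {0})}"

definition mero_Cstar :: "(complex \<Rightarrow> complex) set" where
  "mero_Cstar = {f. f meromorphic_on (- {0})}"

text \<open>
  Equality in the field of meromorphic germs (also for matrices of such germs).  Poles may
  accumulate at 0, so equality is required off a discrete subset of a punctured disk rather
  than \<open>eventually\<close> at 0.
\<close>

definition germ_eq :: "(complex \<Rightarrow> 'a) \<Rightarrow> (complex \<Rightarrow> 'a) \<Rightarrow> bool" where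
  "germ_eq f g \<longleftrightarrow> (\<exists>\<rho>>0. \<forall>\<^sub>\<approx>z\<in>ball 0 \<rho> - {0}. f z = g z)"

lemma conv_laurent_eq: "conv_laurent = {f. f meromorphic_on {0}}"
proof (intro Set.set_eqI iffI)
  fix f assume "f \<in> conv_laurent"
  then obtain g h where gh: "g analytic_on {0}" "h analytic_on {0}"
      and e: "\<forall>\<^sub>F z in at 0. f z = g z / h z"
    by (auto simp: conv_laurent_def)
  have "(\<lambda>z. g z / h z) meromorphic_on {0}"
    using gh by (intro meromorphic_intros analytic_on_imp_meromorphic_on)
  then show "f \<in> {f. f meromorphic_on {0}}"
    using meromorphic_on_cong[of "{0}" f "\<lambda>z. g z / h z" "{0}"] e by auto
next
  fix f :: "complex \<Rightarrow> complex" assume "f \<in> {f. f meromorphic_on {0}}"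
  then obtain F where F: "f has_laurent_expansion F"
    by (auto simp: meromorphic_on_def)
  define n where "n = nat (- fls_subdegree F)"
  define G where "G = fls_regpart (fls_shift (- int n) F)"
  have sd: "fls_subdegree (fls_shift (- int n) F) \<ge> 0 \<or> F = 0"
    by (cases "F = 0") (auto simp: n_def fls_shift_subdegree)
  have "(\<lambda>z. z ^ n) has_laurent_expansion fls_X ^ n"
    by (intro laurent_expansion_intros)
  from has_laurent_expansion_mult[OF F this]
  have "(\<lambda>z. f z * z ^ n) has_laurent_expansion F * fls_X ^ n" .
  also have "F * fls_X ^ n = fls_shift (- int n) F"
    by (rule fls_X_power_times_conv_shift)
  also have "\<dots> = fps_to_fls G"
    using sd unfolding G_def by (cases "F = 0") auto
  finally have L: "(\<lambda>z. f z * z ^ n) has_laurent_expansion fps_to_fls G" .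
  define g where "g = (\<lambda>z. if z = 0 then fps_nth G 0 else f z * z ^ n)"
  have "g has_laurent_expansion fps_to_fls G"
    by (rule has_laurent_expansion_cong[THEN iffD1, OF _ refl L])
       (auto simp: g_def eventually_at_filter)
  moreover have "g 0 = fps_nth G 0" by (simp add: g_def)
  ultimately have "g has_fps_expansion G"
    by (simp add: has_fps_expansion_to_laurent)
  then have "g analytic_on {0}"
    using has_fps_expansion_imp_analytic_0 by blast
  moreover have "(\<lambda>z::complex. z ^ n) analytic_on {0}" by (intro analytic_intros)
  moreover have "\<forall>\<^sub>F z in at (0::complex). z ^ n \<noteq> 0"
    using eventually_neq_at_within[of 0 0 UNIV] by eventually_elim auto
  moreover have "\<forall>\<^sub>F z in at 0. f z = g z / z ^ n"
    using eventually_neq_at_within[of 0 0 UNIV] by eventually_elim (auto simp: g_def)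
  ultimately show "f \<in> conv_laurent" unfolding conv_laurent_def by blast
qed

section \<open>Block matrices and the gauge action\<close>

text \<open>
  Blocks are numbered \<open>0, \<dots>, k - 1\<close>; block \<open>i\<close> has size \<open>r i\<close> and occupies the row and
  column indices from \<open>boffset r i\<close> up to \<open>boffset r (Suc i) - 1\<close>.
\<close>

definition boffset :: "(nat \<Rightarrow> nat) \<Rightarrow> nat \<Rightarrow> nat" where
  "boffset r i = (\<Sum>l<i. r l)"

definition bindex :: "(nat \<Rightarrow> nat) \<Rightarrow> nat \<Rightarrow> nat" where
  "bindex r a = (LEAST i. a < boffset r (Suc i))"

definition block :: "(nat \<Rightarrow> nat) \<Rightarrow> nat \<Rightarrow> nat \<Rightarrow> 'a mat \<Rightarrow> 'a mat" where
  "block r i j M = mat (r i) (r j) (\<lambda>(a, b). M $$ (boffset r i + a, boffset r j + b))"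

definition of_blocks :: "nat \<Rightarrow> (nat \<Rightarrow> nat) \<Rightarrow> (nat \<Rightarrow> nat \<Rightarrow> 'a mat) \<Rightarrow> 'a mat" where
  "of_blocks k r B = mat (boffset r k) (boffset r k) (\<lambda>(a, b).
     B (bindex r a) (bindex r b) $$ (a - boffset r (bindex r a), b - boffset r (bindex r b)))"

lemma boffset_Suc: "boffset r (Suc i) = boffset r i + r i"
  by (simp add: boffset_def)

lemma boffset_mono: "i \<le> j \<Longrightarrow> boffset r i \<le> boffset r j"
  unfolding boffset_def by (rule sum_mono2) auto

lemma bindex_boffset:
  assumes "a < r i" shows "bindex r (boffset r i + a) = i"
  unfolding bindex_def
proof (rule Least_equality)
  show "boffset r i + a < boffset r (Suc i)" using assms by (simp add: boffset_Suc)
next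
  fix j assume "boffset r i + a < boffset r (Suc j)"
  then show "i \<le> j" using boffset_mono[of "Suc j" i r] by (cases "i \<le> j") auto
qed

lemma block_of_blocks:
  assumes "i < k" "j < k" "B i j \<in> carrier_mat (r i) (r j)"
  shows "block r i j (of_blocks k r B) = B i j"
proof -
  have "boffset r l + a < boffset r k" if "l < k" "a < r l" for l a
    using that boffset_mono[of "Suc l" k r] by (simp add: boffset_Suc)
  then show ?thesis
    using assms by (intro eq_matI) (auto simp: block_def of_blocks_def bindex_boffset)
qed

definition mat_over :: "nat \<Rightarrow> nat \<Rightarrow> (complex \<Rightarrow> complex) set \<Rightarrow> (complex \<Rightarrow> complex mat) set" where
  "mat_over m n K = {M. (\<forall>z. M z \<in> carrier_mat m n) \<and>
     (\<forall>a<m. \<forall>b<n. (\<lambda>z. M z $$ (a, b)) \<in> K)}"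

text \<open>The block unipotent group: its complex points and its points over a function field \<open>K\<close>.\<close>

definition unip :: "nat \<Rightarrow> (nat \<Rightarrow> nat) \<Rightarrow> complex mat set" where
  "unip k r = {M \<in> carrier_mat (boffset r k) (boffset r k).
     \<forall>i<k. block r i i M = 1\<^sub>m (r i) \<and> (\<forall>j<i. block r i j M = 0\<^sub>m (r i) (r j))}"

definition unip_over ::
  "nat \<Rightarrow> (nat \<Rightarrow> nat) \<Rightarrow> (complex \<Rightarrow> complex) set \<Rightarrow> (complex \<Rightarrow> complex mat) set" where
  "unip_over k r K = {F \<in> mat_over (boffset r k) (boffset r k) K. \<forall>z. F z \<in> unip k r}"

definition sigma_q :: "complex \<Rightarrow> (complex \<Rightarrow> 'a) \<Rightarrow> complex \<Rightarrow> 'a" where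
  "sigma_q q f = (\<lambda>z. f (q * z))"

text \<open>Used for pointwise invertible \<open>F\<close> only, where \<open>mat_inverse\<close> does not return \<open>None\<close>.\<close>

definition gauge ::
  "complex \<Rightarrow> (complex \<Rightarrow> complex mat) \<Rightarrow> (complex \<Rightarrow> complex mat) \<Rightarrow> complex \<Rightarrow> complex mat" where
  "gauge q F A = (\<lambda>z. sigma_q q F z * A z * the (mat_inverse (F z)))"

definition A_blk ::
  "nat \<Rightarrow> (nat \<Rightarrow> int) \<Rightarrow> (nat \<Rightarrow> nat) \<Rightarrow> (nat \<Rightarrow> complex mat) \<Rightarrow>
     (nat \<Rightarrow> nat \<Rightarrow> complex \<Rightarrow> complex mat) \<Rightarrow> complex \<Rightarrow> complex mat" where
  "A_blk k \<mu> r A U = (\<lambda>z. of_blocks k r (\<lambda>i j.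
     if i = j then (z powi (- \<mu> i)) \<cdot>\<^sub>m A i
     else if i < j then U i j z
     else 0\<^sub>m (r i) (r j)))"

text \<open>Polynomial normal form of \<open>A_blk k \<mu> r A U\<close>, a condition on the germs \<open>U i j\<close> only.\<close>

definition poly_normal_form ::
  "nat \<Rightarrow> (nat \<Rightarrow> int) \<Rightarrow> (nat \<Rightarrow> nat) \<Rightarrow> (nat \<Rightarrow> nat \<Rightarrow> complex \<Rightarrow> complex mat) \<Rightarrow> bool" where
  "poly_normal_form k \<mu> r U \<longleftrightarrow> (\<forall>i j. i < j \<and> j < k \<longrightarrow> (\<forall>a<r i. \<forall>b<r j.
     \<exists>c::int \<Rightarrow> complex. \<forall>\<^sub>F z in at 0. U i j z $$ (a, b) = (\<Sum>l\<in>{\<mu> j..<\<mu> i}. c l * z powi l)))"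

section \<open>The elliptic curve and summation divisors\<close>

definition Cstar :: "complex monoid" where
  "Cstar = \<lparr>carrier = - {0}, mult = (*), one = 1\<rparr>"

definition q_powers :: "complex \<Rightarrow> complex set" where
  "q_powers q = range (\<lambda>m::int. q powi m)"

definition E_q :: "complex \<Rightarrow> complex set monoid" where
  "E_q q = Cstar Mod q_powers q"

definition proj_E :: "complex \<Rightarrow> complex \<Rightarrow> complex set" where
  "proj_E q a = q_powers q #>\<^bsub>Cstar\<^esub> a"

lemma comm_group_Cstar: "comm_group Cstar"
proof (rule comm_groupI)
  fix x assume "x \<in> carrier Cstar"
  then show "\<exists>y\<in>carrier Cstar. y \<otimes>\<^bsub>Cstar\<^esub> x = \<one>\<^bsub>Cstar\<^esub>"
    by (auto simp: Cstar_def intro!: bexI[of _ "inverse x"])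
qed (auto simp: Cstar_def)

lemma comm_group_E_q:
  assumes "q \<noteq> 0" shows "comm_group (E_q q)"
proof -
  interpret C: comm_group Cstar by (rule comm_group_Cstar)
  have "subgroup (q_powers q) Cstar"
  proof (rule C.subgroupI)
    fix a assume "a \<in> q_powers q"
    then obtain m where m: "a = q powi m" by (auto simp: q_powers_def)
    have "inv\<^bsub>Cstar\<^esub> a = q powi (- m)"
      by (rule C.inv_equality) (use assms m in \<open>auto simp: Cstar_def power_int_minus\<close>)
    then show "inv\<^bsub>Cstar\<^esub> a \<in> q_powers q" by (simp add: q_powers_def)
  next
    fix a b assume "a \<in> q_powers q" "b \<in> q_powers q"
    then obtain m n where "a = q powi m" "b = q powi n" by (auto simp: q_powers_def)
    then have "a \<otimes>\<^bsub>Cstar\<^esub> b = q powi (m + n)"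
      using assms by (simp add: Cstar_def power_int_add)
    then show "a \<otimes>\<^bsub>Cstar\<^esub> b \<in> q_powers q" by (simp add: q_powers_def)
  qed (use assms in \<open>auto simp: q_powers_def Cstar_def\<close>)
  then show ?thesis unfolding E_q_def by (rule C.abelian_FactGroup)
qed

text \<open>
  Effective divisors are multisets of points: multiplicity is \<open>count\<close>, degree is \<open>size\<close>.
\<close>

definition ev_E :: "complex \<Rightarrow> complex set multiset \<Rightarrow> complex set" where
  "ev_E q D = finprod (E_q q) (\<lambda>\<alpha>. \<alpha> [^]\<^bsub>E_q q\<^esub> count D \<alpha>) (set_mset D)"

definition summation_divisor ::
  "complex \<Rightarrow> nat \<Rightarrow> (nat \<Rightarrow> int) \<Rightarrow> (nat \<Rightarrow> nat \<Rightarrow> complex set multiset) \<Rightarrow> bool" where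
  "summation_divisor q k \<mu> D \<longleftrightarrow>
     (\<forall>i j. i < j \<and> j < k \<longrightarrow>
        set_mset (D i j) \<subseteq> carrier (E_q q) \<and> int (size (D i j)) = \<mu> i - \<mu> j) \<and>
     (\<forall>i l j. i < l \<and> l < j \<and> j < k \<longrightarrow> D i j = D i l + D l j)"

definition allowed_divisor ::
  "complex \<Rightarrow> nat \<Rightarrow> (nat \<Rightarrow> int) \<Rightarrow> (nat \<Rightarrow> complex mat) \<Rightarrow>
     (nat \<Rightarrow> nat \<Rightarrow> complex set multiset) \<Rightarrow> bool" where
  "allowed_divisor q k \<mu> A D \<longleftrightarrow> (\<forall>i j. i < j \<and> j < k \<longrightarrow>
     ev_E q (D i j) \<notin>
       proj_E q ` {(-1) powi (\<mu> i - \<mu> j) * (s / t) | s t. s \<in> spectrum (A i) \<and> t \<in> spectrum (A j)})"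

text \<open>
  The order of a pole of \<open>f\<close> at \<open>z\<close> is \<open>- zorder f z\<close>; nothing is required where there is no pole.
\<close>

definition div_ge ::
  "complex \<Rightarrow> nat \<Rightarrow> nat \<Rightarrow> (complex \<Rightarrow> complex mat) \<Rightarrow> complex set multiset \<Rightarrow> bool" where
  "div_ge q m n F D \<longleftrightarrow> (\<exists>\<rho>>0. \<forall>z0\<in>ball 0 \<rho> - {0}. \<forall>a<m. \<forall>b<n.
     is_pole (\<lambda>z. F z $$ (a, b)) z0 \<longrightarrow>
       - zorder (\<lambda>z. F z $$ (a, b)) z0 \<le> int (count D (proj_E q z0)))"

definition is_solution ::
  "complex \<Rightarrow> nat \<Rightarrow> (nat \<Rightarrow> int) \<Rightarrow> (nat \<Rightarrow> nat) \<Rightarrow> (nat \<Rightarrow> complex mat) \<Rightarrow>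
     (nat \<Rightarrow> nat \<Rightarrow> complex set multiset) \<Rightarrow>
     (nat \<Rightarrow> nat \<Rightarrow> complex \<Rightarrow> complex mat) \<Rightarrow> (nat \<Rightarrow> nat \<Rightarrow> complex \<Rightarrow> complex mat) \<Rightarrow>
     (complex \<Rightarrow> complex mat) \<Rightarrow> bool" where
  "is_solution q k \<mu> r A D U V F \<longleftrightarrow>
     F \<in> unip_over k r mero_germs \<and>
     germ_eq (gauge q F (A_blk k \<mu> r A U)) (A_blk k \<mu> r A V) \<and>
     (\<forall>i j. i < j \<and> j < k \<longrightarrow> div_ge q (r i) (r j) (\<lambda>z. block r i j (F z)) (D i j))"

end

theory Submission
  imports Defs
begin

text \<open>
  The equation \<open>F[A_U] = A_V\<close> is the linear equation \<open>(\<sigma>\<^sub>q F) A_U = A_V F\<close>.  A constant block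
  diagonal change of frame makes every \<open>A\<^sub>i\<close> upper triangular (\<open>triangularize_blocks\<close>); then both
  \<open>A_U\<close> and \<open>A_V\<close> are upper triangular and the equation splits into scalar ones, for the entries
  \<open>F\<^sub>a\<^sub>b\<close> over the blocks \<open>i < j\<close>, solved one after the other by increasing \<open>b - a\<close>:
  \[ t_b z^{-\mu_j} F_{ab}(qz) - t_a z^{-\mu_i} F_{ab}(z) = \text{terms already known}, \]
  where \<open>t\<^sub>a\<close> and \<open>t\<^sub>b\<close> are eigenvalues of \<open>A\<^sub>i\<close> and \<open>A\<^sub>j\<close>.

  The pole condition is absorbed by a theta function.  Let \<open>\<Theta>\<^sub>D\<close> be holomorphic on the punctured
  plane with divisor exactly \<open>D\<close>; it satisfies \<open>\<Theta>\<^sub>D (q z) = \<kappa>\<^sub>D z^(deg D) \<Theta>\<^sub>D z\<close> with a constant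
  \<open>\<kappa>\<^sub>D\<close>.  Having poles bounded by \<open>D\<^sub>i\<^sub>j\<close> means \<open>F\<^sub>a\<^sub>b = X\<^sub>a\<^sub>b / \<Theta>\<close> with \<open>X\<^sub>a\<^sub>b\<close> holomorphic near the
  puncture (\<open>poles_bounded_iff\<close>).  Since \<open>D\<^sub>i\<^sub>j\<close> has degree \<open>\<mu>\<^sub>i - \<mu>\<^sub>j\<close>, the powers of \<open>z\<close> cancel; since
  \<open>D\<^sub>i\<^sub>j = D\<^sub>i\<^sub>l + D\<^sub>l\<^sub>j\<close>, multiplying by \<open>\<Theta>\<close> clears the poles of the known terms
  (\<open>gauge_eq_iff\<close>).  What remains is an equation with constant coefficients
  \[ s X(qz) - t X(z) = W(z), \qquad s = t_b / \kappa_D,\ t = t_a, \]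
  with \<open>W\<close> holomorphic on a punctured disc, hence \<open>(s q^m - t) x\<^sub>m = w\<^sub>m\<close> for the Laurent
  coefficients.  The product of representatives of the points of \<open>D\<close> enters \<open>\<kappa>\<^sub>D\<close>, and
  that \<open>D\<close> is allowed says precisely that \<open>s q^m \<noteq> t\<close> for all \<open>m\<close>
  (\<open>div_mult_nonresonant\<close>).  So the coefficients are determined, which gives uniqueness
  (\<open>q_homogeneous_unique\<close>); and as \<open>q^m / (s q^m - t)\<close> is bounded, the solution converges on a
  disc \<open>\<bar>q\<bar>\<close> times larger than the one of \<open>W\<close> (\<open>q_solve\<close>), which leaves room for \<open>X (q z)\<close> in the
  later equations.

  The coefficients \<open>w\<^sub>m\<close> are residues at \<open>0\<close>, so the solution does not depend on the radius of
  the disc.  For Laurent polynomial data the same \<open>X\<^sub>a\<^sub>b\<close> is therefore holomorphic on the whole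
  punctured plane, which is the second part.
\<close>

section \<open>Laurent expansions around an essential singularity\<close>

definition laurent_coeff :: "(complex \<Rightarrow> complex) \<Rightarrow> int \<Rightarrow> complex" where
  "laurent_coeff f n = residue (\<lambda>z. f z * z powi (- n - 1)) 0"

abbreviation punctured :: "real \<Rightarrow> complex set" where
  "punctured \<rho> \<equiv> ball 0 \<rho> - {0}"

lemma open_punctured [simp]: "open (punctured \<rho>)"
  by (simp add: open_Diff)

lemma laurent_integrand_holomorphic:
  assumes "f holomorphic_on punctured \<rho>"
  shows "(\<lambda>z. f z * z powi n) holomorphic_on punctured \<rho>"
  using assms by (intro holomorphic_intros) auto

lemma laurent_coeff_bound:
  assumes f: "f holomorphic_on punctured \<rho>" and r: "0 < r" "r < \<rho>"
  shows "\<exists>M\<ge>0. \<forall>n. norm (laurent_coeff f n) \<le> M * r powi (- n)"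
proof -
  have sub: "sphere 0 r \<subseteq> punctured \<rho>" using r by auto
  have "compact (f ` sphere 0 r)"
    by (intro compact_continuous_image holomorphic_on_imp_continuous_on
        holomorphic_on_subset[OF f sub]) auto
  then obtain M where M: "M > 0" "\<And>z. z \<in> sphere 0 r \<Longrightarrow> norm (f z) \<le> M"
    using compact_imp_bounded bounded_pos by (metis imageI)
  show ?thesis
  proof (intro exI[of _ M] conjI allI)
    fix n
    define g where "g = (\<lambda>z. f z * z powi (- n - 1))"
    have "(g has_contour_integral 2 * pi * \<i> * residue g 0) (circlepath 0 r)"
      using r laurent_integrand_holomorphic[OF f] unfolding g_def
      by (intro base_residue[of "ball 0 \<rho>"]) auto
    then have "norm (2 * pi * \<i> * residue g 0) \<le> (M * r powi (- n - 1)) * (2 * pi * r)"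
      by (rule has_contour_integral_bound_circlepath)
         (use r M in \<open>auto simp: g_def norm_mult norm_power_int intro!: mult_right_mono\<close>)
    also have "\<dots> = 2 * pi * (M * r powi (- n))"
      using r by (simp add: power_int_diff)
    finally show "norm (laurent_coeff f n) \<le> M * r powi (- n)"
      by (simp add: norm_mult laurent_coeff_def g_def)
  qed (use M in auto)
qed

lemma laurent_coeff_cong:
  assumes "\<forall>\<^sub>F z in at 0. f z = g z"
  shows "laurent_coeff f n = laurent_coeff g n"
  unfolding laurent_coeff_def
  by (rule residue_cong) (use assms in \<open>auto elim: eventually_mono\<close>)

lemma laurent_coeff_punctured_cong:
  assumes "\<rho> > 0" "\<And>z. z \<in> punctured \<rho> \<Longrightarrow> f z = g z"
  shows "laurent_coeff f n = laurent_coeff g n"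
  by (intro laurent_coeff_cong eventually_at[THEN iffD2] exI[of _ \<rho>]) (use assms in auto)

lemma laurent_coeff_add:
  assumes "\<rho> > 0" "f holomorphic_on punctured \<rho>" "g holomorphic_on punctured \<rho>"
  shows "laurent_coeff (\<lambda>z. f z + g z) n = laurent_coeff f n + laurent_coeff g n"
  unfolding laurent_coeff_def ring_distribs
  by (rule residue_add[of "ball 0 \<rho>"]) (use assms in \<open>auto intro: laurent_integrand_holomorphic\<close>)

lemma laurent_coeff_cmult:
  assumes "\<rho> > 0" "f holomorphic_on punctured \<rho>"
  shows "laurent_coeff (\<lambda>z. c * f z) n = c * laurent_coeff f n"
  unfolding laurent_coeff_def mult.assoc
  by (rule residue_lmul[of "ball 0 \<rho>"]) (use assms in \<open>auto intro: laurent_integrand_holomorphic\<close>)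

lemma laurent_coeff_times_z:
  "laurent_coeff (\<lambda>z. z * f z) n = laurent_coeff f (n - 1)"
  unfolding laurent_coeff_def
proof (rule residue_cong)
  show "\<forall>\<^sub>F z in at 0. z * f z * z powi (- n - 1) = f z * z powi (- (n - 1) - 1)"
    using eventually_neq_at_within[of 0 0 UNIV]
    by eventually_elim (auto simp: power_int_diff power_int_minus field_simps)
qed auto

lemma laurent_coeff_const: "laurent_coeff (\<lambda>_. c) n = (if n = 0 then c else 0)"
proof (cases "n \<ge> 0")
  case True
  have "laurent_coeff (\<lambda>_. c) n = residue (\<lambda>z. c / z ^ Suc (nat n)) 0"
    using True unfolding laurent_coeff_def
    by (intro arg_cong2[where f = residue] ext refl)
       (auto simp: power_int_def divide_inverse power_inverse nat_add_distrib add.commute)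
  also have "\<dots> = fps_nth (fps_const c) (nat n)"
    by (rule residue_fps_expansion_over_power_at_0) (rule has_fps_expansion_const)
  finally show ?thesis using True by simp
next
  case False
  then have "laurent_coeff (\<lambda>_. c) n = residue (\<lambda>z. c * z ^ nat (- n - 1)) 0"
    unfolding laurent_coeff_def
    by (intro arg_cong2[where f = residue] ext refl) (auto simp: power_int_def)
  also have "\<dots> = 0"
    by (rule residue_holo[of UNIV]) (auto intro!: holomorphic_intros)
  finally show ?thesis using False by simp
qed

text \<open>
  Rotating and scaling a circle does not change its winding number, and the substitution
  \<open>w = q z\<close> turns the integral along the circle into the one along its image.
\<close>

lemma residue_rescale:
  assumes q: "q \<noteq> 0" and \<rho>: "\<rho> > 0" and g: "g holomorphic_on punctured \<rho>"
  shows "residue (\<lambda>z. q * g (q * z)) 0 = residue g 0"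
proof -
  \<comment> \<open>Any radius whose image under multiplication by q stays below the given one will do.\<close>
  define r where "r = \<rho> / norm q / 2"
  have r: "r > 0" "norm q * r < \<rho>" using q \<rho> by (auto simp: r_def)
  define \<gamma> where "\<gamma> = (\<lambda>z. q * z) \<circ> circlepath 0 r"
  have vp: "valid_path \<gamma>"
    unfolding \<gamma>_def by (rule valid_path_compose_holomorphic[of _ _ UNIV]) (auto intro!: holomorphic_intros)
  have closed: "pathfinish \<gamma> = pathstart \<gamma>"
    by (simp add: \<gamma>_def pathfinish_compose pathstart_compose)
  have im: "path_image \<gamma> \<subseteq> sphere 0 (norm q * r)"
    using r by (auto simp: \<gamma>_def path_image_compose norm_mult)
  then have im': "path_image \<gamma> \<subseteq> punctured \<rho>" using r q by auto
  have sub: "contour_integral \<gamma> h = contour_integral (circlepath 0 r) (\<lambda>w. q * h (q * w))" for h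
  proof -
    have "contour_integral \<gamma> h = contour_integral (circlepath 0 r) (\<lambda>w. deriv (\<lambda>z. q * z) w * h (q * w))"
      unfolding \<gamma>_def
      by (rule contour_integral_comp_analyticW[of _ UNIV]) (auto intro!: analytic_intros)
    also have "deriv (\<lambda>z. q * z) = (\<lambda>w. q)"
      by (intro ext DERIV_imp_deriv) (auto intro!: derivative_eq_intros)
    finally show ?thesis .
  qed
  have "winding_number \<gamma> 0 = 1 / (2 * pi * \<i>) * contour_integral \<gamma> (\<lambda>w. 1 / (w - 0))"
    by (rule winding_number_valid_path) (use vp im' in auto)
  also have "contour_integral \<gamma> (\<lambda>w. 1 / (w - 0)) = contour_integral (circlepath 0 r) (\<lambda>w. 1 / (w - 0))"
    unfolding sub using q by simp
  also have "1 / (2 * pi * \<i>) * \<dots> = winding_number (circlepath 0 r) 0"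
    by (rule winding_number_valid_path[symmetric]) (use r in auto)
  finally have wn: "winding_number \<gamma> 0 = 1"
    using r by (simp add: winding_number_circlepath_centre)
  have "contour_integral \<gamma> g = 2 * pi * \<i> * (\<Sum>p\<in>{0}. winding_number \<gamma> p * residue g p)"
  proof (rule Residue_theorem[of "ball 0 \<rho>"])
    show "\<forall>z. z \<notin> ball 0 \<rho> \<longrightarrow> winding_number \<gamma> z = 0"
      using vp im' closed
      by (intro allI impI winding_number_zero_outside[of _ "ball 0 \<rho>"]) (auto simp: valid_path_imp_path)
  qed (use vp im' closed g in auto)
  then have "contour_integral (circlepath 0 r) (\<lambda>z. q * g (q * z)) = 2 * pi * \<i> * residue g 0"
    by (simp add: sub wn)
  moreover have "((\<lambda>z. q * g (q * z)) has_contour_integral 2 * pi * \<i> * residue (\<lambda>z. q * g (q * z)) 0) (circlepath 0 r)"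
  proof (rule base_residue[of "ball 0 (\<rho> / norm q)"])
    show "(\<lambda>z. q * g (q * z)) holomorphic_on ball 0 (\<rho> / norm q) - {0}"
      using q by (intro holomorphic_intros holomorphic_on_compose_gen[OF _ g, of "\<lambda>z. q * z", unfolded o_def])
        (auto simp: norm_mult field_simps)
    show "cball 0 r \<subseteq> ball 0 (\<rho> / norm q)"
    proof -
      have "r < \<rho> / norm q" using q \<rho> by (simp add: r_def field_simps)
      then show ?thesis by auto
    qed
  qed (use q r \<rho> in auto)
  ultimately show ?thesis
    by (simp add: contour_integral_unique)
qed

lemma laurent_coeff_rescale:
  assumes q: "q \<noteq> 0" and \<rho>: "\<rho> > 0" and f: "f holomorphic_on punctured \<rho>"
  shows "laurent_coeff (\<lambda>z. f (q * z)) n = q powi n * laurent_coeff f n"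
proof -
  define g where "g = (\<lambda>w. q powi n * (f w * w powi (- n - 1)))"
  have hol: "(\<lambda>z. f z * z powi (- n - 1)) holomorphic_on punctured \<rho>"
    by (intro laurent_integrand_holomorphic f)
  have "laurent_coeff (\<lambda>z. f (q * z)) n = residue (\<lambda>z. q * g (q * z)) 0"
    unfolding laurent_coeff_def g_def using q
    by (intro arg_cong2[where f = residue] ext refl)
       (simp add: power_int_mult_distrib power_int_diff power_int_minus)
  also have "\<dots> = residue g 0"
    unfolding g_def by (rule residue_rescale[OF q \<rho>]) (intro holomorphic_intros hol)
  also have "\<dots> = q powi n * laurent_coeff f n"
    unfolding laurent_coeff_def g_def
    by (rule residue_lmul[of "ball 0 \<rho>"]) (use \<rho> hol in auto)
  finally show ?thesis .
qed

lemma telescope_sums: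
  fixes f :: "nat \<Rightarrow> 'a::real_normed_vector"
  assumes "f \<longlonglongrightarrow> l" shows "(\<lambda>n. f n - f (Suc n)) sums (f 0 - l)"
proof -
  have "(\<lambda>n. \<Sum>i<n. f i - f (Suc i)) = (\<lambda>n. f 0 - f n)"
    by (simp add: sum_lessThan_telescope')
  then show ?thesis unfolding sums_def using assms by (auto intro!: tendsto_intros)
qed

text \<open>
  The hypothesis is Cauchy's estimate on every circle: a radius larger than \<open>\<bar>z\<bar>\<close> controls the
  coefficients of high index, a smaller one those of very negative index.
\<close>

lemma laurent_remainder_tendsto_0:
  fixes b :: "int \<Rightarrow> complex"
  assumes bnd: "\<And>r. 0 < r \<Longrightarrow> r < \<rho> \<Longrightarrow> \<exists>M\<ge>0. \<forall>n. norm (b n) \<le> M * r powi (- n)"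
    and z: "z \<in> punctured \<rho>"
  shows "(\<lambda>n. b (int n + a) * z ^ n) \<longlonglongrightarrow> 0"
    and "(\<lambda>n. b (a - int n) * (1 / z) ^ n) \<longlonglongrightarrow> 0"
proof -
  have z0: "0 < norm z" "norm z < \<rho>" using z by auto
  then obtain r where r: "norm z < r" "r < \<rho>" using dense by blast
  obtain r' where r': "0 < r'" "r' < norm z" using dense z0 by blast
  have r0: "r > 0" using r z0 by linarith
  obtain M where M: "\<And>n. norm (b n) \<le> M * r powi (- n)" using bnd[of r] r z0 by auto
  obtain M' where M': "\<And>n. norm (b n) \<le> M' * r' powi (- n)" using bnd[of r'] r' z0 by auto
  show "(\<lambda>n. b (int n + a) * z ^ n) \<longlonglongrightarrow> 0"
  proof (rule Lim_null_comparison)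
    show "\<forall>\<^sub>F n in sequentially. norm (b (int n + a) * z ^ n) \<le> M * r powi (- a) * (norm z / r) ^ n"
    proof (intro always_eventually allI)
      fix n
      have "norm (b (int n + a) * z ^ n) \<le> M * r powi (- (int n + a)) * norm z ^ n"
        unfolding norm_mult norm_power by (intro mult_right_mono M) auto
      also have "\<dots> = M * r powi (- a) * (norm z / r) ^ n"
        using r0 z0 by (simp add: power_int_add power_int_diff power_int_minus field_simps)
      finally show "norm (b (int n + a) * z ^ n) \<le> M * r powi (- a) * (norm z / r) ^ n" .
    qed
    show "(\<lambda>n. M * r powi (- a) * (norm z / r) ^ n) \<longlonglongrightarrow> 0"
      using r r0 by (intro tendsto_mult_right_zero LIMSEQ_power_zero) auto
  qed
  show "(\<lambda>n. b (a - int n) * (1 / z) ^ n) \<longlonglongrightarrow> 0"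
  proof (rule Lim_null_comparison)
    show "\<forall>\<^sub>F n in sequentially. norm (b (a - int n) * (1 / z) ^ n) \<le> M' * r' powi (- a) * (r' / norm z) ^ n"
    proof (intro always_eventually allI)
      fix n
      have "norm (b (a - int n) * (1 / z) ^ n) \<le> M' * r' powi (- (a - int n)) * (1 / norm z) ^ n"
        unfolding norm_mult norm_power norm_divide norm_one by (intro mult_right_mono M') auto
      also have "\<dots> = M' * r' powi (- a) * (r' / norm z) ^ n"
        using r' z0 by (simp add: power_int_add power_int_diff power_int_minus field_simps)
      finally show "norm (b (a - int n) * (1 / z) ^ n) \<le> M' * r' powi (- a) * (r' / norm z) ^ n" .
    qed
    show "(\<lambda>n. M' * r' powi (- a) * (r' / norm z) ^ n) \<longlonglongrightarrow> 0"
      using r' z0 by (intro tendsto_mult_right_zero LIMSEQ_power_zero) auto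
  qed
qed

text \<open>
  The two halves are separate power series, in \<open>z\<close> and in \<open>1 / z\<close>, so that their convergence and
  holomorphy follow from the theory of power series.
\<close>

definition laurent_sum :: "(int \<Rightarrow> complex) \<Rightarrow> complex \<Rightarrow> complex" where
  "laurent_sum c z = (\<Sum>n. c (int n) * z ^ n) + (\<Sum>n. c (- int n - 1) * (1 / z) ^ Suc n)"

text \<open>
  Let \<open>\<phi>\<close> be the difference quotient of \<open>f\<close> at the point \<open>z\<close>, again holomorphic, and \<open>b\<^sub>n\<close> its
  coefficients.  Comparing coefficients in \<open>f w = f z + (w - z) \<phi> w\<close> shows that
  \<open>a\<^sub>n z\<^sup>n = b\<^sub>n\<^sub>-\<^sub>1 z\<^sup>n - b\<^sub>n z^(n + 1)\<close> for \<open>n \<noteq> 0\<close>, with an extra \<open>f z\<close> for \<open>n = 0\<close>: the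
  Laurent series of \<open>f\<close> telescopes to \<open>f z\<close>.
\<close>

theorem laurent_expansion_punctured:
  assumes f: "f holomorphic_on punctured \<rho>" and z: "z \<in> punctured \<rho>"
  shows "f z = laurent_sum (laurent_coeff f) z"
proof -
  have \<rho>: "\<rho> > 0" using z by (auto simp: dist_norm) (smt (verit) norm_ge_zero)
  define \<phi> where "\<phi> = (\<lambda>w. if w = z then deriv f z else (f w - f z) / (w - z))"
  have \<phi>: "\<phi> holomorphic_on punctured \<rho>"
    unfolding \<phi>_def by (rule pole_lemma_open[OF f]) auto
  define b where "b = laurent_coeff \<phi>"
  have coeff: "laurent_coeff f n = b (n - 1) - z * b n + (if n = 0 then f z else 0)" for n
  proof -
    have "laurent_coeff f n = laurent_coeff (\<lambda>w. (w * \<phi> w + (- z) * \<phi> w) + f z) n"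
      by (rule laurent_coeff_punctured_cong[OF \<rho>]) (auto simp: \<phi>_def field_simps)
    also have "\<dots> = b (n - 1) - z * b n + (if n = 0 then f z else 0)"
      unfolding b_def
      by (subst laurent_coeff_add[OF \<rho>], (intro holomorphic_intros \<phi>)+)+
         (simp add: laurent_coeff_times_z laurent_coeff_cmult[OF \<rho> \<phi>, of "- z", simplified] laurent_coeff_const)
    finally show ?thesis .
  qed
  have bnd: "\<exists>M\<ge>0. \<forall>n. norm (b n) \<le> M * r powi (- n)" if "0 < r" "r < \<rho>" for r
    unfolding b_def using laurent_coeff_bound[OF \<phi> that] .
  have "(\<lambda>n. b (int n - 1) * z ^ n - b (int (Suc n) - 1) * z ^ Suc n) sums (b (int 0 - 1) * z ^ 0 - 0)"
    using laurent_remainder_tendsto_0(1)[OF bnd z, of "-1"] by (intro telescope_sums) simp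
  moreover have "(\<lambda>n. if n = 0 then f z else 0) sums f z"
    using sums_single[of 0 "\<lambda>_. f z"] by simp
  ultimately have "(\<lambda>n. (b (int n - 1) * z ^ n - b (int (Suc n) - 1) * z ^ Suc n) + (if n = 0 then f z else 0))
      sums (b (int 0 - 1) * z ^ 0 - 0 + f z)"
    by (rule sums_add)
  moreover have "(\<lambda>n. (b (int n - 1) * z ^ n - b (int (Suc n) - 1) * z ^ Suc n) + (if n = 0 then f z else 0))
      = (\<lambda>n. laurent_coeff f (int n) * z ^ n)"
    by (auto simp: fun_eq_iff coeff algebra_simps)
  ultimately have pos: "(\<lambda>n. laurent_coeff f (int n) * z ^ n) sums (b (-1) + f z)"
    by simp
  have "(\<lambda>n. b (-1 - int n) * (1 / z) ^ n - b (-1 - int (Suc n)) * (1 / z) ^ Suc n)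
      sums (b (-1 - int 0) * (1 / z) ^ 0 - 0)"
    by (intro telescope_sums laurent_remainder_tendsto_0(2)[OF bnd z])
  then have "(\<lambda>n. - (b (-1 - int n) * (1 / z) ^ n - b (-1 - int (Suc n)) * (1 / z) ^ Suc n)) sums (- b (-1))"
    by (intro sums_minus) simp
  then have neg: "(\<lambda>n. laurent_coeff f (- int n - 1) * (1 / z) ^ Suc n) sums (- b (-1))"
  proof (rule sums_cong[THEN iffD1, rotated])
    fix n
    have "b (- int n - 1) = b (-1 - int n)" "b (- int n - 1 - 1) = b (-1 - int (Suc n))"
      by (rule arg_cong[where f = b], simp)+
    then show "- (b (-1 - int n) * (1 / z) ^ n - b (-1 - int (Suc n)) * (1 / z) ^ Suc n)
        = laurent_coeff f (- int n - 1) * (1 / z) ^ Suc n"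
      using z by (simp add: coeff field_simps)
  qed
  show ?thesis
    unfolding laurent_sum_def sums_unique[OF pos, symmetric] sums_unique[OF neg, symmetric] by simp
qed

lemma laurent_halves_summable:
  assumes bnd: "\<And>r. 0 < r \<Longrightarrow> r < \<rho> \<Longrightarrow> \<exists>M\<ge>0. \<forall>n. norm (c n) \<le> M * r powi (- n)"
    and \<rho>: "\<rho> > 0"
  shows "z \<in> ball 0 \<rho> \<Longrightarrow> summable (\<lambda>n. c (int n) * z ^ n)"
    and "summable (\<lambda>n. c (- int n - 1) * (w::complex) ^ n)"
proof -
  show "summable (\<lambda>n. c (int n) * z ^ n)" if "z \<in> ball 0 \<rho>"
  proof -
    from that obtain r where r: "norm z < r" "r < \<rho>" using dense[of "norm z" \<rho>] by auto
    then have r0: "r > 0" using norm_ge_zero[of z] by linarith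
    obtain M where M: "M \<ge> 0" "\<And>n. norm (c n) \<le> M * r powi (- n)" using bnd[of r] r r0 by auto
    show ?thesis
    proof (rule summable_comparison_test')
      show "summable (\<lambda>n. M * (norm z / r) ^ n)"
        using r r0 by (intro summable_mult summable_geometric) auto
      fix n
      have "norm (c (int n) * z ^ n) \<le> M * r powi (- int n) * norm z ^ n"
        unfolding norm_mult norm_power by (intro mult_right_mono M) auto
      then show "norm (c (int n) * z ^ n) \<le> M * (norm z / r) ^ n"
        using r0 by (simp add: power_int_minus field_simps)
    qed
  qed
  define r where "r = min (\<rho> / 2) (1 / (2 * (norm w + 1)))"
  have r: "0 < r" "r < \<rho>" "r * norm w < 1"
  proof -
    have "0 < norm w + 1" using norm_ge_zero[of w] by linarith
    then show r0: "0 < r" using \<rho> by (auto simp: r_def)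
    show "r < \<rho>" using \<rho> by (auto simp: r_def)
    have "r * norm w \<le> 1 / (2 * (norm w + 1)) * norm w"
      by (intro mult_right_mono) (auto simp: r_def)
    also have "\<dots> < 1" using \<open>0 < norm w + 1\<close> by (simp add: field_simps)
    finally show "r * norm w < 1" .
  qed
  obtain M where M: "M \<ge> 0" "\<And>n. norm (c n) \<le> M * r powi (- n)" using bnd[of r] r by auto
  show "summable (\<lambda>n. c (- int n - 1) * w ^ n)"
  proof (rule summable_comparison_test')
    show "summable (\<lambda>n. M * r * (r * norm w) ^ n)"
      using r by (intro summable_mult summable_geometric) auto
    fix n
    have "norm (c (- int n - 1) * w ^ n) \<le> M * r powi (- (- int n - 1)) * norm w ^ n"
      unfolding norm_mult norm_power by (intro mult_right_mono M) auto
    then show "norm (c (- int n - 1) * w ^ n) \<le> M * r * (r * norm w) ^ n"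
      using r by (simp add: power_int_add field_simps)
  qed
qed

text \<open>
  The estimates for small radii make the series in \<open>1 / z\<close> entire.
\<close>

lemma laurent_sum_holomorphic:
  assumes bnd: "\<And>r. 0 < r \<Longrightarrow> r < \<rho> \<Longrightarrow> \<exists>M\<ge>0. \<forall>n. norm (c n) \<le> M * r powi (- n)"
    and \<rho>: "\<rho> > 0"
  shows "laurent_sum c holomorphic_on punctured \<rho>"
proof -
  have 1: "(\<lambda>z. \<Sum>n. c (int n) * z ^ n) holomorphic_on ball 0 \<rho>"
  proof (rule power_series_holomorphic)
    fix w :: complex assume "w \<in> ball 0 \<rho>"
    from laurent_halves_summable(1)[OF bnd \<rho> this]
    show "(\<lambda>n. c (int n) * (w - 0) ^ n) sums (\<Sum>n. c (int n) * w ^ n)"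
      by (simp add: summable_sums)
  qed
  have 2: "(\<lambda>w. \<Sum>n. c (- int n - 1) * w ^ n) holomorphic_on UNIV"
  proof -
    have "(\<lambda>w. \<Sum>n. c (- int n - 1) * w ^ n) holomorphic_on ball 0 R" for R
      by (rule power_series_holomorphic[of 0 R "\<lambda>n. c (- int n - 1)"])
         (use laurent_halves_summable(2)[OF bnd \<rho>] in \<open>simp add: summable_sums\<close>)
    then have "(\<lambda>w. \<Sum>n. c (- int n - 1) * w ^ n) analytic_on ball 0 R" for R
      by (simp add: analytic_on_open)
    then have "(\<lambda>w. \<Sum>n. c (- int n - 1) * w ^ n) analytic_on (\<Union>R. ball 0 R)"
      by (subst analytic_on_UN) blast
    then have "(\<lambda>w. \<Sum>n. c (- int n - 1) * w ^ n) analytic_on UNIV"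
      by (rule analytic_on_subset) (auto intro: gt_ex)
    then show ?thesis by (rule analytic_imp_holomorphic)
  qed
  \<comment> \<open>The series in 1 / z starts with its first power, hence the extra factor w.\<close>
  have 3: "(\<lambda>w. w * (\<Sum>n. c (- int n - 1) * w ^ n)) = (\<lambda>w. \<Sum>n. c (- int n - 1) * w ^ Suc n)"
  proof
    fix w
    show "w * (\<Sum>n. c (- int n - 1) * w ^ n) = (\<Sum>n. c (- int n - 1) * w ^ Suc n)"
      using suminf_mult[OF laurent_halves_summable(2)[OF bnd \<rho>, of w], of w]
      by (simp add: mult_ac)
  qed
  have 4: "(\<lambda>w. \<Sum>n. c (- int n - 1) * w ^ Suc n) holomorphic_on UNIV"
    unfolding 3[symmetric] by (intro holomorphic_intros 2)
  have "(\<lambda>z. \<Sum>n. c (- int n - 1) * (1 / z) ^ Suc n) holomorphic_on punctured \<rho>"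
    by (rule holomorphic_on_compose_gen[OF _ 4, of "\<lambda>z. 1 / z", unfolded o_def]) (intro holomorphic_intros | simp)+
  then show ?thesis
    unfolding laurent_sum_def
    by (intro holomorphic_intros holomorphic_on_subset[OF 1]) auto
qed

text \<open>
  The quotient tends to \<open>1 / s\<close> for \<open>n \<rightarrow> \<infinity>\<close> and to \<open>0\<close> for \<open>n \<rightarrow> -\<infinity>\<close>.  A vanishing denominator
  is harmless because division by zero gives zero.
\<close>

lemma q_multiplier_bounded:
  fixes s t q :: complex
  assumes q: "norm q > 1" and s: "s \<noteq> 0" and t: "t \<noteq> 0"
  shows "\<exists>K\<ge>0. \<forall>n. norm (q powi n / (s * q powi n - t)) \<le> K"
proof -
  have q0: "q \<noteq> 0" using q by auto
  have inv: "(\<lambda>n. (1 / q) ^ n) \<longlonglongrightarrow> 0"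
    using q by (intro LIMSEQ_power_zero) (auto simp: norm_divide divide_less_eq)
  have "(\<lambda>n. 1 / (s - t * (1 / q) ^ n)) \<longlonglongrightarrow> 1 / (s - t * 0)"
    by (intro tendsto_intros inv) (use s in auto)
  then have "Bseq (\<lambda>n. 1 / (s - t * (1 / q) ^ n))"
    using convergentI convergent_imp_Bseq by blast
  then obtain K1 where K1: "K1 > 0" "\<And>n. norm (1 / (s - t * (1 / q) ^ n)) \<le> K1"
    by (auto simp: Bseq_def)
  have "(\<lambda>n. (1 / q) ^ n / (s * (1 / q) ^ n - t)) \<longlonglongrightarrow> 0 / (s * 0 - t)"
    by (intro tendsto_intros inv) (use t in auto)
  then have "Bseq (\<lambda>n. (1 / q) ^ n / (s * (1 / q) ^ n - t))"
    using convergentI convergent_imp_Bseq by blast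
  then obtain K2 where K2: "K2 > 0" "\<And>n. norm ((1 / q) ^ n / (s * (1 / q) ^ n - t)) \<le> K2"
    by (auto simp: Bseq_def)
  show ?thesis
  proof (intro exI[of _ "max K1 K2"] conjI allI)
    fix n :: int
    show "norm (q powi n / (s * q powi n - t)) \<le> max K1 K2"
    proof (cases n)
      case (nonneg m)
      have "q powi n / (s * q powi n - t) = 1 / (s - t * (1 / q) ^ m)"
      proof (cases "s * q ^ m = t")
        case True then show ?thesis using nonneg q0 by (auto simp: field_simps)
      next
        case False
        then have "s - t * (1 / q) ^ m \<noteq> 0" using q0 by (auto simp: field_simps)
        then show ?thesis using nonneg q0 False by (simp add: field_simps)
      qed
      then show ?thesis using K1(2)[of m] by (simp add: le_max_iff_disj)
    next
      case (neg m)
      then have "q powi n = (1 / q) ^ Suc m"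
        by (metis inverse_eq_divide power_int_minus power_int_of_nat power_inverse)
      then show ?thesis using K2(2)[of "Suc m"] by (simp only: le_max_iff_disj) simp
    qed
  qed (use K1 in auto)
qed

text \<open>
  The solution of \<open>s X(qz) - t X(z) = W(z)\<close>, obtained by dividing Laurent coefficients.  It is an explicit
  expression in the germ of \<open>W\<close> at the puncture, so that one and the same function serves on
  every punctured disc on which \<open>W\<close> is holomorphic.
\<close>

definition q_solve :: "complex \<Rightarrow> complex \<Rightarrow> complex \<Rightarrow> (complex \<Rightarrow> complex) \<Rightarrow> complex \<Rightarrow> complex" where
  "q_solve q s t W = laurent_sum (\<lambda>n. laurent_coeff W n / (s * q powi n - t))"

text \<open>
  The factor \<open>q powi n\<close> in the bound of the multiplier is what enlarges the disc by \<open>norm q\<close>.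
\<close>

theorem q_solve:
  assumes q: "norm q > 1" and s: "s \<noteq> 0" and t: "t \<noteq> 0" and nr: "\<And>n. s * q powi n \<noteq> t"
    and \<rho>: "\<rho> > 0" and W: "W holomorphic_on punctured \<rho>"
  shows "q_solve q s t W holomorphic_on punctured (norm q * \<rho>)"
    and "z \<in> punctured \<rho> \<Longrightarrow> s * q_solve q s t W (q * z) - t * q_solve q s t W z = W z"
proof -
  define w where "w = laurent_coeff W"
  define c where "c = (\<lambda>n. w n / (s * q powi n - t))"
  have q0: "q \<noteq> 0" using q by auto
  obtain K where K: "K \<ge> 0" "\<And>n. norm (q powi n / (s * q powi n - t)) \<le> K"
    using q_multiplier_bounded[OF q s t] by blast
  have bnd: "\<exists>M\<ge>0. \<forall>n. norm (c n) \<le> M * r powi (- n)" if r: "0 < r" "r < norm q * \<rho>" for r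
  proof -
    have r': "0 < r / norm q" "r / norm q < \<rho>" using r q q0 by (auto simp: field_simps)
    obtain M where M: "M \<ge> 0" "\<And>n. norm (w n) \<le> M * (r / norm q) powi (- n)"
      using laurent_coeff_bound[OF W r'] by (auto simp: w_def)
    show ?thesis
    proof (intro exI[of _ "K * M"] conjI allI)
      fix n
      have "norm (c n) = norm (q powi n / (s * q powi n - t)) * (norm (w n) * norm q powi (- n))"
        using q0 by (simp add: c_def norm_mult norm_divide norm_power_int power_int_minus)
      also have "\<dots> \<le> K * ((M * (r / norm q) powi (- n)) * norm q powi (- n))"
        by (intro mult_mono mult_right_mono K M) (auto intro: K)
      also have "\<dots> = K * M * r powi (- n)"
        using q0 r by (simp add: power_int_divide_distrib power_int_minus field_simps)
      finally show "norm (c n) \<le> K * M * r powi (- n)" .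
    qed (use K M in auto)
  qed
  have q\<rho>: "norm q * \<rho> > 0" using \<rho> q0 by simp
  have eq: "q_solve q s t W = laurent_sum c" by (simp add: q_solve_def c_def w_def)
  show "q_solve q s t W holomorphic_on punctured (norm q * \<rho>)"
    unfolding eq by (rule laurent_sum_holomorphic[OF bnd q\<rho>])
  assume z: "z \<in> punctured \<rho>"
  have zq: "q * z \<in> ball 0 (norm q * \<rho>)" using z q0 by (auto simp: norm_mult)
  have zz: "z \<in> ball 0 (norm q * \<rho>)"
  proof -
    have "1 * norm z \<le> norm q * norm z" using q by (intro mult_right_mono) auto
    then show ?thesis using zq by (auto simp: norm_mult)
  qed
  have cw: "(s * q powi n - t) * c n = w n" for n
    using nr[of n] by (simp add: c_def)
  note S1 = laurent_halves_summable(1)[OF bnd q\<rho>] and S2 = laurent_halves_summable(2)[OF bnd q\<rho>]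
  have T2: "summable (\<lambda>n. c (- int n - 1) * x ^ Suc n)" for x
    using summable_mult[OF S2[of x], of x] by (simp add: mult_ac)
  have pos: "s * (\<Sum>n. c (int n) * (q * z) ^ n) - t * (\<Sum>n. c (int n) * z ^ n) = (\<Sum>n. w (int n) * z ^ n)"
  proof -
    have "(\<lambda>n. s * (c (int n) * (q * z) ^ n) - t * (c (int n) * z ^ n)) sums
        (s * (\<Sum>n. c (int n) * (q * z) ^ n) - t * (\<Sum>n. c (int n) * z ^ n))"
      by (intro sums_diff sums_mult summable_sums S1 zq zz)
    also have "(\<lambda>n. s * (c (int n) * (q * z) ^ n) - t * (c (int n) * z ^ n)) = (\<lambda>n. w (int n) * z ^ n)"
      by (auto simp: fun_eq_iff cw[symmetric] power_mult_distrib algebra_simps)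
    finally show ?thesis by (rule sums_unique)
  qed
  have neg: "s * (\<Sum>n. c (- int n - 1) * (1 / (q * z)) ^ Suc n) - t * (\<Sum>n. c (- int n - 1) * (1 / z) ^ Suc n)
      = (\<Sum>n. w (- int n - 1) * (1 / z) ^ Suc n)"
  proof -
    have "(\<lambda>n. s * (c (- int n - 1) * (1 / (q * z)) ^ Suc n) - t * (c (- int n - 1) * (1 / z) ^ Suc n)) sums
        (s * (\<Sum>n. c (- int n - 1) * (1 / (q * z)) ^ Suc n) - t * (\<Sum>n. c (- int n - 1) * (1 / z) ^ Suc n))"
      by (intro sums_diff sums_mult summable_sums T2)
    also have "(\<lambda>n. s * (c (- int n - 1) * (1 / (q * z)) ^ Suc n) - t * (c (- int n - 1) * (1 / z) ^ Suc n))
        = (\<lambda>n. w (- int n - 1) * (1 / z) ^ Suc n)"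
    proof
      fix n
      have "q powi (- int n - 1) = (1 / q) ^ Suc n"
        using q0 by (simp add: power_int_diff power_int_minus field_simps)
      then show "s * (c (- int n - 1) * (1 / (q * z)) ^ Suc n) - t * (c (- int n - 1) * (1 / z) ^ Suc n)
          = w (- int n - 1) * (1 / z) ^ Suc n"
        using cw[of "- int n - 1"] by (simp add: power_divide power_mult_distrib algebra_simps flip: cw)
    qed
    finally show ?thesis by (rule sums_unique)
  qed
  have "s * laurent_sum c (q * z) - t * laurent_sum c z = laurent_sum w z"
    using pos neg unfolding laurent_sum_def by (simp add: algebra_simps)
  then show "s * q_solve q s t W (q * z) - t * q_solve q s t W z = W z"
    unfolding eq w_def using laurent_expansion_punctured[OF W z] by simp
qed

text \<open>
  The radii differ because the equation may be known only near the puncture.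
\<close>

theorem q_homogeneous_unique:
  assumes q: "norm q > 1" and nr: "\<And>n. s * q powi n \<noteq> t"
    and \<rho>: "\<rho> > 0" "\<rho>' > 0" and H: "H holomorphic_on punctured \<rho>"
    and eq: "\<And>z. z \<in> punctured \<rho>' \<Longrightarrow> s * H (q * z) = t * H z"
    and z: "z \<in> punctured \<rho>"
  shows "H z = 0"
proof -
  have q0: "q \<noteq> 0" using q by auto
  have Hq: "(\<lambda>z. H (q * z)) holomorphic_on punctured (\<rho> / norm q)"
    using q0 by (intro holomorphic_on_compose_gen[OF _ H, of "\<lambda>z. q * z", unfolded o_def] holomorphic_intros)
      (auto simp: norm_mult field_simps)
  have "laurent_coeff H n = 0" for n
  proof -
    have "s * (q powi n * laurent_coeff H n) = laurent_coeff (\<lambda>z. s * H (q * z)) n"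
      using laurent_coeff_cmult[OF _ Hq] laurent_coeff_rescale[OF q0 \<rho>(1) H] \<rho> q0 by simp
    also have "\<dots> = laurent_coeff (\<lambda>z. t * H z) n"
      using eq by (intro laurent_coeff_punctured_cong[OF \<rho>(2)])
    also have "\<dots> = t * laurent_coeff H n"
      using laurent_coeff_cmult[OF \<rho>(1) H] by simp
    finally have "(s * q powi n - t) * laurent_coeff H n = 0" by (simp add: algebra_simps)
    then show ?thesis using nr[of n] by simp
  qed
  then show ?thesis
    using laurent_expansion_punctured[OF H z] by (simp add: laurent_sum_def)
qed

section \<open>A theta function with simple zeros on a spiral\<close>

definition euler_prod :: "complex \<Rightarrow> complex \<Rightarrow> complex" where
  "euler_prod q z = (\<Prod>n. 1 - z / q ^ n)"

text \<open>
  Jacobi's theta function in product form, up to a constant factor and the normalisation of its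
  zeros: they are the integer powers of \<open>q\<close>.
\<close>

definition theta :: "complex \<Rightarrow> complex \<Rightarrow> complex" where
  "theta q z = euler_prod q z * euler_prod q (1 / (q * z))"

lemma weierstrass_product_q_powers:
  assumes q: "norm q > 1" shows "weierstrass_product (\<lambda>n. q ^ n) (\<lambda>_. 0)"
proof
  show "q ^ n \<noteq> 0" for n using q by auto
  show "filterlim (\<lambda>n. q ^ n) at_infinity sequentially"
    using q by (intro filterlim_realpow_sequentially_gt1)
  fix r :: real assume "r > 0"
  have "summable (\<lambda>n. r * (1 / norm q) ^ n)"
    using q by (intro summable_mult summable_geometric) (auto simp: divide_less_eq)
  then show "summable (\<lambda>n. (r / norm (q ^ n)) ^ Suc 0)"
    by (simp add: norm_power power_divide)
qed

context
  fixes q :: complex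
  assumes q: "norm q > 1"
begin

interpretation W: weierstrass_product "\<lambda>n. q ^ n" "\<lambda>_. 0"
  by (rule weierstrass_product_q_powers[OF q])

lemma euler_prod_eq_weierstrass: "euler_prod q = W.f"
  by (simp add: fun_eq_iff euler_prod_def W.f_def weierstrass_factor_def)

lemma euler_prod_holomorphic: "euler_prod q holomorphic_on A"
  unfolding euler_prod_eq_weierstrass by (rule W.holomorphic)

lemma euler_prod_eq_0_iff: "euler_prod q z = 0 \<longleftrightarrow> z \<in> range (\<lambda>n. q ^ n)"
  unfolding euler_prod_eq_weierstrass by (rule W.zero)

lemma inj_q_power: "q ^ m = q ^ n \<longleftrightarrow> m = n"
proof
  assume "q ^ m = q ^ n"
  then have "norm q ^ m = norm q ^ n" by (metis norm_power)
  then show "m = n" using q by simp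
qed simp

lemma zorder_euler_prod_1: "zorder (euler_prod q) 1 = 1"
proof -
  have "(\<lambda>n. q ^ n) -` {1} = {0}" using inj_q_power[of _ 0] by auto
  then show ?thesis using W.zorder[of 1] by (simp add: euler_prod_eq_weierstrass)
qed

lemma euler_prod_shift: "euler_prod q (q * z) = (1 - q * z) * euler_prod q z"
proof (rule has_prod_unique2)
  have q0: "q \<noteq> 0" using q by auto
  have "(\<lambda>n. 1 - q * z / q ^ n) has_prod ((\<Prod>k<1. 1 - q * z / q ^ k) * (\<Prod>k. 1 - q * z / q ^ (k + 1)))"
    using W.convergent[of "q * z"]
    by (intro has_prod_ignore_initial_segment') (simp add: weierstrass_factor_def)
  also have "(\<lambda>k. 1 - q * z / q ^ (k + 1)) = (\<lambda>k. 1 - z / q ^ k)"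
    using q0 by (auto simp: fun_eq_iff)
  finally show "(\<lambda>n. 1 - q * z / q ^ n) has_prod ((1 - q * z) * euler_prod q z)"
    by (simp add: euler_prod_def)
  show "(\<lambda>n. 1 - q * z / q ^ n) has_prod euler_prod q (q * z)"
    using W.has_prod[of "q * z"] by (simp add: euler_prod_eq_weierstrass weierstrass_factor_def)
qed

text \<open>
  Passing from \<open>z\<close> to \<open>q z\<close> gains the factor \<open>1 - q z\<close> in the first product and loses
  \<open>1 - 1 / (q z)\<close> in the second one; their quotient is \<open>- q z\<close>.
\<close>

lemma theta_shift:
  assumes z: "z \<noteq> 0" shows "theta q (q * z) = - q * z * theta q z"
proof -
  have q0: "q \<noteq> 0" using q by auto
  define w where "w = 1 / (q * (q * z))"
  have w: "q * w = 1 / (q * z)" using q0 z by (simp add: w_def)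
  have "theta q (q * z) = (1 - q * z) * euler_prod q z * euler_prod q w"
    by (simp add: theta_def euler_prod_shift w_def)
  moreover have "theta q z = euler_prod q z * ((1 - q * w) * euler_prod q w)"
    by (simp add: theta_def flip: w euler_prod_shift)
  moreover have "1 - q * z = - q * z * (1 - q * w)" using q0 z by (simp add: w field_simps)
  ultimately show ?thesis by simp
qed

lemma theta_holomorphic: "theta q holomorphic_on - {0}"
proof -
  have q0: "q \<noteq> 0" using q by auto
  have "(\<lambda>z. euler_prod q (1 / (q * z))) holomorphic_on - {0}"
    using q0 by (intro holomorphic_on_compose_gen[OF _ euler_prod_holomorphic[of UNIV], of "\<lambda>z. 1 / (q * z)", unfolded o_def] holomorphic_intros) auto
  then show ?thesis unfolding theta_def by (intro holomorphic_intros euler_prod_holomorphic)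
qed

lemma theta_eq_0_iff:
  assumes z: "z \<noteq> 0" shows "theta q z = 0 \<longleftrightarrow> z \<in> q_powers q"
proof -
  have q0: "q \<noteq> 0" using q by auto
  have "euler_prod q (1 / (q * z)) = 0 \<longleftrightarrow> (\<exists>n::nat. z = q powi (- int n - 1))"
    using q0 z unfolding euler_prod_eq_0_iff
    by (auto simp: power_int_diff power_int_minus field_simps)
  moreover have "euler_prod q z = 0 \<longleftrightarrow> (\<exists>n::nat. z = q powi int n)"
    unfolding euler_prod_eq_0_iff by auto
  moreover have "(\<exists>m::int. P m) \<longleftrightarrow> (\<exists>n::nat. P (int n)) \<or> (\<exists>n::nat. P (- int n - 1))" for P
  proof safe
    fix m :: int assume m: "P m" "\<nexists>n. P (- int n - 1)"
    show "\<exists>n. P (int n)"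
    proof (cases "m \<ge> 0")
      case True then show ?thesis using m by (intro exI[of _ "nat m"]) auto
    next
      case False
      then have "P (- int (nat (- m - 1)) - 1)" using m by simp
      then show ?thesis using m by blast
    qed
  qed blast+
  from this[of "\<lambda>m. z = q powi m"] have "z \<in> q_powers q \<longleftrightarrow>
      (\<exists>n::nat. z = q powi int n) \<or> (\<exists>n::nat. z = q powi (- int n - 1))"
    by (auto simp: q_powers_def)
  ultimately show ?thesis by (auto simp: theta_def)
qed

lemma theta_analytic: "z \<noteq> 0 \<Longrightarrow> theta q analytic_on {z}"
  using theta_holomorphic analytic_at[of "theta q" z] by (metis ComplI open_Compl closed_singleton singletonD open_delete open_UNIV Compl_eq_Diff_UNIV)

lemma minus_one_notin_q_powers: "-1 \<notin> q_powers q"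
proof
  assume "-1 \<in> q_powers q"
  then obtain m :: int where m: "q powi m = -1" by (auto simp: q_powers_def)
  then have "norm q powi m = 1" by (metis norm_power_int norm_minus_cancel norm_one)
  then have "m = 0"
    using q power_int_strict_increasing[of 0 m "norm q"] power_int_strict_increasing[of m 0 "norm q"]
    by (cases m "0::int" rule: linorder_cases) auto
  with m show False by simp
qed

lemma theta_eventually_nonzero:
  assumes "z \<noteq> 0" shows "\<forall>\<^sub>F w in at z. theta q w \<noteq> 0"
proof -
  have "\<forall>\<^sub>F w in at z. theta q w \<noteq> 0 \<and> w \<in> - {0}"
  proof (rule non_zero_neighbour_alt[OF theta_holomorphic])
    show "connected (- {0::complex})"
      by (intro connected_punctured_universe) simp
    \<comment> \<open>A point off the zero set keeps theta from vanishing identically.\<close>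
    show "theta q (-1) \<noteq> 0" by (subst theta_eq_0_iff) (auto simp: minus_one_notin_q_powers)
  qed (use assms in auto)
  then show ?thesis by (rule eventually_mono) auto
qed

lemma zorder_theta_shift:
  assumes z: "z \<noteq> 0" shows "zorder (theta q) (q * z) = zorder (theta q) z"
proof -
  have q0: "q \<noteq> 0" using q by auto
  have "zorder (theta q) (q * z) = zorder (\<lambda>w. theta q (q * w)) z"
    using q0 z by (intro zorder_scale[symmetric] theta_analytic[THEN analytic_on_imp_meromorphic_on]) auto
  also have "\<dots> = zorder (\<lambda>w. (- q * w) * theta q w) z"
  proof (rule zorder_cong)
    show "\<forall>\<^sub>F w in at z. theta q (q * w) = (- q * w) * theta q w"
      using eventually_neq_at_within[of 0 z UNIV] by eventually_elim (simp add: theta_shift)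
  qed simp
  also have "\<dots> = zorder (\<lambda>w. - q * w) z + zorder (theta q) z"
  proof (rule zorder_times_analytic)
    show "\<forall>\<^sub>F w in at z. (- q * w) * theta q w \<noteq> 0"
      using theta_eventually_nonzero[OF z] eventually_neq_at_within[of 0 z UNIV]
      by eventually_elim (use q0 in auto)
  qed (use z in \<open>auto intro!: analytic_intros theta_analytic\<close>)
  also have "zorder (\<lambda>w. - q * w) z = 0"
    using q0 z by (intro zorder_eq_0I analytic_intros) auto
  finally show ?thesis by simp
qed

lemma zorder_theta_1: "zorder (theta q) 1 = 1"
proof -
  have q0: "q \<noteq> 0" using q by auto
  have nz: "euler_prod q (1 / (q * 1)) \<noteq> 0"
    unfolding euler_prod_eq_0_iff
  proof
    assume "1 / (q * 1) \<in> range (\<lambda>n. q ^ n)"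
    then obtain n where "q ^ Suc n = q ^ 0" using q0 by (auto simp: field_simps)
    then show False unfolding inj_q_power by simp
  qed
  have "(\<lambda>z. euler_prod q (1 / (q * z))) analytic_on {1}"
    using q0 euler_prod_holomorphic[of UNIV]
    by (intro analytic_on_compose[of "\<lambda>z. 1 / (q * z)" _ "euler_prod q", unfolded o_def] analytic_intros)
       (auto intro: analytic_on_subset simp: analytic_on_open[of UNIV, symmetric])
  moreover have "euler_prod q analytic_on {1}"
    using euler_prod_holomorphic[of UNIV] analytic_at by blast
  ultimately have "zorder (theta q) 1 = zorder (euler_prod q) 1 + zorder (\<lambda>z. euler_prod q (1 / (q * z))) 1"
    unfolding theta_def using theta_eventually_nonzero[of 1]
    by (intro zorder_times_analytic) (auto simp: theta_def)
  also have "zorder (\<lambda>z. euler_prod q (1 / (q * z))) 1 = 0"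
    by (intro zorder_eq_0I) fact+
  finally show ?thesis by (simp add: zorder_euler_prod_1)
qed

text \<open>
  All zeros lie on the orbit of \<open>1\<close>, and the functional equation carries the order from one point
  of an orbit to the next.
\<close>

lemma zorder_theta:
  assumes z: "z \<noteq> 0" shows "zorder (theta q) z = (if z \<in> q_powers q then 1 else 0)"
proof (cases "z \<in> q_powers q")
  case False
  then show ?thesis using z by (simp add: zorder_eq_0I theta_analytic theta_eq_0_iff)
next
  case True
  then obtain m :: int where m: "z = q powi m" by (auto simp: q_powers_def)
  have q0: "q \<noteq> 0" using q by auto
  have "zorder (theta q) (q powi m) = 1"
  proof (induction m rule: int_induct[of _ 0])
    case base show ?case by (simp add: zorder_theta_1)
  next
    case (step1 i)
    then show ?case using zorder_theta_shift[of "q powi i"] q0 by (simp add: power_int_add mult.commute)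
  next
    case (step2 i)
    then show ?case using zorder_theta_shift[of "q powi (i - 1)"] q0 by (simp add: power_int_diff)
  qed
  then show ?thesis using True m by simp
qed

section \<open>Theta functions attached to effective divisors\<close>

lemma normal_q_powers: "q_powers q \<lhd> Cstar"
proof -
  interpret C: comm_group Cstar by (rule comm_group_Cstar)
  have q0: "q \<noteq> 0" using q by auto
  have "subgroup (q_powers q) Cstar"
  proof (rule C.subgroupI)
    fix a assume "a \<in> q_powers q"
    then obtain m where m: "a = q powi m" by (auto simp: q_powers_def)
    have "inv\<^bsub>Cstar\<^esub> a = q powi (- m)"
      by (rule C.inv_equality) (use q0 m in \<open>auto simp: Cstar_def power_int_minus\<close>)
    then show "inv\<^bsub>Cstar\<^esub> a \<in> q_powers q" by (simp add: q_powers_def)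
  next
    fix a b assume "a \<in> q_powers q" "b \<in> q_powers q"
    then obtain m n where "a = q powi m" "b = q powi n" by (auto simp: q_powers_def)
    then have "a \<otimes>\<^bsub>Cstar\<^esub> b = q powi (m + n)"
      using q0 by (simp add: Cstar_def power_int_add)
    then show "a \<otimes>\<^bsub>Cstar\<^esub> b \<in> q_powers q" by (simp add: q_powers_def)
  qed (use q0 in \<open>auto simp: q_powers_def Cstar_def\<close>)
  then show ?thesis by (rule C.subgroup_imp_normal)
qed

lemma proj_E_hom: "proj_E q \<in> hom Cstar (E_q q)"
  using normal.r_coset_hom_Mod[OF normal_q_powers] by (simp add: proj_E_def[abs_def] E_q_def)

lemma proj_E_eq_iff:
  assumes "a \<noteq> 0" "b \<noteq> 0"
  shows "proj_E q a = proj_E q b \<longleftrightarrow> a / b \<in> q_powers q"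
proof -
  have q0: "q \<noteq> 0" using q by auto
  have mem: "x \<in> proj_E q y \<longleftrightarrow> x / y \<in> q_powers q" if "y \<noteq> 0" for x y
  proof -
    have "x \<in> proj_E q y \<longleftrightarrow> (\<exists>h\<in>q_powers q. x = h * y)"
      by (auto simp: proj_E_def r_coset_def Cstar_def)
    also have "\<dots> \<longleftrightarrow> (\<exists>h\<in>q_powers q. h = x / y)"
      using that by (intro bex_cong refl) (auto simp: field_simps)
    finally show ?thesis by auto
  qed
  have self: "x \<in> proj_E q x" if "x \<noteq> 0" for x
    unfolding mem[OF that] using that by (auto simp: q_powers_def intro: range_eqI[of _ _ 0])
  have mult: "x * y \<in> q_powers q" if "x \<in> q_powers q" "y \<in> q_powers q" for x y
    using that q0 by (auto simp: q_powers_def power_int_add[symmetric])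
  have inv: "inverse x \<in> q_powers q" if "x \<in> q_powers q" for x
    using that by (auto simp: q_powers_def power_int_minus[symmetric])
  show ?thesis
  proof
    assume "proj_E q a = proj_E q b"
    then show "a / b \<in> q_powers q" using self[of a] mem[of b] assms by auto
  next
    assume ab: "a / b \<in> q_powers q"
    have "x / a \<in> q_powers q \<longleftrightarrow> x / b \<in> q_powers q" for x
      using mult[OF _ ab, of "x / a"] mult[OF _ inv[OF ab], of "x / b"] assms by (auto simp: field_simps)
    then show "proj_E q a = proj_E q b" using mem assms by auto
  qed
qed

definition lift_E :: "complex set \<Rightarrow> complex" where
  "lift_E \<alpha> = (SOME a. a \<noteq> 0 \<and> proj_E q a = \<alpha>)"

lemma lift_E:
  assumes "\<alpha> \<in> carrier (E_q q)" shows "lift_E \<alpha> \<noteq> 0" "proj_E q (lift_E \<alpha>) = \<alpha>"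
proof -
  have "\<exists>a. a \<noteq> 0 \<and> proj_E q a = \<alpha>"
    using assms by (auto simp: E_q_def FactGroup_def RCOSETS_def proj_E_def Cstar_def)
  from someI_ex[OF this] show "lift_E \<alpha> \<noteq> 0" "proj_E q (lift_E \<alpha>) = \<alpha>"
    by (auto simp: lift_E_def)
qed

text \<open>
  The projection from the multiplicative group is a homomorphism, so the evaluation of a divisor
  can be computed with representatives.
\<close>

lemma ev_E_eq_proj_E:
  assumes D: "set_mset D \<subseteq> carrier (E_q q)"
  shows "ev_E q D = proj_E q (\<Prod>\<alpha>\<in>#D. lift_E \<alpha>)"
proof -
  have q0: "q \<noteq> 0" using q by auto
  interpret C: comm_group Cstar by (rule comm_group_Cstar)
  interpret E: comm_group "E_q q" by (rule comm_group_E_q[OF q0])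
  interpret h: group_hom Cstar "E_q q" "proj_E q"
    by unfold_locales (rule proj_E_hom)
  have pw: "x [^]\<^bsub>Cstar\<^esub> (n::nat) = x ^ n" if "x \<noteq> 0" for x n
    by (induction n) (auto simp: Cstar_def)
  have pt: "\<alpha> [^]\<^bsub>E_q q\<^esub> (n::nat) = proj_E q (lift_E \<alpha> ^ n)" if "\<alpha> \<in> carrier (E_q q)" for \<alpha> n
    using lift_E[OF that] h.hom_nat_pow[of "lift_E \<alpha>" n] pw[of "lift_E \<alpha>"] by (simp add: Cstar_def)
  have "finprod (E_q q) (\<lambda>\<alpha>. \<alpha> [^]\<^bsub>E_q q\<^esub> count D \<alpha>) S = proj_E q (\<Prod>\<alpha>\<in>S. lift_E \<alpha> ^ count D \<alpha>)"
    if "finite S" "S \<subseteq> carrier (E_q q)" for S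
    using that
  proof (induction S rule: finite_induct)
    case empty
    then show ?case using h.hom_one by (simp add: Cstar_def)
  next
    case (insert x S)
    have nz: "(\<Prod>\<alpha>\<in>S. lift_E \<alpha> ^ count D \<alpha>) \<noteq> 0" "lift_E x \<noteq> 0"
      using insert lift_E by auto
    have "finprod (E_q q) (\<lambda>\<alpha>. \<alpha> [^]\<^bsub>E_q q\<^esub> count D \<alpha>) (insert x S)
        = x [^]\<^bsub>E_q q\<^esub> count D x \<otimes>\<^bsub>E_q q\<^esub> finprod (E_q q) (\<lambda>\<alpha>. \<alpha> [^]\<^bsub>E_q q\<^esub> count D \<alpha>) S"
      using insert by (intro E.finprod_insert) auto
    also have "\<dots> = proj_E q (lift_E x ^ count D x) \<otimes>\<^bsub>E_q q\<^esub> proj_E q (\<Prod>\<alpha>\<in>S. lift_E \<alpha> ^ count D \<alpha>)"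
      using insert by (simp add: pt)
    also have "\<dots> = proj_E q (\<Prod>\<alpha>\<in>insert x S. lift_E \<alpha> ^ count D \<alpha>)"
      using insert nz by (subst h.hom_mult[symmetric]) (auto simp: Cstar_def)
    finally show ?case .
  qed
  from this[OF finite_set_mset D] show ?thesis
    by (simp add: ev_E_def image_prod_mset_multiplicity)
qed

text \<open>
  A product of translated theta functions; its divisor is the given one (see \<open>div_theta_zorder\<close>
  below).
\<close>

definition div_theta :: "complex set multiset \<Rightarrow> complex \<Rightarrow> complex" where
  "div_theta D z = (\<Prod>\<alpha>\<in>#D. theta q (z / lift_E \<alpha>))"

text \<open>
  The constant in the functional equation of the theta function of the divisor.
\<close>

definition div_mult :: "complex set multiset \<Rightarrow> complex" where
  "div_mult D = (\<Prod>\<alpha>\<in>#D. - q / lift_E \<alpha>)"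

lemma div_theta_empty [simp]: "div_theta {#} z = 1"
  by (simp add: div_theta_def)

lemma div_theta_add: "div_theta (D + D') z = div_theta D z * div_theta D' z"
  by (simp add: div_theta_def)

lemma div_mult_nonzero:
  assumes "set_mset D \<subseteq> carrier (E_q q)" shows "div_mult D \<noteq> 0"
  using assms q lift_E by (induction D) (auto simp: div_mult_def)

lemma div_theta_shift:
  assumes "set_mset D \<subseteq> carrier (E_q q)" and z: "z \<noteq> 0"
  shows "div_theta D (q * z) = div_mult D * z ^ size D * div_theta D z"
  using assms(1)
proof (induction D)
  case (add \<alpha> D)
  have "theta q (q * z / lift_E \<alpha>) = - q * (z / lift_E \<alpha>) * theta q (z / lift_E \<alpha>)"
    using theta_shift[of "z / lift_E \<alpha>"] z lift_E[of \<alpha>] add.prems by simp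
  then show ?case using add by (simp add: div_theta_def div_mult_def)
qed (simp add: div_theta_def div_mult_def)

lemma theta_scaled_holomorphic:
  assumes "a \<noteq> 0" shows "(\<lambda>z. theta q (z / a)) holomorphic_on - {0}"
  using assms by (intro holomorphic_on_compose_gen[OF _ theta_holomorphic, of "\<lambda>z. z / a", unfolded o_def] holomorphic_intros) auto

lemma div_theta_holomorphic:
  assumes "set_mset D \<subseteq> carrier (E_q q)" shows "div_theta D holomorphic_on - {0}"
  using assms
proof (induction D)
  case (add \<alpha> D)
  then show ?case using theta_scaled_holomorphic[of "lift_E \<alpha>"] lift_E[of \<alpha>]
    by (auto simp: div_theta_def intro!: holomorphic_intros)
qed (simp add: div_theta_def[abs_def])

lemma theta_scaled_zorder:
  assumes a: "a \<noteq> 0" and z: "z \<noteq> 0"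
  shows "zorder (\<lambda>z. theta q (z / a)) z = (if proj_E q z = proj_E q a then 1 else 0)"
    and "\<forall>\<^sub>F w in at z. theta q (w / a) \<noteq> 0"
proof -
  have "zorder (\<lambda>w. theta q (1 / a * w)) z = zorder (theta q) (1 / a * z)"
    using a z by (intro zorder_scale theta_analytic[THEN analytic_on_imp_meromorphic_on]) auto
  then show "zorder (\<lambda>z. theta q (z / a)) z = (if proj_E q z = proj_E q a then 1 else 0)"
    using a z by (simp add: zorder_theta proj_E_eq_iff)
  have "\<forall>\<^sub>F w in at z. theta q (w / a) \<noteq> 0 \<and> w \<in> - {0}"
  proof (rule non_zero_neighbour_alt[OF theta_scaled_holomorphic[OF a]])
    show "connected (- {0::complex})"
      by (intro connected_punctured_universe) simp
    show "theta q (- a / a) \<noteq> 0" using a by (simp add: theta_eq_0_iff minus_one_notin_q_powers)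
  qed (use a z in auto)
  then show "\<forall>\<^sub>F w in at z. theta q (w / a) \<noteq> 0" by (rule eventually_mono) auto
qed

lemma div_theta_zorder:
  assumes "set_mset D \<subseteq> carrier (E_q q)" and z: "z \<noteq> 0"
  shows "zorder (div_theta D) z = int (count D (proj_E q z)) \<and> (\<forall>\<^sub>F w in at z. div_theta D w \<noteq> 0)"
  using assms(1)
proof (induction D)
  case empty
  then show ?case by (simp add: div_theta_def[abs_def])
next
  case (add \<alpha> D)
  have \<alpha>: "lift_E \<alpha> \<noteq> 0" "proj_E q (lift_E \<alpha>) = \<alpha>" and D: "set_mset D \<subseteq> carrier (E_q q)"
    using add.prems lift_E[of \<alpha>] by auto
  have eq: "div_theta (add_mset \<alpha> D) = (\<lambda>w. theta q (w / lift_E \<alpha>) * div_theta D w)"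
    by (simp add: div_theta_def fun_eq_iff)
  have ev: "\<forall>\<^sub>F w in at z. theta q (w / lift_E \<alpha>) * div_theta D w \<noteq> 0"
    using theta_scaled_zorder(2)[OF \<alpha>(1) z] add.IH[OF D, THEN conjunct2] by eventually_elim auto
  have "zorder (div_theta (add_mset \<alpha> D)) z = zorder (\<lambda>w. theta q (w / lift_E \<alpha>)) z + zorder (div_theta D) z"
    unfolding eq
  proof (rule zorder_times_analytic[OF _ _ ev])
    show "(\<lambda>w. theta q (w / lift_E \<alpha>)) analytic_on {z}" "div_theta D analytic_on {z}"
      using theta_scaled_holomorphic[OF \<alpha>(1)] div_theta_holomorphic[OF D] z
      by (auto simp: analytic_at intro: exI[of _ "- {0}"])
  qed
  then show ?case using add.IH[OF D] ev \<alpha> by (auto simp: theta_scaled_zorder(1)[OF \<alpha>(1) z] eq)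
qed

text \<open>
  If \<open>t q^n = s \<kappa>\<close>, then the product \<open>R\<close> of representatives, which satisfies
  \<open>\<kappa> R = (- q)^(deg D)\<close>, differs from \<open>(- 1)^(deg D) s / t\<close> by a power of \<open>q\<close>, so both have the
  same image on the elliptic curve.  This is where the sign in the definition of allowed
  divisors comes from.
\<close>

lemma div_mult_nonresonant:
  assumes D: "set_mset D \<subseteq> carrier (E_q q)" and st: "s \<noteq> 0" "t \<noteq> 0"
    and ev: "ev_E q D \<noteq> proj_E q ((-1) powi int (size D) * (s / t))"
  shows "t / div_mult D * q powi n \<noteq> s"
proof
  have q0: "q \<noteq> 0" using q by auto
  define R where "R = (\<Prod>\<alpha>\<in>#D. lift_E \<alpha>)"
  have R: "R \<noteq> 0" using D lift_E(1) unfolding R_def by (induction D) auto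
  have c: "div_mult D = (- q) ^ size D / R"
    using D unfolding R_def div_mult_def by (induction D) auto
  assume "t / div_mult D * q powi n = s"
  then have "t * R * q powi n = s * (- q) ^ size D"
    using q0 R by (simp add: c field_simps)
  then have "R / ((-1) powi int (size D) * (s / t)) = q powi (int (size D) - n)"
    using q0 R st by (simp add: power_int_diff field_simps power_minus[of q])
  then have "proj_E q R = proj_E q ((-1) powi int (size D) * (s / t))"
    using R st by (subst proj_E_eq_iff) (auto simp: q_powers_def)
  then show False using ev ev_E_eq_proj_E[OF D] by (simp add: R_def)
qed

end

section \<open>Scalar triangular systems\<close>

text \<open>
  Two upper triangular matrices \<open>B\<close> and \<open>C\<close> of functions, given by their entries, which agree on
  the diagonal blocks; \<open>\<beta>\<close> sends an index to its block, \<open>t\<^sub>a z^(- m\<^sub>a)\<close> are the diagonal entries.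
  Of the theta functions \<open>\<Theta>\<^sub>a\<^sub>b\<close> only the functional equation with constants \<open>\<kappa>\<^sub>a\<^sub>b\<close>, the
  multiplicativity that reflects the additivity of the divisors, and the non-resonance of the
  constants enter.
\<close>

locale triangular_gauge =
  fixes q :: complex and n :: nat and \<beta> :: "nat \<Rightarrow> nat" and m :: "nat \<Rightarrow> int"
    and t :: "nat \<Rightarrow> complex" and \<Theta> :: "nat \<Rightarrow> nat \<Rightarrow> complex \<Rightarrow> complex" and \<kappa> :: "nat \<Rightarrow> nat \<Rightarrow> complex"
    and B C :: "nat \<Rightarrow> nat \<Rightarrow> complex \<Rightarrow> complex"
  assumes q: "norm q > 1"
    and \<beta>_mono: "\<And>a b. a \<le> b \<Longrightarrow> b < n \<Longrightarrow> \<beta> a \<le> \<beta> b"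
    and t_nz: "\<And>a. a < n \<Longrightarrow> t a \<noteq> 0"
    and \<kappa>_nz: "\<And>a b. a < n \<Longrightarrow> b < n \<Longrightarrow> \<kappa> a b \<noteq> 0"
    and \<Theta>_hol: "\<And>a b. a < n \<Longrightarrow> b < n \<Longrightarrow> \<Theta> a b holomorphic_on - {0}"
    and \<Theta>_shift: "\<And>a b z. a < n \<Longrightarrow> b < n \<Longrightarrow> \<beta> a \<le> \<beta> b \<Longrightarrow> z \<noteq> 0 \<Longrightarrow>
      \<Theta> a b (q * z) = \<kappa> a b * z powi (m a - m b) * \<Theta> a b z"
    and \<Theta>_mult: "\<And>a c b z. \<beta> a \<le> \<beta> c \<Longrightarrow> \<beta> c \<le> \<beta> b \<Longrightarrow> a < n \<Longrightarrow> b < n \<Longrightarrow> c < n \<Longrightarrow> \<Theta> a b z = \<Theta> a c z * \<Theta> c b z"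
    and nonres: "\<And>a b l. a < n \<Longrightarrow> b < n \<Longrightarrow> \<beta> a < \<beta> b \<Longrightarrow> t b / \<kappa> a b * q powi l \<noteq> t a"
    and B_diag: "\<And>a z. a < n \<Longrightarrow> B a a z = t a * z powi (- m a)"
    and BC_block: "\<And>a b z. a < n \<Longrightarrow> b < n \<Longrightarrow> \<beta> a = \<beta> b \<Longrightarrow> C a b z = B a b z"
    and BC_upper: "\<And>a b z. b < a \<Longrightarrow> a < n \<Longrightarrow> B a b z = 0 \<and> C a b z = 0"
begin

lemma q_nz: "q \<noteq> 0" using q by auto

text \<open>
  \<open>gauge_eq X a b\<close> is the entry \<open>(a, b)\<close> of \<open>F(qz) B(z) = C(z) F(z)\<close> for \<open>F = X / \<Theta>\<close>, multiplied by
  \<open>z^(m\<^sub>a) \<Theta>\<^sub>a\<^sub>b\<close>: free of poles, and with constant coefficients on the left.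
\<close>

definition gauge_rhs :: "(nat \<Rightarrow> nat \<Rightarrow> complex \<Rightarrow> complex) \<Rightarrow> nat \<Rightarrow> nat \<Rightarrow> complex \<Rightarrow> complex" where
  "gauge_rhs X a b z = z powi m a * (\<Theta> a b z * (C a b z - B a b z) +
     (\<Sum>c\<in>{a<..<b}. C a c z * \<Theta> a c z * X c b z
        - X a c (q * z) * \<Theta> c b z * B c b z / \<kappa> a c * z powi (m c - m a)))"

definition gauge_eq :: "(nat \<Rightarrow> nat \<Rightarrow> complex \<Rightarrow> complex) \<Rightarrow> nat \<Rightarrow> nat \<Rightarrow> complex \<Rightarrow> bool" where
  "gauge_eq X a b z \<longleftrightarrow> t b / \<kappa> a b * X a b (q * z) - t a * X a b z = gauge_rhs X a b z"

text \<open>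
  The right-hand side of the recursion is \<open>gauge_rhs gauge_sol a b\<close> written out: termination
  needs to see that only indices strictly between \<open>a\<close> and \<open>b\<close> are used.
\<close>

function gauge_sol :: "nat \<Rightarrow> nat \<Rightarrow> complex \<Rightarrow> complex" where
  "gauge_sol a b = (if \<beta> a = \<beta> b then (\<lambda>z. if a = b then 1 else 0) else
     q_solve q (t b / \<kappa> a b) (t a) (\<lambda>z. z powi m a * (\<Theta> a b z * (C a b z - B a b z) +
       (\<Sum>c\<in>{a<..<b}. C a c z * \<Theta> a c z * gauge_sol c b z
          - gauge_sol a c (q * z) * \<Theta> c b z * B c b z / \<kappa> a c * z powi (m c - m a)))))"
  by pat_completeness auto
termination by (relation "Wellfounded.measure (\<lambda>(a, b). b - a)") auto

declare gauge_sol.simps [simp del]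

lemma gauge_sol_block: "\<beta> a = \<beta> b \<Longrightarrow> gauge_sol a b = (\<lambda>z. if a = b then 1 else 0)"
  by (simp add: gauge_sol.simps)

lemma gauge_sol_off_block:
  "\<beta> a \<noteq> \<beta> b \<Longrightarrow> gauge_sol a b = q_solve q (t b / \<kappa> a b) (t a) (gauge_rhs gauge_sol a b)"
  by (subst gauge_sol.simps) (simp add: gauge_rhs_def[abs_def])

lemma punctured_subset: "punctured \<rho> \<subseteq> - {0}" by auto

lemma times_q_punctured: "z \<in> punctured \<rho> \<longleftrightarrow> q * z \<in> punctured (norm q * \<rho>)"
  using q_nz by (auto simp: norm_mult)

lemma punctured_mono_q: "\<rho> > 0 \<Longrightarrow> punctured \<rho> \<subseteq> punctured (norm q * \<rho>)"
proof -
  assume "\<rho> > 0"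
  then have "1 * \<rho> \<le> norm q * \<rho>" using q by (intro mult_right_mono) auto
  then show ?thesis by auto
qed

lemma gauge_rhs_holomorphic:
  assumes BC: "\<And>a b. a < n \<Longrightarrow> b < n \<Longrightarrow> B a b holomorphic_on punctured \<rho> \<and> C a b holomorphic_on punctured \<rho>"
    and \<rho>: "\<rho> > 0" and ab: "a < n" "b < n"
    and X: "\<And>c. c \<in> {a<..<b} \<Longrightarrow> X c b holomorphic_on punctured (norm q * \<rho>) \<and> X a c holomorphic_on punctured (norm q * \<rho>)"
  shows "gauge_rhs X a b holomorphic_on punctured \<rho>"
proof -
  note th = holomorphic_on_subset[OF \<Theta>_hol punctured_subset]
  have "X c b holomorphic_on punctured \<rho>" if "c \<in> {a<..<b}" for c
    using X[OF that] punctured_mono_q[OF \<rho>] holomorphic_on_subset by blast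
  moreover have "(\<lambda>z. X a c (q * z)) holomorphic_on punctured \<rho>" if "c \<in> {a<..<b}" for c
  proof (rule holomorphic_on_compose_gen[of "\<lambda>z. q * z" _ "X a c", unfolded o_def])
    show "X a c holomorphic_on punctured (norm q * \<rho>)" using X[OF that] by simp
    show "(\<lambda>z. q * z) ` punctured \<rho> \<subseteq> punctured (norm q * \<rho>)"
      using times_q_punctured by (intro image_subsetI) simp
  qed (intro holomorphic_intros)
  ultimately show ?thesis
    unfolding gauge_rhs_def using BC ab \<kappa>_nz by (intro holomorphic_intros th) auto
qed

text \<open>
  By induction on \<open>b - a\<close> the right-hand side is holomorphic on the disc of the data, because the
  earlier entries are holomorphic on a disc larger by the factor \<open>norm q\<close>; so the radius does not
  shrink along the recursion.
\<close>

theorem gauge_sol_solves: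
  assumes BC: "\<And>a b. a < n \<Longrightarrow> b < n \<Longrightarrow> B a b holomorphic_on punctured \<rho> \<and> C a b holomorphic_on punctured \<rho>"
    and \<rho>: "\<rho> > 0"
  shows "a < n \<Longrightarrow> b < n \<Longrightarrow> \<beta> a \<le> \<beta> b \<Longrightarrow> gauge_sol a b holomorphic_on punctured (norm q * \<rho>) \<and>
     (\<beta> a < \<beta> b \<longrightarrow> (\<forall>z\<in>punctured \<rho>. gauge_eq gauge_sol a b z))"
proof (induction "b - a" arbitrary: a b rule: less_induct)
  case less
  show ?case
  proof (cases "\<beta> a = \<beta> b")
    case True
    then show ?thesis by (auto simp: gauge_sol_block)
  next
    case False
    then have lt: "\<beta> a < \<beta> b" using less.prems by auto
    have hol: "gauge_rhs gauge_sol a b holomorphic_on punctured \<rho>"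
    proof (rule gauge_rhs_holomorphic[OF BC \<rho>])
      fix c assume c: "c \<in> {a<..<b}"
      then have "b - c < b - a" "c - a < b - a" "\<beta> a \<le> \<beta> c" "\<beta> c \<le> \<beta> b"
          using less.prems \<beta>_mono[of a c] \<beta>_mono[of c b] by auto
      with c show "gauge_sol c b holomorphic_on punctured (norm q * \<rho>) \<and> gauge_sol a c holomorphic_on punctured (norm q * \<rho>)"
        using less.hyps[of b c] less.hyps[of c a] less.prems by (auto intro: \<beta>_mono)
    qed (use less.prems in auto)
    have "t b / \<kappa> a b \<noteq> 0" "t a \<noteq> 0" using less.prems t_nz \<kappa>_nz by auto
    from q_solve[OF q this nonres[OF less.prems(1,2) lt] \<rho> hol]
    show ?thesis unfolding gauge_eq_def gauge_sol_off_block[OF False] by blast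
  qed
qed

text \<open>
  Two solutions with the same earlier entries differ by a solution of the homogeneous equation.
\<close>

theorem gauge_unique:
  assumes \<rho>: "\<rho> > 0" "\<rho>' > 0"
    and hol: "\<And>a b. a < n \<Longrightarrow> b < n \<Longrightarrow> X a b holomorphic_on punctured \<rho> \<and> Y a b holomorphic_on punctured \<rho>"
    and block: "\<And>a b z. a < n \<Longrightarrow> b < n \<Longrightarrow> \<beta> a = \<beta> b \<Longrightarrow> z \<in> punctured \<rho> \<Longrightarrow> X a b z = Y a b z"
    and eq: "\<And>a b z. a < n \<Longrightarrow> b < n \<Longrightarrow> \<beta> a < \<beta> b \<Longrightarrow> z \<in> punctured \<rho>' \<Longrightarrow> gauge_eq X a b z \<and> gauge_eq Y a b z"
  shows "a < n \<Longrightarrow> b < n \<Longrightarrow> \<beta> a \<le> \<beta> b \<Longrightarrow> z \<in> punctured \<rho> \<Longrightarrow> X a b z = Y a b z"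
proof (induction "b - a" arbitrary: a b z rule: less_induct)
  case less
  show ?case
  proof (cases "\<beta> a = \<beta> b")
    case True
    then show ?thesis using block less.prems by auto
  next
    case False
    then have lt: "\<beta> a < \<beta> b" using less.prems by auto
    \<comment> \<open>Here both equations hold, and X and Y are known at z and at q z.\<close>
  define r where "r = min \<rho>' (\<rho> / norm q)"
    have r: "r > 0" using \<rho> q_nz by (auto simp: r_def)
    have sub: "z \<in> punctured \<rho>'" "q * z \<in> punctured \<rho>" "z \<in> punctured \<rho>" if "z \<in> punctured r" for z
    proof -
      have "norm z < \<rho>' \<and> norm z < \<rho> / norm q" "z \<noteq> 0" using that by (auto simp: r_def)
      moreover have "\<rho> / norm q \<le> \<rho>"
        using q \<rho> mult_left_mono[of 1 "norm q" \<rho>] by (auto simp: divide_le_eq)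
      ultimately have "norm z < \<rho>' \<and> norm z < \<rho> / norm q \<and> norm z < \<rho>" "z \<noteq> 0" by linarith+
      then show "z \<in> punctured \<rho>'" "q * z \<in> punctured \<rho>" "z \<in> punctured \<rho>"
        using q_nz by (auto simp: norm_mult field_simps)
    qed
    have "t b / \<kappa> a b * (X a b (q * z) - Y a b (q * z)) = t a * (X a b z - Y a b z)" if z: "z \<in> punctured r" for z
    proof -
      have "gauge_rhs X a b z = gauge_rhs Y a b z"
        unfolding gauge_rhs_def
      proof (intro arg_cong2[where f = "(*)"] arg_cong2[where f = "(+)"] sum.cong refl)
        fix c assume c: "c \<in> {a<..<b}"
        then have "b - c < b - a" "c - a < b - a" "\<beta> a \<le> \<beta> c" "\<beta> c \<le> \<beta> b"
          using less.prems \<beta>_mono[of a c] \<beta>_mono[of c b] by auto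
        with c have "X c b z = Y c b z" "X a c (q * z) = Y a c (q * z)"
          using less.hyps[of b c z] less.hyps[of c a "q * z"] less.prems sub[OF z] by (auto intro: \<beta>_mono)
        then show "C a c z * \<Theta> a c z * X c b z - X a c (q * z) * \<Theta> c b z * B c b z / \<kappa> a c * z powi (m c - m a)
          = C a c z * \<Theta> a c z * Y c b z - Y a c (q * z) * \<Theta> c b z * B c b z / \<kappa> a c * z powi (m c - m a)"
          by simp
      qed
      then have "t b / \<kappa> a b * X a b (q * z) - t a * X a b z = t b / \<kappa> a b * Y a b (q * z) - t a * Y a b z"
        using eq[OF less.prems(1,2) lt sub(1)[OF z]] by (simp add: gauge_eq_def)
      then show ?thesis by (simp add: algebra_simps)
    qed
    then have "X a b z - Y a b z = 0"
      by (intro q_homogeneous_unique[OF q nonres[OF less.prems(1,2) lt] \<rho>(1) r _ _ less.prems(4), where H = "\<lambda>z. X a b z - Y a b z"])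
         (use hol less.prems in \<open>auto intro!: holomorphic_intros\<close>)
    then show ?thesis by simp
  qed
qed

lemma pattern_lower:
  assumes f: "\<And>a b. a < n \<Longrightarrow> b < n \<Longrightarrow> \<beta> a = \<beta> b \<Longrightarrow> f a b = (if a = b then 1 else 0 :: complex)"
    "\<And>a b. a < n \<Longrightarrow> b < n \<Longrightarrow> \<beta> a > \<beta> b \<Longrightarrow> f a b = 0"
    and "b < a" "a < n"
  shows "f a b = 0"
proof (cases "\<beta> a = \<beta> b")
  case False
  then have "\<beta> b < \<beta> a" using \<beta>_mono[of b a] assms(3,4) by simp
  then show ?thesis using f(2) assms(3,4) by simp
qed (use f(1) assms(3,4) in simp)

text \<open>
  On and below the diagonal blocks the matrix equation holds for every block unipotent pair, since
  \<open>B\<close> and \<open>C\<close> are triangular and agree on the blocks.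
\<close>

lemma gauge_sum_trivial:
  fixes f g :: "nat \<Rightarrow> nat \<Rightarrow> complex"
  assumes f: "\<And>a b. a < n \<Longrightarrow> b < n \<Longrightarrow> \<beta> a = \<beta> b \<Longrightarrow> f a b = (if a = b then 1 else 0)" "\<And>a b. a < n \<Longrightarrow> b < n \<Longrightarrow> \<beta> a > \<beta> b \<Longrightarrow> f a b = 0"
    and g: "\<And>a b. a < n \<Longrightarrow> b < n \<Longrightarrow> \<beta> a = \<beta> b \<Longrightarrow> g a b = (if a = b then 1 else 0)" "\<And>a b. a < n \<Longrightarrow> b < n \<Longrightarrow> \<beta> a > \<beta> b \<Longrightarrow> g a b = 0"
    and ab: "a < n" "b < n" "\<beta> b \<le> \<beta> a"
  shows "(\<Sum>c<n. f a c * B c b z) = (\<Sum>c<n. C a c z * g c b)"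
proof -
  have "f a c * B c b z = (if c = a then B a b z else 0)" if c: "c < n" for c
  proof (cases "\<beta> a < \<beta> c")
    case True
    then have "b < c" using \<beta>_mono[of c b] ab by (cases "c \<le> b") auto
    then show ?thesis using BC_upper[of b c] c True by auto
  next
    case False
    then show ?thesis using f(1)[of a c] f(2)[of a c] ab c by (cases "\<beta> a = \<beta> c") auto
  qed
  then have "(\<Sum>c<n. f a c * B c b z) = (\<Sum>c<n. if c = a then B a b z else 0)"
    by (intro sum.cong) auto
  then have 1: "(\<Sum>c<n. f a c * B c b z) = B a b z" using ab by simp
  have "C a c z * g c b = (if c = b then C a b z else 0)" if c: "c < n" for c
  proof (cases "\<beta> c < \<beta> b")
    case True
    then have "c < a" using \<beta>_mono[of a c] ab c by (cases "a \<le> c") auto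
    then show ?thesis using BC_upper[of c a] ab True by auto
  next
    case False
    then show ?thesis using g(1)[of c b] g(2)[of c b] ab c by (cases "\<beta> c = \<beta> b") auto
  qed
  then have "(\<Sum>c<n. C a c z * g c b) = (\<Sum>c<n. if c = b then C a b z else 0)"
    by (intro sum.cong) auto
  then have 2: "(\<Sum>c<n. C a c z * g c b) = C a b z" using ab by simp
  have "B a b z = C a b z"
  proof (cases "\<beta> a = \<beta> b")
    case False
    then have "b < a" using \<beta>_mono[of a b] ab by (cases "a \<le> b") auto
    then show ?thesis using BC_upper ab by auto
  qed (use BC_block ab in auto)
  with 1 2 show ?thesis by simp
qed

lemma gauge_sum_split:
  fixes f :: "nat \<Rightarrow> nat \<Rightarrow> complex"
  assumes f: "\<And>a b. a < n \<Longrightarrow> b < n \<Longrightarrow> \<beta> a = \<beta> b \<Longrightarrow> f a b = (if a = b then 1 else 0)" "\<And>a b. a < n \<Longrightarrow> b < n \<Longrightarrow> \<beta> a > \<beta> b \<Longrightarrow> f a b = 0"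
    and ab: "a < n" "b < n"
  shows "a < b \<Longrightarrow> (\<Sum>c<n. f a c * B c b z) = B a b z + (\<Sum>c\<in>{a<..<b}. f a c * B c b z) + f a b * B b b z"
    and "a < b \<Longrightarrow> (\<Sum>c<n. C a c z * f c b) = C a a z * f a b + (\<Sum>c\<in>{a<..<b}. C a c z * f c b) + C a b z"
proof -
  have low: "f a b = 0" if "b < a" "a < n" for a b
    by (rule pattern_lower[where f = f]) (simp_all add: f that)
  have faa: "f a a = 1" and fbb: "f b b = 1" using f(1)[OF ab(1) ab(1)] f(1)[OF ab(2) ab(2)] by simp_all
  assume lt: "a < b"
  have split: "sum h {a..b} = h a + sum h {a<..<b} + h b" for h :: "nat \<Rightarrow> complex"
  proof -
    have "{a..b} = insert a (insert b {a<..<b})" using lt by auto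
    then show ?thesis using lt by (simp add: algebra_simps)
  qed
  have "(\<Sum>c<n. f a c * B c b z) = (\<Sum>c\<in>{a..b}. f a c * B c b z)"
  proof (rule sum.mono_neutral_right)
    show "\<forall>c\<in>{..<n} - {a..b}. f a c * B c b z = 0"
    proof
      fix c assume "c \<in> {..<n} - {a..b}"
      then have "c < a \<or> b < c" "c < n" by (simp_all add: not_le)
      then consider "c < a" | "b < c" "c < n" by blast
      then show "f a c * B c b z = 0"
        using low[of c a] low[of b c] BC_upper[of c a z] BC_upper[of b c z] ab by cases simp_all
    qed
  qed (use ab in auto)
  then show "(\<Sum>c<n. f a c * B c b z) = B a b z + (\<Sum>c\<in>{a<..<b}. f a c * B c b z) + f a b * B b b z"
    by (simp only: split faa mult_1_left)
  have "(\<Sum>c<n. C a c z * f c b) = (\<Sum>c\<in>{a..b}. C a c z * f c b)"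
  proof (rule sum.mono_neutral_right)
    show "\<forall>c\<in>{..<n} - {a..b}. C a c z * f c b = 0"
    proof
      fix c assume "c \<in> {..<n} - {a..b}"
      then have "c < a \<or> b < c" "c < n" by (simp_all add: not_le)
      then consider "c < a" | "b < c" "c < n" by blast
      then show "C a c z * f c b = 0"
        using low[of c a] low[of b c] BC_upper[of c a z] BC_upper[of b c z] ab by cases simp_all
    qed
  qed (use ab in auto)
  then show "(\<Sum>c<n. C a c z * f c b) = C a a z * f a b + (\<Sum>c\<in>{a<..<b}. C a c z * f c b) + C a b z"
    by (simp only: split fbb mult_1_right)
qed

text \<open>
  The block unipotent matrix with numerators \<open>X\<close>.
\<close>

definition unip_entry :: "(nat \<Rightarrow> nat \<Rightarrow> complex \<Rightarrow> complex) \<Rightarrow> complex \<Rightarrow> nat \<Rightarrow> nat \<Rightarrow> complex" where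
  "unip_entry X z a b = (if \<beta> a = \<beta> b then if a = b then 1 else 0 else if \<beta> a < \<beta> b then X a b z / \<Theta> a b z else 0)"

text \<open>
  Multiplication by \<open>z^(m\<^sub>a) \<Theta>\<^sub>a\<^sub>b\<close>.  In \<open>F\<^sub>a\<^sub>b(qz)\<close> the functional equation produces
  \<open>z^(m\<^sub>a - m\<^sub>b)\<close>, which cancels against the powers of \<open>z\<close> in the diagonal entries; in the products
  with earlier entries, \<open>\<Theta>\<^sub>a\<^sub>b = \<Theta>\<^sub>a\<^sub>c \<Theta>\<^sub>c\<^sub>b\<close> clears the denominator.
\<close>

lemma gauge_eq_iff:
  assumes ab: "a < n" "b < n" "\<beta> a < \<beta> b" and z: "z \<noteq> 0"
    and nz: "\<And>a b. a < n \<Longrightarrow> b < n \<Longrightarrow> \<Theta> a b z \<noteq> 0"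
    and X: "\<And>a b. a < n \<Longrightarrow> b < n \<Longrightarrow> \<beta> a = \<beta> b \<Longrightarrow> X a b z = \<Theta> a b z * (if a = b then 1 else 0) \<and>
       X a b (q * z) = \<Theta> a b (q * z) * (if a = b then 1 else 0)"
  shows "(\<Sum>c<n. unip_entry X (q * z) a c * B c b z) = (\<Sum>c<n. C a c z * unip_entry X z c b) \<longleftrightarrow> gauge_eq X a b z"
proof -
  have lt: "a < b" using ab \<beta>_mono[of b a] by (meson not_less)
  have unip_entry: "unip_entry X z a b = X a b z / \<Theta> a b z"
    "unip_entry X (q * z) a b = X a b (q * z) / (\<kappa> a b * z powi (m a - m b) * \<Theta> a b z)"
    if "a < n" "b < n" "\<beta> a \<le> \<beta> b" for a b
    using that X[of a b] nz[of a b] \<Theta>_shift[of a b z] \<kappa>_nz[of a b] z by (auto simp: unip_entry_def)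
  have "(\<Sum>c<n. unip_entry X (q * z) a c * B c b z) = (\<Sum>c<n. C a c z * unip_entry X z c b) \<longleftrightarrow>
     unip_entry X (q * z) a b * B b b z - C a a z * unip_entry X z a b
       = C a b z - B a b z + (\<Sum>c\<in>{a<..<b}. C a c z * unip_entry X z c b - unip_entry X (q * z) a c * B c b z)"
  proof -
    have pat: "unip_entry X w a b = (if a = b then 1 else 0)" if "\<beta> a = \<beta> b" for w a b
      using that by (simp add: unip_entry_def)
    have pat': "unip_entry X w a b = 0" if "\<beta> a > \<beta> b" for w a b
      using that by (simp add: unip_entry_def)
    have e: "x + y + u = v + w + s \<longleftrightarrow> u - v = s - x + (w - y)" for x y u v w s :: complex
      by (auto simp: algebra_simps)
    have 1: "(\<Sum>c<n. unip_entry X (q * z) a c * B c b z) =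
        B a b z + (\<Sum>c\<in>{a<..<b}. unip_entry X (q * z) a c * B c b z) + unip_entry X (q * z) a b * B b b z"
      by (rule gauge_sum_split(1)) (simp_all add: unip_entry_def ab lt)
    have 2: "(\<Sum>c<n. C a c z * unip_entry X z c b) =
        C a a z * unip_entry X z a b + (\<Sum>c\<in>{a<..<b}. C a c z * unip_entry X z c b) + C a b z"
      by (rule gauge_sum_split(2)) (simp_all add: unip_entry_def ab lt)
    show ?thesis unfolding sum_subtractf 1 2 by (rule e)
  qed
  also have "\<dots> \<longleftrightarrow> (z powi m a * \<Theta> a b z) * (unip_entry X (q * z) a b * B b b z - C a a z * unip_entry X z a b)
       = (z powi m a * \<Theta> a b z) * (C a b z - B a b z + (\<Sum>c\<in>{a<..<b}. C a c z * unip_entry X z c b - unip_entry X (q * z) a c * B c b z))"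
    using nz[OF ab(1,2)] z by simp
  also have "(z powi m a * \<Theta> a b z) * (unip_entry X (q * z) a b * B b b z - C a a z * unip_entry X z a b)
      = t b / \<kappa> a b * X a b (q * z) - t a * X a b z"
  proof -
    define u where "u = z powi (m a - m b)"
    have u: "u \<noteq> 0" "z powi m a * z powi (- m b) = u" "z powi m a * z powi (- m a) = 1"
      using z by (simp_all add: u_def flip: power_int_add)
    have diag: "B b b z = t b * z powi (- m b)" "C a a z = t a * z powi (- m a)"
      using B_diag BC_block ab by auto
    have "(z powi m a * \<Theta> a b z) * (unip_entry X (q * z) a b * B b b z - C a a z * unip_entry X z a b)
      = \<Theta> a b z * (unip_entry X (q * z) a b * t b * (z powi m a * z powi (- m b))
          - t a * (z powi m a * z powi (- m a)) * unip_entry X z a b)"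
      unfolding diag by (simp only: algebra_simps)
    also have "\<dots> = t b / \<kappa> a b * X a b (q * z) - t a * X a b z"
      unfolding u unip_entry[OF ab(1,2) less_imp_le[OF ab(3)]] u_def[symmetric]
      using nz[OF ab(1,2)] \<kappa>_nz[OF ab(1,2)] u(1) by (simp add: field_simps)
    finally show ?thesis .
  qed
  also have "(z powi m a * \<Theta> a b z) * (C a b z - B a b z + (\<Sum>c\<in>{a<..<b}. C a c z * unip_entry X z c b - unip_entry X (q * z) a c * B c b z))
      = gauge_rhs X a b z"
  proof -
    have key: "\<Theta> a b z * (C a c z * unip_entry X z c b - unip_entry X (q * z) a c * B c b z)
        = C a c z * \<Theta> a c z * X c b z - X a c (q * z) * \<Theta> c b z * B c b z / \<kappa> a c * z powi (m c - m a)"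
      if c: "c \<in> {a<..<b}" for c
    proof -
      have c': "a \<le> c" "c \<le> b" "c < n" using c ab(2) by auto
      have cn: "c < n" "\<beta> a \<le> \<beta> c" "\<beta> c \<le> \<beta> b"
        by (fact c'(3), rule \<beta>_mono[OF c'(1,3)], rule \<beta>_mono[OF c'(2) ab(2)])
      have th: "\<Theta> a b z = \<Theta> a c z * \<Theta> c b z" by (rule \<Theta>_mult[OF cn(2,3) ab(1,2) cn(1)])
      define u where "u = z powi (m a - m c)"
      have u: "u \<noteq> 0" "z powi (m c - m a) = 1 / u"
        using z by (simp_all add: u_def power_int_diff)
      have alg: "(h * k) * (C' * (x / k) - y / (ka * u * h) * B') = C' * h * x - y * k * B' / ka * (1 / u)"
        if "h \<noteq> 0" "k \<noteq> 0" "ka \<noteq> 0" for h k ka C' x y B' :: complex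
        using that u(1) by (simp add: field_simps)
      show ?thesis
        unfolding th u(2) unip_entry(1)[OF cn(1) ab(2) cn(3)] unip_entry(2)[OF ab(1) cn(1,2)] u_def[symmetric]
        by (rule alg[OF nz[OF ab(1) cn(1)] nz[OF cn(1) ab(2)] \<kappa>_nz[OF ab(1) cn(1)]])
    qed
    have "\<Theta> a b z * (\<Sum>c\<in>{a<..<b}. C a c z * unip_entry X z c b - unip_entry X (q * z) a c * B c b z) =
       (\<Sum>c\<in>{a<..<b}. C a c z * \<Theta> a c z * X c b z - X a c (q * z) * \<Theta> c b z * B c b z / \<kappa> a c * z powi (m c - m a))"
      unfolding sum_distrib_left by (rule sum.cong[OF refl key])
    then show ?thesis
      unfolding gauge_rhs_def by (simp only: mult.assoc[of "z powi m a"] distrib_left)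
  qed
  finally show ?thesis by (simp add: gauge_eq_def)
qed

end

section \<open>Poles bounded by a divisor\<close>

lemma cosparse_punctured_iff:
  "eventually P (cosparse (punctured \<rho>)) \<longleftrightarrow> (\<forall>z\<in>punctured \<rho>. eventually P (at z))"
  by (rule eventually_cosparse_open_eq) simp

lemma cosparse_punctured_mono:
  "eventually P (cosparse (punctured \<rho>)) \<Longrightarrow> \<rho>' \<le> \<rho> \<Longrightarrow> eventually P (cosparse (punctured \<rho>'))"
  unfolding cosparse_punctured_iff by auto

lemma div_theta_cosparse_nonzero:
  assumes "norm q > 1" "set_mset D \<subseteq> carrier (E_q q)"
  shows "\<forall>\<^sub>\<approx>z\<in>punctured \<rho>. div_theta q D z \<noteq> 0"
  unfolding cosparse_punctured_iff using div_theta_zorder[OF assms] by auto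

text \<open>
  The theta function of \<open>D\<close> vanishes at each point exactly to the order that \<open>D\<close> prescribes, so
  multiplying by it makes the singularities removable if and only if the poles are bounded by
  \<open>D\<close>.
\<close>

lemma poles_bounded_iff:
  assumes q: "norm q > 1" and D: "set_mset D \<subseteq> carrier (E_q q)"
  shows "f meromorphic_on punctured \<rho> \<and>
      (\<forall>z0\<in>punctured \<rho>. is_pole f z0 \<longrightarrow> - zorder f z0 \<le> int (count D (proj_E q z0))) \<longleftrightarrow>
    (\<exists>X. X holomorphic_on punctured \<rho> \<and> (\<forall>\<^sub>\<approx>z\<in>punctured \<rho>. f z = X z / div_theta q D z))"
    (is "?L \<longleftrightarrow> ?R")
proof
  assume L: ?L
  define g where "g = (\<lambda>z. f z * div_theta q D z)"
  have th_mero: "div_theta q D meromorphic_on punctured \<rho>"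
    using holomorphic_on_subset[OF div_theta_holomorphic[OF q D]]
    by (intro analytic_on_imp_meromorphic_on) (auto simp: analytic_on_open)
  have g: "g meromorphic_on punctured \<rho>"
    unfolding g_def using L th_mero by (intro meromorphic_intros) auto
  have nopole: "\<not> is_pole g z0" if z0: "z0 \<in> punctured \<rho>" for z0
  proof
    assume pole: "is_pole g z0"
    have fm: "f meromorphic_on {z0}" and tm: "div_theta q D meromorphic_on {z0}" and gm: "g meromorphic_on {z0}"
      using L th_mero g z0 by (auto intro: meromorphic_on_subset)
    have thz: "zorder (div_theta q D) z0 = int (count D (proj_E q z0))" "\<forall>\<^sub>F w in at z0. div_theta q D w \<noteq> 0"
      using div_theta_zorder[OF q D, of z0] z0 by auto
    have "\<forall>\<^sub>F z in at z0. g z \<noteq> 0" using pole by (rule non_zero_neighbour_pole)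
    then have fnz: "\<forall>\<^sub>F z in at z0. f z \<noteq> 0" by eventually_elim (auto simp: g_def)
    have "zorder g z0 = zorder f z0 + zorder (div_theta q D) z0"
      unfolding g_def using fnz thz(2)
      by (intro zorder_mult fm tm) (auto intro: eventually_frequently)
    moreover have "zorder g z0 < 0"
      using isolated_pole_imp_neg_zorder[OF meromorphic_on_isolated_singularity[OF gm] pole] .
    ultimately have neg: "zorder f z0 < - int (count D (proj_E q z0))" using thz by simp
    then have "is_pole f z0" by (intro zorder_neg_imp_is_pole fm fnz) auto
    then show False using L z0 neg by force
  qed
  have "remove_sings g analytic_on punctured \<rho>"
    using nicely_meromorphic_on_imp_analytic_at[OF remove_sings_nicely_meromorphic[OF g]] nopole
      meromorphic_on_isolated_singularity meromorphic_on_subset[OF g] meromorphic_on_not_essential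
    by (subst analytic_on_analytic_at) (metis empty_subsetI insert_subset is_pole_remove_sings_iff)
  moreover have "\<forall>\<^sub>\<approx>z\<in>punctured \<rho>. f z = remove_sings g z / div_theta q D z"
    using eventually_remove_sings_eq[OF g] div_theta_cosparse_nonzero[OF q D, of \<rho>]
    by eventually_elim (auto simp: g_def)
  ultimately show ?R using analytic_imp_holomorphic by blast
next
  assume ?R
  then obtain X where X: "X holomorphic_on punctured \<rho>"
    and fX: "\<And>z. z \<in> punctured \<rho> \<Longrightarrow> \<forall>\<^sub>F w in at z. f w = X w / div_theta q D w"
    unfolding cosparse_punctured_iff by blast
  have an: "X analytic_on punctured \<rho>" "div_theta q D analytic_on punctured \<rho>"
    using X holomorphic_on_subset[OF div_theta_holomorphic[OF q D]] by (auto simp: analytic_on_open)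
  have m: "(\<lambda>z. X z / div_theta q D z) meromorphic_on punctured \<rho>"
    by (intro meromorphic_intros analytic_on_imp_meromorphic_on an)
  show ?L
  proof (intro conjI ballI impI)
    show "f meromorphic_on punctured \<rho>"
      using m meromorphic_on_cong[OF fX refl] by blast
    fix z0 assume z0: "z0 \<in> punctured \<rho>" and pole: "is_pole f z0"
    have an0: "X analytic_on {z0}" "div_theta q D analytic_on {z0}"
      using an z0 by (auto intro: analytic_on_subset)
    have thz: "zorder (div_theta q D) z0 = int (count D (proj_E q z0))" "\<forall>\<^sub>F w in at z0. div_theta q D w \<noteq> 0"
      using div_theta_zorder[OF q D, of z0] z0 by auto
    have "\<forall>\<^sub>F w in at z0. X w \<noteq> 0"
      using non_zero_neighbour_pole[OF pole] fX[OF z0] by eventually_elim auto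
    then have fr: "\<exists>\<^sub>F w in at z0. X w \<noteq> 0" by (intro eventually_frequently) auto
    have "zorder f z0 = zorder (\<lambda>w. X w / div_theta q D w) z0"
      using fX[OF z0] by (rule zorder_cong) simp
    also have "\<dots> = zorder X z0 - zorder (div_theta q D) z0"
      using fr thz(2) by (intro zorder_divide analytic_on_imp_meromorphic_on an0) (auto intro: eventually_frequently)
    finally show "- zorder f z0 \<le> int (count D (proj_E q z0))"
      using zorder_ge_0[OF an0(1) fr] thz(1) by simp
  qed
qed

lemma holomorphic_cosparse_eq:
  assumes f: "f holomorphic_on punctured \<rho>" and g: "g holomorphic_on punctured \<rho>"
    and eq: "\<forall>\<^sub>\<approx>z\<in>punctured \<rho>. f z = g z" and z: "z \<in> punctured \<rho>"
  shows "f z = (g z :: complex)"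
proof -
  have "isCont (\<lambda>z. f z - g z) z"
    using f g z by (metis holomorphic_on_imp_continuous_on continuous_on_eq_continuous_at open_punctured continuous_diff)
  then have "((\<lambda>z. f z - g z) \<longlongrightarrow> f z - g z) (at z)" by (simp add: isCont_def)
  moreover have "((\<lambda>z. f z - g z) \<longlongrightarrow> 0) (at z)"
    using eq z unfolding cosparse_punctured_iff by (intro tendsto_eventually) (auto elim: eventually_mono)
  ultimately show ?thesis using tendsto_unique[of "at z"] by fastforce
qed

lemma common_radius:
  assumes "finite I" "\<And>i. i \<in> I \<Longrightarrow> \<exists>\<rho>>0. P i (\<rho>::real)"
    and mono: "\<And>i \<rho> \<rho>'. i \<in> I \<Longrightarrow> P i \<rho> \<Longrightarrow> 0 < \<rho>' \<Longrightarrow> \<rho>' \<le> \<rho> \<Longrightarrow> P i \<rho>'"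
  shows "\<exists>\<rho>>0. \<forall>i\<in>I. P i \<rho>"
  using assms
proof (induction I rule: finite_induct)
  case empty
  then show ?case by (auto intro: exI[of _ 1])
next
  case (insert x I)
  from insert.IH insert.prems obtain \<rho>1 where 1: "\<rho>1 > 0" "\<And>i. i \<in> I \<Longrightarrow> P i \<rho>1" by (metis insertCI)
  obtain \<rho>2 where 2: "\<rho>2 > 0" "P x \<rho>2" using insert.prems(1) by blast
  have "0 < min \<rho>1 \<rho>2" using 1 2 by simp
  moreover have "P i (min \<rho>1 \<rho>2)" if "i \<in> insert x I" for i
    using that insert.prems(2)[OF insertI1 2(2)] insert.prems(2)[of i \<rho>1] 1 2 by auto
  ultimately show ?case by blast
qed

section \<open>Block matrices by entries\<close>

context
  fixes k :: nat and r :: "nat \<Rightarrow> nat"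
begin

lemma bindex_props:
  assumes "a < boffset r k"
  shows "bindex r a < k" "boffset r (bindex r a) \<le> a" "a < boffset r (Suc (bindex r a))"
    "a - boffset r (bindex r a) < r (bindex r a)"
proof -
  have k: "k > 0" using assms by (cases k) (auto simp: boffset_def)
  have ex: "a < boffset r (Suc (k - 1))" using assms k by simp
  then show lt: "a < boffset r (Suc (bindex r a))" unfolding bindex_def by (rule LeastI)
  have "bindex r a \<le> k - 1" unfolding bindex_def by (rule Least_le[of _ "k - 1"]) (rule ex)
  then show "bindex r a < k" using k by simp
  show le: "boffset r (bindex r a) \<le> a"
  proof (cases "bindex r a")
    case 0 then show ?thesis by (simp add: boffset_def)
  next
    case (Suc i)
    then have "\<not> a < boffset r (Suc i)"
      unfolding bindex_def using not_less_Least[of i "\<lambda>i. a < boffset r (Suc i)"] by simp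
    then show ?thesis using Suc by simp
  qed
  show "a - boffset r (bindex r a) < r (bindex r a)"
    using lt le by (simp add: boffset_Suc)
qed

lemma bindex_mono: "a \<le> b \<Longrightarrow> b < boffset r k \<Longrightarrow> bindex r a \<le> bindex r b"
  unfolding bindex_def[of r a] by (rule Least_le) (use bindex_props(3)[of b] in simp)

lemma boffset_plus_less: "i < k \<Longrightarrow> x < r i \<Longrightarrow> boffset r i + x < boffset r k"
  using boffset_mono[of "Suc i" k r] by (simp add: boffset_Suc)

lemma all_bindex_iff:
  "(\<forall>a<boffset r k. P a (bindex r a)) \<longleftrightarrow> (\<forall>i<k. \<forall>x<r i. P (boffset r i + x) i)"
proof (intro iffI allI impI)
  fix i x assume "\<forall>a<boffset r k. P a (bindex r a)" "i < k" "x < r i"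
  then show "P (boffset r i + x) i" using boffset_plus_less[of i x] bindex_boffset[of x r i] by metis
next
  fix a assume *: "\<forall>i<k. \<forall>x<r i. P (boffset r i + x) i" and a: "a < boffset r k"
  show "P a (bindex r a)"
    using *[rule_format, OF bindex_props(1,4)[OF a]] bindex_props(2)[OF a] by simp
qed

text \<open>
  From here on matrices are described by their entries, with \<open>bindex\<close> recording the block of an
  index; this form is compatible with triangular shape inside the blocks.
\<close>

lemma unip_iff:
  "M \<in> unip k r \<longleftrightarrow> M \<in> carrier_mat (boffset r k) (boffset r k) \<and>
     (\<forall>a<boffset r k. \<forall>b<boffset r k.
        (bindex r a = bindex r b \<longrightarrow> M $$ (a, b) = (if a = b then 1 else 0)) \<and>
        (bindex r b < bindex r a \<longrightarrow> M $$ (a, b) = 0))"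
proof -
  have blk: "block r i i M = 1\<^sub>m (r i) \<longleftrightarrow>
      (\<forall>x<r i. \<forall>y<r i. M $$ (boffset r i + x, boffset r i + y) = (if boffset r i + x = boffset r i + y then 1 else 0))" for i
    by (auto simp: block_def mat_eq_iff)
  have blk': "block r i j M = 0\<^sub>m (r i) (r j) \<longleftrightarrow>
      (\<forall>x<r i. \<forall>y<r j. M $$ (boffset r i + x, boffset r j + y) = 0)" for i j
    by (auto simp: block_def mat_eq_iff)
  have "(\<forall>a<boffset r k. \<forall>b<boffset r k.
        (bindex r a = bindex r b \<longrightarrow> M $$ (a, b) = (if a = b then 1 else 0)) \<and>
        (bindex r b < bindex r a \<longrightarrow> M $$ (a, b) = 0)) \<longleftrightarrow>
      (\<forall>i<k. \<forall>x<r i. \<forall>j<k. \<forall>y<r j. (i = j \<longrightarrow> M $$ (boffset r i + x, boffset r j + y) = (if boffset r i + x = boffset r j + y then 1 else 0)) \<and>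
        (j < i \<longrightarrow> M $$ (boffset r i + x, boffset r j + y) = 0))"
    unfolding all_bindex_iff[of "\<lambda>a i. \<forall>b<boffset r k. (i = bindex r b \<longrightarrow> M $$ (a, b) = (if a = b then 1 else 0)) \<and>
        (bindex r b < i \<longrightarrow> M $$ (a, b) = 0)"]
    unfolding all_bindex_iff[of "\<lambda>b j. (i = j \<longrightarrow> M $$ (a, b) = (if a = b then 1 else 0)) \<and>
        (j < i \<longrightarrow> M $$ (a, b) = 0)" for a i] ..
  also have "\<dots> \<longleftrightarrow> (\<forall>i<k. block r i i M = 1\<^sub>m (r i) \<and> (\<forall>j<i. block r i j M = 0\<^sub>m (r i) (r j)))"
    unfolding blk blk'
  proof
    assume L: "\<forall>i<k. \<forall>x<r i. \<forall>j<k. \<forall>y<r j. (i = j \<longrightarrow> M $$ (boffset r i + x, boffset r j + y) = (if boffset r i + x = boffset r j + y then 1 else 0)) \<and>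
        (j < i \<longrightarrow> M $$ (boffset r i + x, boffset r j + y) = 0)"
    show "\<forall>i<k. (\<forall>x<r i. \<forall>y<r i. M $$ (boffset r i + x, boffset r i + y) = (if boffset r i + x = boffset r i + y then 1 else 0)) \<and>
      (\<forall>j<i. \<forall>x<r i. \<forall>y<r j. M $$ (boffset r i + x, boffset r j + y) = 0)"
    proof (intro allI impI conjI)
      fix i x y assume "i < k" "x < r i" "y < r i"
      then show "M $$ (boffset r i + x, boffset r i + y) = (if boffset r i + x = boffset r i + y then 1 else 0)"
        using L by blast
    next
      fix i j x y assume "i < k" "j < i" "x < r i" "y < r j"
      moreover from this have "j < k" by simp
      ultimately show "M $$ (boffset r i + x, boffset r j + y) = 0"
        using L by blast
    qed
  qed blast
  finally show ?thesis unfolding unip_def by blast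
qed

lemma of_blocks_index:
  "a < boffset r k \<Longrightarrow> b < boffset r k \<Longrightarrow> of_blocks k r X $$ (a, b) =
     X (bindex r a) (bindex r b) $$ (a - boffset r (bindex r a), b - boffset r (bindex r b))"
  by (simp add: of_blocks_def)

lemma of_blocks_carrier [simp]: "of_blocks k r X \<in> carrier_mat (boffset r k) (boffset r k)"
  by (simp add: of_blocks_def)

lemma sum_over_block:
  fixes g :: "nat \<Rightarrow> 'a::comm_monoid_add"
  assumes i: "i < k" and 0: "\<And>c. c < boffset r k \<Longrightarrow> bindex r c \<noteq> i \<Longrightarrow> g c = 0"
  shows "(\<Sum>c<boffset r k. g c) = (\<Sum>x<r i. g (boffset r i + x))"
proof -
  have eq: "{c. c < boffset r k \<and> bindex r c = i} = (\<lambda>x. boffset r i + x) ` {..<r i}"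
  proof safe
    fix c assume c: "c < boffset r k" "i = bindex r c"
    show "c \<in> (\<lambda>x. boffset r (bindex r c) + x) ` {..<r (bindex r c)}"
      using bindex_props[OF c(1)] by (intro image_eqI[of _ _ "c - boffset r (bindex r c)"]) auto
  qed (use i boffset_plus_less bindex_boffset in auto)
  have "(\<Sum>c<boffset r k. g c) = (\<Sum>c\<in>{c. c < boffset r k \<and> bindex r c = i}. g c)"
    by (rule sum.mono_neutral_right) (use 0 in auto)
  also have "\<dots> = (\<Sum>x<r i. g (boffset r i + x))"
    unfolding eq by (subst sum.reindex) auto
  finally show ?thesis .
qed

definition block_diag :: "(nat \<Rightarrow> complex mat) \<Rightarrow> complex mat" where
  "block_diag X = of_blocks k r (\<lambda>i j. if i = j then X i else 0\<^sub>m (r i) (r j))"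

lemma block_diag_carrier [simp]: "block_diag X \<in> carrier_mat (boffset r k) (boffset r k)"
  by (simp add: block_diag_def)

lemma block_diag_index:
  assumes "a < boffset r k" "b < boffset r k"
  shows "block_diag X $$ (a, b) = (if bindex r a = bindex r b
     then X (bindex r a) $$ (a - boffset r (bindex r a), b - boffset r (bindex r b)) else 0)"
  using assms bindex_props(4)[OF assms(1)] bindex_props(4)[OF assms(2)]
  by (auto simp: block_diag_def of_blocks_index)

lemma mult_index_sum:
  assumes "X \<in> carrier_mat n n" "Y \<in> carrier_mat n n" "a < n" "b < n"
  shows "(X * Y) $$ (a, b) = (\<Sum>c<n. X $$ (a, c) * Y $$ (c, b))"
  using assms by (auto simp: scalar_prod_def lessThan_atLeast0)

lemma block_diag_mult:
  assumes X: "\<And>i. i < k \<Longrightarrow> X i \<in> carrier_mat (r i) (r i)" and Y: "\<And>i. i < k \<Longrightarrow> Y i \<in> carrier_mat (r i) (r i)"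
  shows "block_diag X * block_diag Y = block_diag (\<lambda>i. X i * Y i)"
proof (rule eq_matI)
  fix a b assume "a < dim_row (block_diag (\<lambda>i. X i * Y i))" "b < dim_col (block_diag (\<lambda>i. X i * Y i))"
  then have a: "a < boffset r k" and b: "b < boffset r k" by (auto simp: block_diag_def of_blocks_def)
  define i where "i = bindex r a"
  have i: "i < k" "a - boffset r i < r i" "boffset r i \<le> a" using bindex_props[OF a] by (auto simp: i_def)
  have "(block_diag X * block_diag Y) $$ (a, b) = (\<Sum>c<boffset r k. block_diag X $$ (a, c) * block_diag Y $$ (c, b))"
    using a b by (intro mult_index_sum) auto
  also have "\<dots> = (\<Sum>x<r i. block_diag X $$ (a, boffset r i + x) * block_diag Y $$ (boffset r i + x, b))"
    using a by (intro sum_over_block[OF i(1)]) (auto simp: block_diag_index i_def)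
  also have "\<dots> = block_diag (\<lambda>i. X i * Y i) $$ (a, b)"
  proof (cases "bindex r b = i")
    case True
    then have bi: "b - boffset r i < r i" using bindex_props[OF b] by auto
    show ?thesis
      using a b i True bi X[OF i(1)] Y[OF i(1)] boffset_plus_less[OF i(1)]
      by (simp add: block_diag_index bindex_boffset i_def[symmetric] mult_index_sum[of _ "r i"]
          del: index_mult_mat)
  next
    case False
    then show ?thesis
      using a b i boffset_plus_less[OF i(1)] by (simp add: block_diag_index bindex_boffset i_def[symmetric])
  qed
  finally show "(block_diag X * block_diag Y) $$ (a, b) = block_diag (\<lambda>i. X i * Y i) $$ (a, b)" .
qed (auto simp: block_diag_def of_blocks_def)

lemma block_diag_cong: "(\<And>i. i < k \<Longrightarrow> X i = Y i) \<Longrightarrow> block_diag X = block_diag Y"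
  by (rule eq_matI) (auto simp: block_diag_index bindex_props(1) block_diag_carrier[THEN carrier_matD(1)] block_diag_carrier[THEN carrier_matD(2)])

lemma block_diag_one: "block_diag (\<lambda>i. 1\<^sub>m (r i)) = 1\<^sub>m (boffset r k)"
proof (rule eq_matI)
  fix a b assume ab: "a < dim_row (1\<^sub>m (boffset r k) :: complex mat)" "b < dim_col (1\<^sub>m (boffset r k) :: complex mat)"
  then have a: "a < boffset r k" and b: "b < boffset r k" by auto
  show "block_diag (\<lambda>i. 1\<^sub>m (r i)) $$ (a, b) = 1\<^sub>m (boffset r k) $$ (a, b)"
    using a b bindex_props[OF a] bindex_props[OF b] by (auto simp: block_diag_index)
qed (auto simp: block_diag_def of_blocks_def)

end

section \<open>Solutions as quotients by theta functions\<close>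

lemma A_blk_carrier [simp]: "A_blk k \<mu> r A U z \<in> carrier_mat (boffset r k) (boffset r k)"
  by (simp add: A_blk_def)

lemma A_blk_index:
  assumes a: "a < boffset r k" and b: "b < boffset r k"
    and A: "\<And>i. i < k \<Longrightarrow> A i \<in> carrier_mat (r i) (r i)"
  shows "A_blk k \<mu> r A U z $$ (a, b) =
    (if bindex r a = bindex r b then z powi (- \<mu> (bindex r a)) * block_diag k r A $$ (a, b)
     else if bindex r a < bindex r b
       then U (bindex r a) (bindex r b) z $$ (a - boffset r (bindex r a), b - boffset r (bindex r b))
     else 0)"
  using A[OF bindex_props(1)[OF a]] bindex_props[OF a] bindex_props[OF b]
  by (auto simp: A_blk_def of_blocks_index[OF a b] block_diag_index[OF a b])

lemma unip_inverse:
  assumes M: "M \<in> unip k r"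
  shows "\<exists>N. mat_inverse M = Some N \<and> M * N = 1\<^sub>m (boffset r k) \<and> N * M = 1\<^sub>m (boffset r k) \<and>
    N \<in> carrier_mat (boffset r k) (boffset r k)"
proof -
  define n where "n = boffset r k"
  have c: "M \<in> carrier_mat n n" using M by (simp add: unip_iff n_def)
  have "upper_triangular M"
    unfolding upper_triangular_def
  proof (intro allI impI)
    fix a b assume ab: "a < dim_row M" "b < a"
    then have "a < n" "b < n" using c by auto
    moreover have "bindex r b \<le> bindex r a" using ab \<open>a < n\<close> by (intro bindex_mono[of _ _ r k]) (auto simp: n_def)
    ultimately show "M $$ (a, b) = 0"
      using M ab unfolding unip_iff n_def by (cases "bindex r b = bindex r a") auto
  qed
  then have "det M = prod_list (diag_mat M)" by (rule det_upper_triangular[OF _ c])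
  also have "diag_mat M = map (\<lambda>_. 1) [0..<n]"
    using M c unfolding unip_iff n_def diag_mat_def by (intro map_cong) auto
  also have "prod_list \<dots> = (1::complex)" by (induction n) auto
  finally have "M \<in> Units (ring_mat TYPE(complex) n ())" by (intro det_non_zero_imp_unit[OF c]) simp
  then obtain N where "mat_inverse M = Some N"
    using mat_inverse(1)[OF c, of "()"] by (cases "mat_inverse M") auto
  with mat_inverse(2)[OF c this] show ?thesis by (auto simp: n_def)
qed

lemma gauge_pointwise_iff:
  assumes M: "M \<in> unip k r" and c: "M' \<in> carrier_mat (boffset r k) (boffset r k)"
    "X \<in> carrier_mat (boffset r k) (boffset r k)" "Y \<in> carrier_mat (boffset r k) (boffset r k)"
  shows "M' * X * the (mat_inverse M) = Y \<longleftrightarrow> M' * X = Y * M"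
proof -
  obtain N where N: "mat_inverse M = Some N" "M * N = 1\<^sub>m (boffset r k)" "N * M = 1\<^sub>m (boffset r k)"
    "N \<in> carrier_mat (boffset r k) (boffset r k)" using unip_inverse[OF M] by blast
  have Mc: "M \<in> carrier_mat (boffset r k) (boffset r k)" using M by (simp add: unip_iff)
  have MX: "M' * X \<in> carrier_mat (boffset r k) (boffset r k)" using c by simp
  show ?thesis
  proof
    assume "M' * X * the (mat_inverse M) = Y"
    then have "Y * M = M' * X * N * M" using N by simp
    also have "\<dots> = M' * X" using assoc_mult_mat[OF MX N(4) Mc] N(3) right_mult_one_mat[OF MX] by simp
    finally show "M' * X = Y * M" by simp
  next
    assume "M' * X = Y * M"
    then have "M' * X * N = Y * (M * N)" using assoc_mult_mat[OF c(3) Mc N(4)] by simp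
    then show "M' * X * the (mat_inverse M) = Y" using N c by simp
  qed
qed

text \<open>
  The divisor that bounds the poles of an entry.  The entries on and below the diagonal blocks
  are constants, so the empty divisor fits them, and additivity extends to all weakly increasing
  triples of blocks.
\<close>

definition entry_div :: "(nat \<Rightarrow> nat) \<Rightarrow> (nat \<Rightarrow> nat \<Rightarrow> complex set multiset) \<Rightarrow> nat \<Rightarrow> nat \<Rightarrow> complex set multiset" where
  "entry_div r D a b = (if bindex r a < bindex r b then D (bindex r a) (bindex r b) else {#})"

text \<open>
  The pole conditions rephrased by numerators over theta functions, for arbitrary matrices \<open>B\<close> and
  \<open>C\<close> in place of \<open>A_U\<close> and \<open>A_V\<close>.  Unlike the conditions on the orders of the poles, this form is
  visibly stable under constant block diagonal changes of frame.
\<close>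

definition regular_gauge ::
  "complex \<Rightarrow> nat \<Rightarrow> (nat \<Rightarrow> nat) \<Rightarrow> (nat \<Rightarrow> nat \<Rightarrow> complex set multiset) \<Rightarrow>
     (complex \<Rightarrow> complex mat) \<Rightarrow> (complex \<Rightarrow> complex mat) \<Rightarrow> (complex \<Rightarrow> complex mat) \<Rightarrow> bool" where
  "regular_gauge q k r D B C F \<longleftrightarrow> (\<forall>z. F z \<in> unip k r) \<and>
     (\<exists>\<rho>>0. (\<exists>X. \<forall>a<boffset r k. \<forall>b<boffset r k. X a b holomorphic_on punctured \<rho> \<and>
          (\<forall>\<^sub>\<approx>z\<in>punctured \<rho>. F z $$ (a, b) = X a b z / div_theta q (entry_div r D a b) z)) \<and>
        (\<forall>\<^sub>\<approx>z\<in>punctured \<rho>. F (q * z) * B z = C z * F z))"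

lemma germ_eq_gauge_iff:
  assumes F: "\<And>z. F z \<in> unip k r"
    and B: "\<And>z. B z \<in> carrier_mat (boffset r k) (boffset r k)"
    and C: "\<And>z. C z \<in> carrier_mat (boffset r k) (boffset r k)"
  shows "germ_eq (gauge q F B) C \<longleftrightarrow> (\<exists>\<rho>>0. \<forall>\<^sub>\<approx>z\<in>punctured \<rho>. F (q * z) * B z = C z * F z)"
proof -
  have "gauge q F B z = C z \<longleftrightarrow> F (q * z) * B z = C z * F z" for z
    unfolding gauge_def sigma_q_def
    by (rule gauge_pointwise_iff[OF F _ B C]) (use F in \<open>simp add: unip_iff\<close>)
  then show ?thesis unfolding germ_eq_def by simp
qed

lemma is_solution_iff_regular_gauge:
  assumes q: "norm q > 1" and D: "\<And>i j. i < j \<Longrightarrow> j < k \<Longrightarrow> set_mset (D i j) \<subseteq> carrier (E_q q)"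
  shows "is_solution q k \<mu> r A D U V F \<longleftrightarrow> regular_gauge q k r D (A_blk k \<mu> r A U) (A_blk k \<mu> r A V) F"
proof -
  define n where "n = boffset r k"
  define P where "P = (\<lambda>(a, b) \<rho>. \<exists>X. X holomorphic_on punctured \<rho> \<and>
     (\<forall>\<^sub>\<approx>z\<in>punctured \<rho>. F z $$ (a, b) = X z / div_theta q (entry_div r D a b) z))"
  have P_mono: "P i \<rho>'" if "P i \<rho>" "\<rho>' \<le> \<rho>" for i \<rho> \<rho>'
  proof -
    obtain a b where i: "i = (a, b)" by (cases i)
    from that obtain X where "X holomorphic_on punctured \<rho>"
      "\<forall>\<^sub>\<approx>z\<in>punctured \<rho>. F z $$ (a, b) = X z / div_theta q (entry_div r D a b) z"
      by (auto simp: P_def i)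
    then show ?thesis using that(2) unfolding P_def i
      by (auto intro!: exI[of _ X] intro: cosparse_punctured_mono holomorphic_on_subset)
  qed
  have blk: "(\<lambda>z. block r (bindex r a) (bindex r b) (F z) $$ (a - boffset r (bindex r a), b - boffset r (bindex r b)))
      = (\<lambda>z. F z $$ (a, b))" if "a < n" "b < n" for a b
    using bindex_props[OF that(1)[unfolded n_def]] bindex_props[OF that(2)[unfolded n_def]]
    by (auto simp: block_def fun_eq_iff)
  have eD: "set_mset (entry_div r D a b) \<subseteq> carrier (E_q q)" if "a < n" "b < n" for a b
    using D[of "bindex r a" "bindex r b"] bindex_props(1)[OF that(2)[unfolded n_def]] by (auto simp: entry_div_def)
  show ?thesis
  proof
    assume sol: "is_solution q k \<mu> r A D U V F"
    then have unip: "\<And>z. F z \<in> unip k r" by (auto simp: is_solution_def unip_over_def)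
    have "\<exists>\<rho>>0. P i \<rho>" if i: "i \<in> {..<n} \<times> {..<n}" for i
    proof -
      obtain a b where ab: "i = (a, b)" "a < n" "b < n" using i by auto
      show ?thesis
      proof (cases "bindex r a < bindex r b")
        case True
        have "(\<lambda>z. F z $$ (a, b)) \<in> mero_germs"
          using sol ab by (auto simp: is_solution_def unip_over_def mat_over_def n_def)
        then obtain \<rho>1 where \<rho>1: "\<rho>1 > 0" "(\<lambda>z. F z $$ (a, b)) meromorphic_on punctured \<rho>1"
          by (auto simp: mero_germs_def)
        have "div_ge q (r (bindex r a)) (r (bindex r b)) (\<lambda>z. block r (bindex r a) (bindex r b) (F z)) (D (bindex r a) (bindex r b))"
          using sol True bindex_props(1)[of b r k] ab by (auto simp: is_solution_def n_def)
        then obtain \<rho>2 where \<rho>2: "\<rho>2 > 0" "\<forall>z0\<in>punctured \<rho>2. is_pole (\<lambda>z. F z $$ (a, b)) z0 \<longrightarrow>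
            - zorder (\<lambda>z. F z $$ (a, b)) z0 \<le> int (count (D (bindex r a) (bindex r b)) (proj_E q z0))"
          using blk[OF ab(2,3)] bindex_props(4)[of a r k] bindex_props(4)[of b r k] ab
          unfolding div_ge_def n_def by metis
        define \<rho> where "\<rho> = min \<rho>1 \<rho>2"
        have "\<exists>X. X holomorphic_on punctured \<rho> \<and> (\<forall>\<^sub>\<approx>z\<in>punctured \<rho>. F z $$ (a, b) = X z / div_theta q (entry_div r D a b) z)"
          unfolding poles_bounded_iff[OF q eD[OF ab(2,3)], symmetric]
          using \<rho>1 \<rho>2 True by (auto simp: \<rho>_def entry_div_def intro: meromorphic_on_subset)
        then show ?thesis using \<rho>1 \<rho>2 by (intro exI[of _ \<rho>]) (auto simp: P_def ab \<rho>_def)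
      next
        case False
        then have "F z $$ (a, b) = (if a = b then 1 else 0)" for z
          using unip[of z] ab unfolding unip_iff n_def by (cases "bindex r a = bindex r b") auto
        then show ?thesis
          using False unfolding P_def ab
          by (intro exI[of _ 1]) (auto simp: entry_div_def div_theta_empty[OF q] intro!: exI[of _ "\<lambda>_. if a = b then 1 else 0"])
      qed
    qed
    then obtain \<rho>1 where \<rho>1: "\<rho>1 > 0" "\<forall>i\<in>{..<n} \<times> {..<n}. P i \<rho>1"
      using common_radius[of "{..<n} \<times> {..<n}" P] P_mono by blast
    obtain \<rho>2 where \<rho>2: "\<rho>2 > 0" "\<forall>\<^sub>\<approx>z\<in>punctured \<rho>2. F (q * z) * A_blk k \<mu> r A U z = A_blk k \<mu> r A V z * F z"
      using sol germ_eq_gauge_iff[of F k r "A_blk k \<mu> r A U" "A_blk k \<mu> r A V" q, OF unip] by (auto simp: is_solution_def)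
    define \<rho> where "\<rho> = min \<rho>1 \<rho>2"
    have "\<forall>i\<in>{..<n} \<times> {..<n}. P i \<rho>" using \<rho>1 P_mono[of _ \<rho>1 \<rho>] by (auto simp: \<rho>_def)
    then have "\<forall>i\<in>{..<n} \<times> {..<n}. \<exists>X. X holomorphic_on punctured \<rho> \<and>
     (\<forall>\<^sub>\<approx>z\<in>punctured \<rho>. F z $$ i = X z / div_theta q (entry_div r D (fst i) (snd i)) z)"
      by (auto simp: P_def)
    from bchoice[OF this] obtain X where X: "\<forall>i\<in>{..<n} \<times> {..<n}. X i holomorphic_on punctured \<rho> \<and>
     (\<forall>\<^sub>\<approx>z\<in>punctured \<rho>. F z $$ i = X i z / div_theta q (entry_div r D (fst i) (snd i)) z)" by blast
    show "regular_gauge q k r D (A_blk k \<mu> r A U) (A_blk k \<mu> r A V) F"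
      unfolding regular_gauge_def
    proof (intro conjI exI allI impI)
      show "0 < \<rho>" using \<rho>1 \<rho>2 by (simp add: \<rho>_def)
      show "\<forall>\<^sub>\<approx>z\<in>punctured \<rho>. F (q * z) * A_blk k \<mu> r A U z = A_blk k \<mu> r A V z * F z"
        using \<rho>2 by (elim cosparse_punctured_mono) (simp add: \<rho>_def)
      fix a b assume "a < boffset r k" "b < boffset r k"
      then have "(a, b) \<in> {..<n} \<times> {..<n}" by (simp add: n_def)
      from bspec[OF X this] show "X (a, b) holomorphic_on punctured \<rho>"
        "\<forall>\<^sub>\<approx>z\<in>punctured \<rho>. F z $$ (a, b) = X (a, b) z / div_theta q (entry_div r D a b) z" by auto
    qed (rule unip)
  next
    assume reg: "regular_gauge q k r D (A_blk k \<mu> r A U) (A_blk k \<mu> r A V) F"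
    then have unip: "\<And>z. F z \<in> unip k r" by (auto simp: regular_gauge_def)
    from reg obtain \<rho> X where \<rho>: "\<rho> > 0" and X: "\<And>a b. a < n \<Longrightarrow> b < n \<Longrightarrow> X a b holomorphic_on punctured \<rho> \<and>
          (\<forall>\<^sub>\<approx>z\<in>punctured \<rho>. F z $$ (a, b) = X a b z / div_theta q (entry_div r D a b) z)"
      and eq: "\<forall>\<^sub>\<approx>z\<in>punctured \<rho>. F (q * z) * A_blk k \<mu> r A U z = A_blk k \<mu> r A V z * F z"
      unfolding regular_gauge_def n_def by blast
    have pb: "(\<lambda>z. F z $$ (a, b)) meromorphic_on punctured \<rho> \<and>
      (\<forall>z0\<in>punctured \<rho>. is_pole (\<lambda>z. F z $$ (a, b)) z0 \<longrightarrow>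
         - zorder (\<lambda>z. F z $$ (a, b)) z0 \<le> int (count (entry_div r D a b) (proj_E q z0)))" if "a < n" "b < n" for a b
      unfolding poles_bounded_iff[OF q eD[OF that]] using X[OF that] by blast
    have "F \<in> unip_over k r mero_germs"
      using unip pb \<rho> by (auto simp: unip_over_def mat_over_def unip_iff mero_germs_def n_def)
    moreover have "germ_eq (gauge q F (A_blk k \<mu> r A U)) (A_blk k \<mu> r A V)"
      using germ_eq_gauge_iff[of F k r "A_blk k \<mu> r A U" "A_blk k \<mu> r A V" q, OF unip] eq \<rho> by auto
    moreover have "div_ge q (r i) (r j) (\<lambda>z. block r i j (F z)) (D i j)" if ij: "i < j" "j < k" for i j
      unfolding div_ge_def
    proof (intro exI[of _ \<rho>] conjI ballI allI impI \<rho>)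
      fix z0 x y assume *: "z0 \<in> punctured \<rho>" "x < r i" "y < r j"
        and pole: "is_pole (\<lambda>z. block r i j (F z) $$ (x, y)) z0"
      define a b where "a = boffset r i + x" and "b = boffset r j + y"
      have ab: "a < n" "b < n" "bindex r a = i" "bindex r b = j"
        using * ij boffset_plus_less[of i k x r] boffset_plus_less[of j k y r] bindex_boffset[of x r i] bindex_boffset[of y r j]
        by (auto simp: a_def b_def n_def)
      have e: "(\<lambda>z. block r i j (F z) $$ (x, y)) = (\<lambda>z. F z $$ (a, b))"
        using * by (auto simp: block_def a_def b_def)
      show "- zorder (\<lambda>z. block r i j (F z) $$ (x, y)) z0 \<le> int (count (D i j) (proj_E q z0))"
        using pb[OF ab(1,2)] * pole ij ab unfolding e by (auto simp: entry_div_def)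
    qed
    ultimately show "is_solution q k \<mu> r A D U V F" unfolding is_solution_def by blast
  qed
qed

lemma regular_gauge_cong:
  assumes "\<rho> > 0" "\<And>z. z \<in> punctured \<rho> \<Longrightarrow> B z = B' z \<and> C z = C' z"
  shows "regular_gauge q k r D B C F \<longleftrightarrow> regular_gauge q k r D B' C' F"
proof -
  have *: "regular_gauge q k r D B' C' F" if reg: "regular_gauge q k r D B C F"
    and eq: "\<And>z. z \<in> punctured \<rho> \<Longrightarrow> B z = B' z \<and> C z = C' z" for B B' C C'
  proof -
    from reg obtain \<rho>' X where \<rho>': "\<rho>' > 0" and X: "\<And>a b. a < boffset r k \<Longrightarrow> b < boffset r k \<Longrightarrow> X a b holomorphic_on punctured \<rho>' \<and>
          (\<forall>\<^sub>\<approx>z\<in>punctured \<rho>'. F z $$ (a, b) = X a b z / div_theta q (entry_div r D a b) z)"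
      and e: "\<forall>\<^sub>\<approx>z\<in>punctured \<rho>'. F (q * z) * B z = C z * F z"
      unfolding regular_gauge_def by blast
    show ?thesis
      unfolding regular_gauge_def
    proof (intro conjI exI[of _ "min \<rho> \<rho>'"] exI[of _ X] allI impI)
      show "F z \<in> unip k r" for z using reg by (auto simp: regular_gauge_def)
      show "0 < min \<rho> \<rho>'" using \<rho>' assms by simp
      have "\<forall>\<^sub>\<approx>z\<in>punctured (min \<rho> \<rho>'). F (q * z) * B z = C z * F z"
        using e by (rule cosparse_punctured_mono) simp
      moreover have "\<forall>\<^sub>\<approx>z\<in>punctured (min \<rho> \<rho>'). z \<in> punctured \<rho>"
        by (rule eventually_in_cosparse) auto
      ultimately show "\<forall>\<^sub>\<approx>z\<in>punctured (min \<rho> \<rho>'). F (q * z) * B' z = C' z * F z"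
        by eventually_elim (use eq in auto)
      fix a b assume ab: "a < boffset r k" "b < boffset r k"
      show "X a b holomorphic_on punctured (min \<rho> \<rho>')" using X[OF ab] by (auto intro: holomorphic_on_subset)
      show "\<forall>\<^sub>\<approx>z\<in>punctured (min \<rho> \<rho>'). F z $$ (a, b) = X a b z / div_theta q (entry_div r D a b) z"
        using X[OF ab] by (auto intro: cosparse_punctured_mono)
    qed
  qed
  show ?thesis using *[of B C B' C'] *[of B' C' B C] assms(2) by auto
qed

section \<open>Conjugation by constant block diagonal matrices\<close>

definition block_diagonal :: "nat \<Rightarrow> (nat \<Rightarrow> nat) \<Rightarrow> complex mat \<Rightarrow> bool" where
  "block_diagonal k r P \<longleftrightarrow> P \<in> carrier_mat (boffset r k) (boffset r k) \<and>
     (\<forall>a<boffset r k. \<forall>b<boffset r k. bindex r a \<noteq> bindex r b \<longrightarrow> P $$ (a, b) = 0)"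

lemma triple_product_index:
  fixes Q M P :: "complex mat"
  assumes "Q \<in> carrier_mat n n" "M \<in> carrier_mat n n" "P \<in> carrier_mat n n" "a < n" "b < n"
  shows "(Q * M * P) $$ (a, b) = (\<Sum>d<n. \<Sum>c<n. Q $$ (a, c) * M $$ (c, d) * P $$ (d, b))"
proof -
  have "(Q * M * P) $$ (a, b) = (\<Sum>d<n. (Q * M) $$ (a, d) * P $$ (d, b))"
    using assms by (intro mult_index_sum) auto
  also have "\<dots> = (\<Sum>d<n. (\<Sum>c<n. Q $$ (a, c) * M $$ (c, d)) * P $$ (d, b))"
    using assms by (intro sum.cong refl) (simp add: mult_index_sum del: index_mult_mat)
  finally show ?thesis by (simp add: sum_distrib_right)
qed

text \<open>
  Conjugation by block diagonal matrices mixes only entries of one and the same block.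
\<close>

lemma block_conj_index:
  assumes P: "block_diagonal k r P" and Q: "block_diagonal k r Q"
    and M: "M \<in> carrier_mat (boffset r k) (boffset r k)" and M': "M' \<in> carrier_mat (boffset r k) (boffset r k)"
    and ab: "a < boffset r k" "b < boffset r k"
    and eq: "\<And>c d. c < boffset r k \<Longrightarrow> d < boffset r k \<Longrightarrow> bindex r c = bindex r a \<Longrightarrow> bindex r d = bindex r b \<Longrightarrow>
       M $$ (c, d) = x * M' $$ (c, d)"
  shows "(Q * M * P) $$ (a, b) = x * (Q * M' * P) $$ (a, b)"
proof -
  have c: "P \<in> carrier_mat (boffset r k) (boffset r k)" "Q \<in> carrier_mat (boffset r k) (boffset r k)"
    using P Q by (auto simp: block_diagonal_def)
  have "Q $$ (a, c) * M $$ (c, d) * P $$ (d, b) = x * (Q $$ (a, c) * M' $$ (c, d) * P $$ (d, b))"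
    if "c < boffset r k" "d < boffset r k" for c d
    using eq[OF that] P Q that ab unfolding block_diagonal_def
    by (cases "bindex r c = bindex r a \<and> bindex r d = bindex r b") auto
  then show ?thesis
    unfolding triple_product_index[OF c(2) M c(1) ab] triple_product_index[OF c(2) M' c(1) ab] sum_distrib_left
    by (intro sum.cong refl) auto
qed

lemma unip_conj:
  assumes P: "block_diagonal k r P" and Q: "block_diagonal k r Q" and QP: "Q * P = 1\<^sub>m (boffset r k)"
    and M: "M \<in> unip k r"
  shows "Q * M * P \<in> unip k r"
proof -
  have c: "P \<in> carrier_mat (boffset r k) (boffset r k)" "Q \<in> carrier_mat (boffset r k) (boffset r k)"
      "M \<in> carrier_mat (boffset r k) (boffset r k)"
    using P Q M by (auto simp: block_diagonal_def unip_iff)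
  show ?thesis
    unfolding unip_iff
  proof (intro conjI allI impI)
    show "Q * M * P \<in> carrier_mat (boffset r k) (boffset r k)" using c by simp
    fix a b assume ab: "a < boffset r k" "b < boffset r k"
    show "(Q * M * P) $$ (a, b) = (if a = b then 1 else 0)" if "bindex r a = bindex r b"
    proof -
      have "(Q * M * P) $$ (a, b) = 1 * (Q * 1\<^sub>m (boffset r k) * P) $$ (a, b)"
        by (rule block_conj_index[OF P Q c(3) _ ab]) (use that M in \<open>auto simp: unip_iff\<close>)
      then show ?thesis using QP c ab right_mult_one_mat[OF c(2)] by simp
    qed
    show "(Q * M * P) $$ (a, b) = 0" if "bindex r b < bindex r a"
    proof -
      have "(Q * M * P) $$ (a, b) = 0 * (Q * M * P) $$ (a, b)"
        by (rule block_conj_index[OF P Q c(3) c(3) ab]) (use that M in \<open>auto simp: unip_iff\<close>)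
      then show ?thesis by simp
    qed
  qed
qed

lemma conj_mult:
  fixes P :: "complex mat"
  assumes "P \<in> carrier_mat n n" "Q \<in> carrier_mat n n" "M \<in> carrier_mat n n" "N \<in> carrier_mat n n"
    and PQ: "P * Q = 1\<^sub>m n"
  shows "(Q * M * P) * (Q * N * P) = Q * (M * N) * P"
proof -
  have "(Q * M * P) * (Q * N * P) = Q * M * (P * (Q * (N * P)))"
    using assms by (simp add: assoc_mult_mat[of _ n n _ n _ n])
  also have "P * (Q * (N * P)) = (P * Q) * (N * P)"
    by (rule assoc_mult_mat[symmetric]) (use assms in auto)
  finally show ?thesis
    using assms by (simp add: assoc_mult_mat[of _ n n _ n _ n])
qed

lemma regular_gauge_conj:
  assumes P: "block_diagonal k r P" and Q: "block_diagonal k r Q"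
    and QP: "Q * P = 1\<^sub>m (boffset r k)" and PQ: "P * Q = 1\<^sub>m (boffset r k)"
    and B: "\<And>z. B z \<in> carrier_mat (boffset r k) (boffset r k)"
    and C: "\<And>z. C z \<in> carrier_mat (boffset r k) (boffset r k)"
    and reg: "regular_gauge q k r D B C F"
  shows "regular_gauge q k r D (\<lambda>z. Q * B z * P) (\<lambda>z. Q * C z * P) (\<lambda>z. Q * F z * P)"
proof -
  define n where "n = boffset r k"
  have c: "P \<in> carrier_mat n n" "Q \<in> carrier_mat n n" using P Q by (auto simp: block_diagonal_def n_def)
  from reg have unip: "\<And>z. F z \<in> unip k r" by (auto simp: regular_gauge_def)
  then have Fc: "\<And>z. F z \<in> carrier_mat n n" by (auto simp: unip_iff n_def)
  from reg obtain \<rho> X where \<rho>: "\<rho> > 0" and X: "\<And>a b. a < n \<Longrightarrow> b < n \<Longrightarrow> X a b holomorphic_on punctured \<rho> \<and>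
          (\<forall>\<^sub>\<approx>z\<in>punctured \<rho>. F z $$ (a, b) = X a b z / div_theta q (entry_div r D a b) z)"
      and eq: "\<forall>\<^sub>\<approx>z\<in>punctured \<rho>. F (q * z) * B z = C z * F z"
    unfolding regular_gauge_def n_def by blast
  define Y where "Y = (\<lambda>a b z. \<Sum>d<n. \<Sum>c<n. Q $$ (a, c) * X c d z * P $$ (d, b))"
  show ?thesis
    unfolding regular_gauge_def
  proof (intro conjI exI[of _ \<rho>] exI[of _ Y] allI impI \<rho> unip_conj[OF P Q QP] unip)
    show "\<forall>\<^sub>\<approx>z\<in>punctured \<rho>. Q * F (q * z) * P * (Q * B z * P) = Q * C z * P * (Q * F z * P)"
      using eq by eventually_elim
        (use conj_mult[OF c Fc B[folded n_def] PQ[folded n_def]] conj_mult[OF c C[folded n_def] Fc PQ[folded n_def]] in simp)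
    fix a b assume ab: "a < boffset r k" "b < boffset r k"
    show "Y a b holomorphic_on punctured \<rho>"
      unfolding Y_def using X by (intro holomorphic_intros) auto
    have "\<forall>\<^sub>\<approx>z\<in>punctured \<rho>. \<forall>c\<in>{..<n}. \<forall>d\<in>{..<n}. F z $$ (c, d) = X c d z / div_theta q (entry_div r D c d) z"
      by (intro eventually_ball_finite ballI) (use X in auto)
    then show "\<forall>\<^sub>\<approx>z\<in>punctured \<rho>. (Q * F z * P) $$ (a, b) = Y a b z / div_theta q (entry_div r D a b) z"
    proof eventually_elim
      case (elim z)
      have "Q $$ (a, c) * F z $$ (c, d) * P $$ (d, b) = Q $$ (a, c) * X c d z * P $$ (d, b) / div_theta q (entry_div r D a b) z"
        if "c < n" "d < n" for c d
      proof (cases "bindex r c = bindex r a \<and> bindex r d = bindex r b")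
        case True
        then have "entry_div r D c d = entry_div r D a b" by (simp add: entry_div_def)
        then show ?thesis using elim that by simp
      next
        case False
        then have "Q $$ (a, c) = 0 \<or> P $$ (d, b) = 0" using P Q ab that unfolding block_diagonal_def n_def by metis
        then show ?thesis by auto
      qed
      then show ?case
        unfolding triple_product_index[OF c(2) Fc c(1) ab[folded n_def]] Y_def sum_divide_distrib
        by (intro sum.cong refl) auto
    qed
  qed
qed

text \<open>
  Needed for the coefficients \<open>s\<close> and \<open>t\<close> of the scalar equations to be nonzero.
\<close>

lemma invertible_eigenvalue_nonzero:
  assumes A: "(A :: complex mat) \<in> carrier_mat n n" and inv: "invertible_mat A" and x: "x \<in> spectrum A"
  shows "x \<noteq> 0"
proof
  assume "x = 0"
  then obtain v where v: "v \<in> carrier_vec n" "v \<noteq> 0\<^sub>v n" "A *\<^sub>v v = 0 \<cdot>\<^sub>v v"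
    using x A by (auto simp: spectrum_def eigenvalue_def eigenvector_def)
  from inv obtain A' where A': "A' * A = 1\<^sub>m (dim_row A')" "A * A' = 1\<^sub>m (dim_row A)"
    by (auto simp: invertible_mat_def inverts_mat_def)
  have "dim_row A' = n" "dim_col A' = n"
    using arg_cong[OF A'(1), of dim_col] arg_cong[OF A'(2), of dim_col] A by simp_all
  then have A'c: "A' \<in> carrier_mat n n" by auto
  have "v = (A' * A) *\<^sub>v v" using A' A'c v by simp
  also have "\<dots> = A' *\<^sub>v (0 \<cdot>\<^sub>v v)" using A A'c v by (simp add: assoc_mult_mat_vec[of _ n n _ n])
  also have "\<dots> = 0\<^sub>v n" using A'c v by auto
  finally show False using v by simp
qed

lemma complex_schur:
  assumes A: "(A :: complex mat) \<in> carrier_mat n n"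
  shows "\<exists>T P Q. similar_mat_wit A T P Q \<and> upper_triangular T \<and> (\<forall>x<n. T $$ (x, x) \<in> spectrum A)"
proof -
  obtain es where es: "char_poly A = (\<Prod>e\<leftarrow>es. [:- e, 1:])" using char_poly_factorized[OF A] by blast
  obtain T P Q where S: "schur_decomposition A es = (T, P, Q)" by (cases "schur_decomposition A es")
  from schur_decomposition[OF A es S] have T: "similar_mat_wit A T P Q" "upper_triangular T" "diag_mat T = es" by auto
  have Tc: "T \<in> carrier_mat n n" using similar_mat_witD2(5)[OF A T(1)] .
  have "T $$ (x, x) \<in> spectrum A" if "x < n" for x
  proof -
    have "T $$ (x, x) \<in> set es" unfolding T(3)[symmetric] diag_mat_def using Tc that by auto
    then show ?thesis unfolding spectrum_root_char_poly[OF A] es by (auto simp: poly_prod_list prod_list_zero_iff)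
  qed
  with T show ?thesis by blast
qed

text \<open>
  Schur decompositions of the diagonal blocks, put together.
\<close>

lemma triangularize_blocks:
  assumes A: "\<And>i. i < k \<Longrightarrow> A i \<in> carrier_mat (r i) (r i)"
  shows "\<exists>P Q. block_diagonal k r P \<and> block_diagonal k r Q \<and> P * Q = 1\<^sub>m (boffset r k) \<and> Q * P = 1\<^sub>m (boffset r k) \<and>
    (\<forall>a<boffset r k. \<forall>b<a. (Q * block_diag k r A * P) $$ (a, b) = 0) \<and>
    (\<forall>a<boffset r k. (Q * block_diag k r A * P) $$ (a, a) \<in> spectrum (A (bindex r a)))"
proof -
  have "\<forall>i\<in>{..<k}. \<exists>TPQ. similar_mat_wit (A i) (fst TPQ) (fst (snd TPQ)) (snd (snd TPQ)) \<and> upper_triangular (fst TPQ) \<and>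
      (\<forall>x<r i. fst TPQ $$ (x, x) \<in> spectrum (A i))"
  proof
    fix i assume "i \<in> {..<k}"
    then obtain T P Q where "similar_mat_wit (A i) T P Q" "upper_triangular T" "\<forall>x<r i. T $$ (x, x) \<in> spectrum (A i)"
      using complex_schur[OF A[of i]] by blast
    then show "\<exists>TPQ. similar_mat_wit (A i) (fst TPQ) (fst (snd TPQ)) (snd (snd TPQ)) \<and> upper_triangular (fst TPQ) \<and>
        (\<forall>x<r i. fst TPQ $$ (x, x) \<in> spectrum (A i))"
      by (intro exI[of _ "(T, P, Q)"]) simp
  qed
  from bchoice[OF this] obtain S where S: "\<And>i. i < k \<Longrightarrow> similar_mat_wit (A i) (fst (S i)) (fst (snd (S i))) (snd (snd (S i))) \<and>
      upper_triangular (fst (S i)) \<and> (\<forall>x<r i. fst (S i) $$ (x, x) \<in> spectrum (A i))" by auto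
  define T P Q where "T = (\<lambda>i. fst (S i))" and "P = (\<lambda>i. fst (snd (S i)))" and "Q = (\<lambda>i. snd (snd (S i)))"
  have wit: "P i * Q i = 1\<^sub>m (r i)" "Q i * P i = 1\<^sub>m (r i)" "A i = P i * T i * Q i"
    "T i \<in> carrier_mat (r i) (r i)" "P i \<in> carrier_mat (r i) (r i)" "Q i \<in> carrier_mat (r i) (r i)" if "i < k" for i
    using similar_mat_witD2[OF A[OF that], of "T i" "P i" "Q i"] S[OF that] by (auto simp: T_def P_def Q_def)
  have QAP: "Q i * A i * P i = T i" if "i < k" for i
  proof -
    note c = wit(4-6)[OF that]
    have "Q i * A i * P i = (Q i * P i) * T i * (Q i * P i)"
      unfolding wit(3)[OF that] using c by (simp add: assoc_mult_mat[of _ "r i" "r i" _ "r i" _ "r i"])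
    then show ?thesis using wit(2)[OF that] c by simp
  qed
  have bd: "block_diagonal k r (block_diag k r X)" for X
    by (auto simp: block_diagonal_def block_diag_index)
  have conj: "block_diag k r Q * block_diag k r A * block_diag k r P = block_diag k r T"
  proof -
    have "block_diag k r Q * block_diag k r A * block_diag k r P = block_diag k r (\<lambda>i. Q i * A i * P i)"
    proof -
      have "Q i * A i \<in> carrier_mat (r i) (r i)" if "i < k" for i
        using wit(6)[OF that] A[OF that] by (rule mult_carrier_mat)
      then show ?thesis using wit(5,6) A by (simp add: block_diag_mult)
    qed
    also have "\<dots> = block_diag k r T" by (rule block_diag_cong) (rule QAP)
    finally show ?thesis .
  qed
  have one: "block_diag k r X * block_diag k r Y = 1\<^sub>m (boffset r k)"
    if "\<And>i. i < k \<Longrightarrow> X i \<in> carrier_mat (r i) (r i) \<and> Y i \<in> carrier_mat (r i) (r i) \<and> X i * Y i = 1\<^sub>m (r i)" for X Y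
  proof -
    have "block_diag k r X * block_diag k r Y = block_diag k r (\<lambda>i. X i * Y i)"
      using that by (intro block_diag_mult) auto
    also have "\<dots> = block_diag k r (\<lambda>i. 1\<^sub>m (r i))" using that by (intro block_diag_cong) auto
    finally show ?thesis by (simp add: block_diag_one)
  qed
  show ?thesis
  proof (intro exI[of _ "block_diag k r P"] exI[of _ "block_diag k r Q"] conjI bd one allI impI, unfold conj)
    fix a b assume a: "a < boffset r k" and b: "b < a"
    then have b': "b < boffset r k" by simp
    note pa = bindex_props[OF a] and pb = bindex_props[OF b']
    have "T (bindex r a) $$ (a - boffset r (bindex r a), b - boffset r (bindex r b)) = 0" if "bindex r a = bindex r b"
      using S[OF pa(1)] wit(4)[OF pa(1)] pa pb b that unfolding upper_triangular_def T_def by auto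
    then show "block_diag k r T $$ (a, b) = 0" by (simp add: block_diag_index[OF a b'])
  next
    fix a assume a: "a < boffset r k"
    show "block_diag k r T $$ (a, a) \<in> spectrum (A (bindex r a))"
      using S[OF bindex_props(1)[OF a]] bindex_props(4)[OF a] by (simp add: block_diag_index[OF a a] T_def)
  qed (use wit in auto)
qed

section \<open>Existence and uniqueness in the triangular frame\<close>

lemma unip_same_block:
  "M \<in> unip k r \<Longrightarrow> a < boffset r k \<Longrightarrow> b < boffset r k \<Longrightarrow> bindex r a = bindex r b \<Longrightarrow>
     M $$ (a, b) = (if a = b then 1 else 0)"
  unfolding unip_iff by blast

lemma unip_lower_block:
  "M \<in> unip k r \<Longrightarrow> a < boffset r k \<Longrightarrow> b < boffset r k \<Longrightarrow> bindex r b < bindex r a \<Longrightarrow> M $$ (a, b) = 0"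
  unfolding unip_iff by blast

lemma cosparse_punctured_rescale:
  assumes q: "q \<noteq> 0" and ev: "\<forall>\<^sub>\<approx>z\<in>punctured \<rho>. R z"
  shows "\<forall>\<^sub>\<approx>z\<in>punctured (\<rho> / norm q). R (q * z)"
  unfolding cosparse_punctured_iff
proof
  fix z assume z: "z \<in> punctured (\<rho> / norm q)"
  then have "q * z \<in> punctured \<rho>" using q by (auto simp: norm_mult field_simps)
  then have "eventually R (at (q * z))" using ev unfolding cosparse_punctured_iff by blast
  moreover have "filterlim (\<lambda>w. q * w) (at (q * z)) (at z)"
  proof (rule filterlim_atI)
    show "((\<lambda>w. q * w) \<longlongrightarrow> q * z) (at z)" by (intro tendsto_intros)
    show "\<forall>\<^sub>F w in at z. q * w \<noteq> q * z"
      using eventually_neq_at_within[of z z UNIV] by eventually_elim (use q in auto)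
  qed
  ultimately show "\<forall>\<^sub>F w in at z. R (q * w)" by (rule eventually_compose_filterlim)
qed

definition entries_holomorphic ::
  "nat \<Rightarrow> (nat \<Rightarrow> nat) \<Rightarrow> (nat \<Rightarrow> nat \<Rightarrow> complex \<Rightarrow> complex mat) \<Rightarrow> real \<Rightarrow> bool" where
  "entries_holomorphic k r W \<rho> \<longleftrightarrow> (\<forall>a<boffset r k. \<forall>b<boffset r k. bindex r a < bindex r b \<longrightarrow>
     (\<lambda>z. W (bindex r a) (bindex r b) z $$ (a - boffset r (bindex r a), b - boffset r (bindex r b)))
       holomorphic_on punctured \<rho>)"

lemma entries_holomorphic_mono:
  "entries_holomorphic k r W \<rho> \<Longrightarrow> \<rho>' \<le> \<rho> \<Longrightarrow> entries_holomorphic k r W \<rho>'"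
  unfolding entries_holomorphic_def
  by (intro allI impI, rule holomorphic_on_subset[of _ "punctured \<rho>"]) auto

text \<open>
  The data of the theorem together with a frame \<open>P\<close>, with inverse \<open>Q\<close>, in which the diagonal
  blocks are triangular.
\<close>

locale gauge_problem =
  fixes q :: complex and k :: nat and \<mu> :: "nat \<Rightarrow> int" and r :: "nat \<Rightarrow> nat"
    and A :: "nat \<Rightarrow> complex mat" and D :: "nat \<Rightarrow> nat \<Rightarrow> complex set multiset"
    and P Q :: "complex mat"
    and U V :: "nat \<Rightarrow> nat \<Rightarrow> complex \<Rightarrow> complex mat"
  assumes q: "norm q > 1"
    and A: "\<And>i. i < k \<Longrightarrow> A i \<in> carrier_mat (r i) (r i) \<and> invertible_mat (A i)"
    and D: "summation_divisor q k \<mu> D"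
    and allowed: "allowed_divisor q k \<mu> A D"
    and P: "block_diagonal k r P" and Q: "block_diagonal k r Q"
    and PQ: "P * Q = 1\<^sub>m (boffset r k)" and QP: "Q * P = 1\<^sub>m (boffset r k)"
    and upper: "\<And>a b. a < boffset r k \<Longrightarrow> b < a \<Longrightarrow> (Q * block_diag k r A * P) $$ (a, b) = 0"
    and spec: "\<And>a. a < boffset r k \<Longrightarrow> (Q * block_diag k r A * P) $$ (a, a) \<in> spectrum (A (bindex r a))"
begin

abbreviation "n \<equiv> boffset r k"
abbreviation "\<beta> \<equiv> bindex r"

abbreviation "\<tau> a \<equiv> (Q * block_diag k r A * P) $$ (a, a)"

definition tri :: "(nat \<Rightarrow> nat \<Rightarrow> complex \<Rightarrow> complex mat) \<Rightarrow> complex \<Rightarrow> complex mat" where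
  "tri W z = Q * A_blk k \<mu> r A W z * P"

definition tri_holomorphic :: "real \<Rightarrow> bool" where
  "tri_holomorphic \<rho> \<longleftrightarrow> (\<forall>a<n. \<forall>b<n. (\<lambda>z. tri U z $$ (a, b)) holomorphic_on punctured \<rho> \<and>
     (\<lambda>z. tri V z $$ (a, b)) holomorphic_on punctured \<rho>)"

lemma PQ_carrier: "P \<in> carrier_mat n n" "Q \<in> carrier_mat n n"
  using P Q by (auto simp: block_diagonal_def)

lemma tri_carrier [simp]: "tri W z \<in> carrier_mat n n"
  using PQ_carrier by (auto simp: tri_def intro!: mult_carrier_mat A_blk_carrier)

lemma tri_dim [simp]: "dim_row (tri W z) = n" "dim_col (tri W z) = n"
  using tri_carrier[of W z] by (auto simp del: tri_carrier)

lemma tri_same_block: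
  assumes "a < n" "b < n" "\<beta> a = \<beta> b"
  shows "tri W z $$ (a, b) = z powi (- \<mu> (\<beta> a)) * (Q * block_diag k r A * P) $$ (a, b)"
  unfolding tri_def
  by (rule block_conj_index[OF P Q _ _ assms(1,2)])
     (use A assms in \<open>auto simp: A_blk_index\<close>)

lemma tri_lower_block:
  assumes "a < n" "b < n" "\<beta> b < \<beta> a"
  shows "tri W z $$ (a, b) = 0"
proof -
  have "tri W z $$ (a, b) = 0 * (Q * A_blk k \<mu> r A W z * P) $$ (a, b)"
    unfolding tri_def
    by (rule block_conj_index[OF P Q _ _ assms(1,2)])
       (use A assms in \<open>auto simp: A_blk_index\<close>)
  then show ?thesis by simp
qed

lemma D_carrier: "i < j \<Longrightarrow> j < k \<Longrightarrow> set_mset (D i j) \<subseteq> carrier (E_q q)"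
  and D_size: "i < j \<Longrightarrow> j < k \<Longrightarrow> int (size (D i j)) = \<mu> i - \<mu> j"
  and D_add: "i < l \<Longrightarrow> l < j \<Longrightarrow> j < k \<Longrightarrow> D i j = D i l + D l j"
  using D unfolding summation_divisor_def by blast+

lemma entry_div_carrier: "b < n \<Longrightarrow> set_mset (entry_div r D a b) \<subseteq> carrier (E_q q)"
  using D_carrier bindex_props(1) by (auto simp: entry_div_def)

lemma entry_div_size: "b < n \<Longrightarrow> \<beta> a \<le> \<beta> b \<Longrightarrow> int (size (entry_div r D a b)) = \<mu> (\<beta> a) - \<mu> (\<beta> b)"
  using D_size bindex_props(1) by (auto simp: entry_div_def)

lemma entry_div_add:
  "b < n \<Longrightarrow> \<beta> a \<le> \<beta> c \<Longrightarrow> \<beta> c \<le> \<beta> b \<Longrightarrow> entry_div r D a b = entry_div r D a c + entry_div r D c b"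
  using D_add[of "\<beta> a" "\<beta> c" "\<beta> b"] bindex_props(1)[of b r k] by (auto simp: entry_div_def)

lemma spec_nonzero: "i < k \<Longrightarrow> x \<in> spectrum (A i) \<Longrightarrow> x \<noteq> 0"
  using invertible_eigenvalue_nonzero[of "A i" "r i" x] A by blast

sublocale T: triangular_gauge q n \<beta> "\<lambda>a. \<mu> (\<beta> a)" \<tau>
  "\<lambda>a b. div_theta q (entry_div r D a b)" "\<lambda>a b. div_mult q (entry_div r D a b)"
  "\<lambda>a b z. tri U z $$ (a, b)" "\<lambda>a b z. tri V z $$ (a, b)"
proof
  show "1 < norm q" by (rule q)
  show "\<beta> a \<le> \<beta> b" if "a \<le> b" "b < n" for a b using bindex_mono[OF that] .
  show "\<tau> a \<noteq> 0" if "a < n" for a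
    using spec_nonzero[OF bindex_props(1)[OF that] spec[OF that]] .
  show "div_mult q (entry_div r D a b) \<noteq> 0" if "a < n" "b < n" for a b
    by (rule div_mult_nonzero[OF q entry_div_carrier[OF that(2)]])
  show "div_theta q (entry_div r D a b) holomorphic_on - {0}" if "a < n" "b < n" for a b
    by (rule div_theta_holomorphic[OF q entry_div_carrier[OF that(2)]])
  show "div_theta q (entry_div r D a b) (q * z) =
      div_mult q (entry_div r D a b) * z powi (\<mu> (\<beta> a) - \<mu> (\<beta> b)) * div_theta q (entry_div r D a b) z"
    if "a < n" "b < n" "\<beta> a \<le> \<beta> b" "z \<noteq> 0" for a b z
    unfolding entry_div_size[OF that(2,3), symmetric] power_int_of_nat
    by (rule div_theta_shift[OF q entry_div_carrier[OF that(2)] that(4)])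
  show "div_theta q (entry_div r D a b) z = div_theta q (entry_div r D a c) z * div_theta q (entry_div r D c b) z"
    if "\<beta> a \<le> \<beta> c" "\<beta> c \<le> \<beta> b" "a < n" "b < n" "c < n" for a c b z
    unfolding entry_div_add[OF that(4,1,2)] by (rule div_theta_add[OF q])
  show "\<tau> b / div_mult q (entry_div r D a b) * q powi l \<noteq> \<tau> a"
    if "a < n" "b < n" "\<beta> a < \<beta> b" for a b l
  proof (rule div_mult_nonresonant[OF q entry_div_carrier[OF that(2)]])
    note ba = bindex_props(1)[OF that(1)] and bb = bindex_props(1)[OF that(2)]
    show "\<tau> a \<noteq> 0" "\<tau> b \<noteq> 0"
      using spec_nonzero[OF ba spec[OF that(1)]] spec_nonzero[OF bb spec[OF that(2)]] .
    show "ev_E q (entry_div r D a b) \<noteq> proj_E q ((-1) powi int (size (entry_div r D a b)) * (\<tau> a / \<tau> b))"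
      unfolding entry_div_size[OF that(2) less_imp_le[OF that(3)]]
    proof
      assume ev: "ev_E q (entry_div r D a b) = proj_E q ((-1) powi (\<mu> (\<beta> a) - \<mu> (\<beta> b)) * (\<tau> a / \<tau> b))"
      have "entry_div r D a b = D (\<beta> a) (\<beta> b)" using that(3) by (simp add: entry_div_def)
      then have "ev_E q (D (\<beta> a) (\<beta> b)) \<in> proj_E q ` {(-1) powi (\<mu> (\<beta> a) - \<mu> (\<beta> b)) * (s / t) | s t.
          s \<in> spectrum (A (\<beta> a)) \<and> t \<in> spectrum (A (\<beta> b))}"
        unfolding ev[symmetric] using ev spec[OF that(1)] spec[OF that(2)]
        by (intro image_eqI[of _ _ "(-1) powi (\<mu> (\<beta> a) - \<mu> (\<beta> b)) * (\<tau> a / \<tau> b)"] CollectI exI[of _ "\<tau> a"] exI[of _ "\<tau> b"] conjI) simp_all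
      moreover have "ev_E q (D (\<beta> a) (\<beta> b)) \<notin> proj_E q ` {(-1) powi (\<mu> (\<beta> a) - \<mu> (\<beta> b)) * (s / t) | s t.
          s \<in> spectrum (A (\<beta> a)) \<and> t \<in> spectrum (A (\<beta> b))}"
        by (rule allowed[unfolded allowed_divisor_def, rule_format]) (use that(3) bb in blast)
      ultimately show False by (rule notE[rotated])
    qed
  qed
  show "tri U z $$ (a, a) = \<tau> a * z powi - \<mu> (\<beta> a)" if "a < n" for a z
    by (simp add: tri_same_block[OF that that])
  show "tri V z $$ (a, b) = tri U z $$ (a, b)" if "a < n" "b < n" "\<beta> a = \<beta> b" for a b z
    by (simp add: tri_same_block[OF that])
  show "tri U z $$ (a, b) = 0 \<and> tri V z $$ (a, b) = 0" if "b < a" "a < n" for a b z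
  proof -
    have b: "b < n" using that by simp
    have "\<beta> b \<le> \<beta> a" using bindex_mono[of b a r k] that by simp
    then consider "\<beta> a = \<beta> b" | "\<beta> b < \<beta> a" by linarith
    then show ?thesis
      by cases (simp_all add: tri_same_block[OF that(2) b] tri_lower_block[OF that(2) b] upper[OF that(2,1)])
  qed
qed

lemma entry_div_block: "\<beta> a = \<beta> b \<Longrightarrow> div_theta q (entry_div r D a b) z = 1"
  by (simp add: entry_div_def div_theta_empty[OF q])

definition tri_sol :: "complex \<Rightarrow> complex mat" where
  "tri_sol z = mat n n (\<lambda>(a, b). T.unip_entry T.gauge_sol z a b)"

lemma tri_sol_index: "a < n \<Longrightarrow> b < n \<Longrightarrow> tri_sol z $$ (a, b) = T.unip_entry T.gauge_sol z a b"
  by (simp add: tri_sol_def)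

lemma tri_sol_unip: "tri_sol z \<in> unip k r"
  unfolding unip_iff by (auto simp: tri_sol_def T.unip_entry_def)

lemma tri_sol_regular:
  assumes \<rho>: "\<rho> > 0"
    and hol: "tri_holomorphic \<rho>"
  shows "regular_gauge q k r D (tri U) (tri V) tri_sol"
proof -
  \<comment> \<open>Below the diagonal blocks the recursion says nothing about the solution.\<close>
  define X where "X = (\<lambda>a b. if \<beta> a \<le> \<beta> b then T.gauge_sol a b else (\<lambda>_. 0))"
  have sol: "T.gauge_sol a b holomorphic_on punctured (norm q * \<rho>) \<and>
      (\<beta> a < \<beta> b \<longrightarrow> (\<forall>z\<in>punctured \<rho>. T.gauge_eq T.gauge_sol a b z))" if "a < n" "b < n" "\<beta> a \<le> \<beta> b" for a b
    by (rule T.gauge_sol_solves[OF _ \<rho> that]) (use hol in \<open>simp add: tri_holomorphic_def\<close>)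
  show ?thesis
    unfolding regular_gauge_def
  proof (intro conjI exI[of _ \<rho>] exI[of _ X] allI impI \<rho> tri_sol_unip)
    fix a b assume ab: "a < n" "b < n"
    show "X a b holomorphic_on punctured \<rho>"
      using sol[OF ab] T.punctured_mono_q[OF \<rho>] by (auto simp: X_def intro: holomorphic_on_subset)
    have "tri_sol z $$ (a, b) = X a b z / div_theta q (entry_div r D a b) z" for z
      using ab by (auto simp: tri_sol_index T.unip_entry_def X_def T.gauge_sol_block entry_div_block)
    then show "\<forall>\<^sub>\<approx>z\<in>punctured \<rho>. tri_sol z $$ (a, b) = X a b z / div_theta q (entry_div r D a b) z"
      by simp
  next
    have "\<forall>\<^sub>\<approx>z\<in>punctured \<rho>. \<forall>a\<in>{..<n}. \<forall>b\<in>{..<n}. div_theta q (entry_div r D a b) z \<noteq> 0"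
      by (intro eventually_ball_finite ballI div_theta_cosparse_nonzero[OF q] entry_div_carrier) auto
    moreover have "\<forall>\<^sub>\<approx>z\<in>punctured \<rho>. z \<in> punctured \<rho>" by (rule eventually_in_cosparse) auto
    ultimately show "\<forall>\<^sub>\<approx>z\<in>punctured \<rho>. tri_sol (q * z) * tri U z = tri V z * tri_sol z"
    proof eventually_elim
      case (elim z)
      have c: "tri_sol z \<in> carrier_mat n n" for z by (simp add: tri_sol_def)
      show ?case
      proof (rule eq_matI)
        fix a b assume "a < dim_row (tri V z * tri_sol z)" "b < dim_col (tri V z * tri_sol z)"
        then have ab: "a < n" "b < n" using c[of z] tri_carrier[of V z] by auto
        have "(\<Sum>c<n. T.unip_entry T.gauge_sol (q * z) a c * tri U z $$ (c, b)) = (\<Sum>c<n. tri V z $$ (a, c) * T.unip_entry T.gauge_sol z c b)"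
        proof (cases "\<beta> a < \<beta> b")
          case True
          show ?thesis
          proof (subst T.gauge_eq_iff[OF ab True])
            show "z \<noteq> 0" using elim by simp
            show "T.gauge_eq T.gauge_sol a b z" using sol[OF ab less_imp_le[OF True]] True elim by blast
            show "div_theta q (entry_div r D a b) z \<noteq> 0" if "a < n" "b < n" for a b using elim that by blast
          qed (simp_all add: entry_div_block T.gauge_sol_block)
        next
          case False
          then show ?thesis
            by (intro T.gauge_sum_trivial[where f = "T.unip_entry T.gauge_sol (q * z)" and g = "T.unip_entry T.gauge_sol z"] ab)
               (simp_all add: T.unip_entry_def)
        qed
        then show "(tri_sol (q * z) * tri U z) $$ (a, b) = (tri V z * tri_sol z) $$ (a, b)"
          unfolding mult_index_sum[OF c tri_carrier ab] mult_index_sum[OF tri_carrier c ab]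
          using ab by (simp add: tri_sol_index)
      qed (use c[of z] c[of "q * z"] tri_carrier[of U z] tri_carrier[of V z] in auto)
    qed
  qed
qed

text \<open>
  A solution satisfies the matrix equation only off a discrete set.  Its numerators are
  holomorphic, hence satisfy the equations without poles everywhere, by continuity.
\<close>

lemma regular_imp_gauge_eq:
  assumes \<rho>0: "\<rho>0 > 0"
    and hol: "tri_holomorphic \<rho>0"
    and reg: "regular_gauge q k r D (tri U) (tri V) G"
  shows "\<exists>\<rho>>0. \<exists>\<rho>'>0. \<exists>X. (\<forall>a<n. \<forall>b<n. X a b holomorphic_on punctured \<rho> \<and>
      (\<forall>\<^sub>\<approx>z\<in>punctured \<rho>. G z $$ (a, b) = X a b z / div_theta q (entry_div r D a b) z) \<and>
      (\<beta> a = \<beta> b \<longrightarrow> (\<forall>z\<in>punctured \<rho>. X a b z = (if a = b then 1 else 0))) \<and>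
      (\<beta> a < \<beta> b \<longrightarrow> (\<forall>z\<in>punctured \<rho>'. T.gauge_eq X a b z)))"
proof -
  from reg have unip: "\<And>z. G z \<in> unip k r" by (auto simp: regular_gauge_def)
  then have Gc: "\<And>z. G z \<in> carrier_mat n n" by (simp add: unip_iff)
  from reg obtain \<rho> X where \<rho>: "\<rho> > 0" and X: "\<And>a b. a < n \<Longrightarrow> b < n \<Longrightarrow> X a b holomorphic_on punctured \<rho>"
      and GX: "\<And>a b. a < n \<Longrightarrow> b < n \<Longrightarrow> \<forall>\<^sub>\<approx>z\<in>punctured \<rho>. G z $$ (a, b) = X a b z / div_theta q (entry_div r D a b) z"
      and eq: "\<forall>\<^sub>\<approx>z\<in>punctured \<rho>. G (q * z) * tri U z = tri V z * G z"
    unfolding regular_gauge_def by blast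
  \<comment> \<open>Both z and q z have to lie in the domain of the numerators.\<close>
  define \<rho>' where "\<rho>' = min \<rho>0 (\<rho> / norm q)"
  have q0: "norm q > 0" using q by linarith
  have \<rho>': "\<rho>' > 0" "\<rho>' \<le> \<rho>0" "\<rho>' \<le> \<rho> / norm q" "\<rho>' \<le> \<rho>" "norm q * \<rho>' \<le> \<rho>"
  proof -
    show "\<rho>' > 0" "\<rho>' \<le> \<rho>0" "\<rho>' \<le> \<rho> / norm q" using \<rho> \<rho>0 q0 by (auto simp: \<rho>'_def)
    then show le: "norm q * \<rho>' \<le> \<rho>" using q0 by (simp add: field_simps)
    have "1 * \<rho>' \<le> norm q * \<rho>'" using q \<open>\<rho>' > 0\<close> by (intro mult_right_mono) auto
    with le show "\<rho>' \<le> \<rho>" by simp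
  qed
  have blk: "X a b z = (if a = b then 1 else 0)" if ab: "a < n" "b < n" "\<beta> a = \<beta> b" and z: "z \<in> punctured \<rho>" for a b z
  proof (rule holomorphic_cosparse_eq[OF X[OF ab(1,2)] _ _ z])
    show "\<forall>\<^sub>\<approx>z\<in>punctured \<rho>. X a b z = (if a = b then 1 else 0)"
      using GX[OF ab(1,2)] by eventually_elim (use unip ab in \<open>simp add: unip_iff entry_div_block\<close>)
  qed auto
  have "\<forall>\<^sub>\<approx>z\<in>punctured \<rho>. \<forall>a\<in>{..<n}. \<forall>b\<in>{..<n}. G z $$ (a, b) = X a b z / div_theta q (entry_div r D a b) z"
    by (intro eventually_ball_finite ballI GX) auto
  then have good: "\<forall>\<^sub>\<approx>z\<in>punctured \<rho>. \<forall>a<n. \<forall>b<n. G z $$ (a, b) = T.unip_entry X z a b"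
  proof eventually_elim
    case (elim z)
    have "G z $$ (a, b) = T.unip_entry X z a b" if "a < n" "b < n" for a b
    proof -
      consider "\<beta> a = \<beta> b" | "\<beta> a < \<beta> b" | "\<beta> b < \<beta> a" by linarith
      then show ?thesis
      proof cases
        case 1
        then show ?thesis using unip_same_block[OF unip that 1, of z] by (simp add: T.unip_entry_def)
      next
        case 2
        then show ?thesis using elim that by (simp add: T.unip_entry_def)
      next
        case 3
        then show ?thesis using unip_lower_block[OF unip that 3, of z] by (simp add: T.unip_entry_def)
      qed
    qed
    then show ?case by blast
  qed
  have nz: "\<forall>\<^sub>\<approx>z\<in>punctured \<rho>'. \<forall>a\<in>{..<n}. \<forall>b\<in>{..<n}. div_theta q (entry_div r D a b) z \<noteq> 0"
    by (intro eventually_ball_finite ballI div_theta_cosparse_nonzero[OF q] entry_div_carrier) auto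
  have ge: "\<forall>\<^sub>\<approx>z\<in>punctured \<rho>'. T.gauge_eq X a b z" if ab: "a < n" "b < n" "\<beta> a < \<beta> b" for a b
  proof -
    have "\<forall>\<^sub>\<approx>z\<in>punctured \<rho>'. z \<in> punctured \<rho>'" by (rule eventually_in_cosparse) auto
    moreover note nz cosparse_punctured_mono[OF good \<rho>'(4)] cosparse_punctured_mono[OF eq \<rho>'(4)]
      cosparse_punctured_mono[OF cosparse_punctured_rescale[OF T.q_nz good] \<rho>'(3)]
    ultimately show ?thesis
    proof eventually_elim
      case (elim z)
      have z: "z \<noteq> 0" "z \<in> punctured \<rho>" "q * z \<in> punctured \<rho>"
        using elim(1) \<rho>' T.times_q_punctured[of z \<rho>'] by auto
      have "(G (q * z) * tri U z) $$ (a, b) = (tri V z * G z) $$ (a, b)" using elim by simp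
      then have "(\<Sum>c<n. T.unip_entry X (q * z) a c * tri U z $$ (c, b)) = (\<Sum>c<n. tri V z $$ (a, c) * T.unip_entry X z c b)"
        unfolding mult_index_sum[OF Gc tri_carrier ab(1,2)] mult_index_sum[OF tri_carrier Gc ab(1,2)]
        using elim ab by simp
      then show ?case
        by (subst (asm) T.gauge_eq_iff[OF ab z(1)]) (use elim blk z in \<open>auto simp: entry_div_block\<close>)
    qed
  qed
  have gauge: "T.gauge_eq X a b z" if ab: "a < n" "b < n" "\<beta> a < \<beta> b" and z: "z \<in> punctured \<rho>'" for a b z
    unfolding T.gauge_eq_def
  proof (rule holomorphic_cosparse_eq[OF _ _ ge[OF ab, unfolded T.gauge_eq_def] z])
    have X': "X c d holomorphic_on punctured (norm q * \<rho>')" if "c < n" "d < n" for c d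
      using X[OF that] \<rho>'(5) by (auto intro: holomorphic_on_subset)
    have sub0: "punctured \<rho>' \<subseteq> punctured \<rho>0" using \<rho>'(2) by auto
    show "T.gauge_rhs X a b holomorphic_on punctured \<rho>'"
    proof (rule T.gauge_rhs_holomorphic[OF _ \<rho>'(1) ab(1,2)])
      show "(\<lambda>z. tri U z $$ (a, b)) holomorphic_on punctured \<rho>' \<and> (\<lambda>z. tri V z $$ (a, b)) holomorphic_on punctured \<rho>'"
        if "a < n" "b < n" for a b using hol that holomorphic_on_subset[OF _ sub0] by (simp add: tri_holomorphic_def)
    qed (use X' ab in auto)
    have "(\<lambda>z. X a b (q * z)) holomorphic_on punctured \<rho>'"
    proof (rule holomorphic_on_compose_gen[of "\<lambda>z. q * z" _ "X a b", unfolded o_def])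
      show "(\<lambda>z. q * z) ` punctured \<rho>' \<subseteq> punctured (norm q * \<rho>')"
        using T.times_q_punctured by (intro image_subsetI) simp
    qed (intro holomorphic_intros X' ab)+
    moreover have "X a b holomorphic_on punctured \<rho>'"
      using X[OF ab(1,2)] \<rho>'(4) by (auto intro: holomorphic_on_subset)
    ultimately show "(\<lambda>z. \<tau> b / div_mult q (entry_div r D a b) * X a b (q * z) -
        \<tau> a * X a b z) holomorphic_on punctured \<rho>'"
      by (intro holomorphic_intros) (use T.\<kappa>_nz[OF ab(1,2)] in auto)
  qed
  show ?thesis
    using \<rho> \<rho>'(1) X GX blk gauge by (intro exI[of _ \<rho>] exI[of _ \<rho>'] exI[of _ X] conjI) auto
qed

lemma tri_unique:
  assumes \<rho>0: "\<rho>0 > 0"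
    and hol: "tri_holomorphic \<rho>0"
    and reg: "regular_gauge q k r D (tri U) (tri V) G" "regular_gauge q k r D (tri U) (tri V) F"
  shows "germ_eq G F"
proof -
  obtain \<rho>1 \<rho>1' X where 1: "\<rho>1 > 0" "\<rho>1' > 0" and X: "\<And>a b. a < n \<Longrightarrow> b < n \<Longrightarrow> X a b holomorphic_on punctured \<rho>1 \<and>
      (\<forall>\<^sub>\<approx>z\<in>punctured \<rho>1. G z $$ (a, b) = X a b z / div_theta q (entry_div r D a b) z) \<and>
      (\<beta> a = \<beta> b \<longrightarrow> (\<forall>z\<in>punctured \<rho>1. X a b z = (if a = b then 1 else 0))) \<and>
      (\<beta> a < \<beta> b \<longrightarrow> (\<forall>z\<in>punctured \<rho>1'. T.gauge_eq X a b z))"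
    using regular_imp_gauge_eq[OF \<rho>0 hol reg(1)] by blast
  obtain \<rho>2 \<rho>2' Y where 2: "\<rho>2 > 0" "\<rho>2' > 0" and Y: "\<And>a b. a < n \<Longrightarrow> b < n \<Longrightarrow> Y a b holomorphic_on punctured \<rho>2 \<and>
      (\<forall>\<^sub>\<approx>z\<in>punctured \<rho>2. F z $$ (a, b) = Y a b z / div_theta q (entry_div r D a b) z) \<and>
      (\<beta> a = \<beta> b \<longrightarrow> (\<forall>z\<in>punctured \<rho>2. Y a b z = (if a = b then 1 else 0))) \<and>
      (\<beta> a < \<beta> b \<longrightarrow> (\<forall>z\<in>punctured \<rho>2'. T.gauge_eq Y a b z))"
    using regular_imp_gauge_eq[OF \<rho>0 hol reg(2)] by blast
  define \<rho> \<rho>' where "\<rho> = min \<rho>1 \<rho>2" and "\<rho>' = min \<rho>1' \<rho>2'"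
  have pos: "\<rho> > 0" "\<rho>' > 0" using 1 2 by (auto simp: \<rho>_def \<rho>'_def)
  have XY: "X a b z = Y a b z" if "a < n" "b < n" "\<beta> a \<le> \<beta> b" "z \<in> punctured \<rho>" for a b z
  proof (rule T.gauge_unique[OF pos _ _ _ that])
    show "X a b holomorphic_on punctured \<rho> \<and> Y a b holomorphic_on punctured \<rho>" if "a < n" "b < n" for a b
      using X[OF that] Y[OF that] by (auto simp: \<rho>_def intro: holomorphic_on_subset)
    show "X a b z = Y a b z" if "a < n" "b < n" "\<beta> a = \<beta> b" "z \<in> punctured \<rho>" for a b z
      using X[OF that(1,2)] Y[OF that(1,2)] that by (auto simp: \<rho>_def)
    show "T.gauge_eq X a b z \<and> T.gauge_eq Y a b z" if "a < n" "b < n" "\<beta> a < \<beta> b" "z \<in> punctured \<rho>'" for a b z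
      using X[OF that(1,2)] Y[OF that(1,2)] that by (auto simp: \<rho>'_def)
  qed
  have unip: "G z \<in> unip k r" "F z \<in> unip k r" for z using reg by (auto simp: regular_gauge_def)
  have "\<forall>\<^sub>\<approx>z\<in>punctured \<rho>. G z $$ (a, b) = F z $$ (a, b)" if ab: "a < n" "b < n" for a b
  proof (cases "\<beta> a \<le> \<beta> b")
    case True
    have "\<forall>\<^sub>\<approx>z\<in>punctured \<rho>. G z $$ (a, b) = X a b z / div_theta q (entry_div r D a b) z"
      "\<forall>\<^sub>\<approx>z\<in>punctured \<rho>. F z $$ (a, b) = Y a b z / div_theta q (entry_div r D a b) z"
      using X[OF ab] Y[OF ab] by (auto simp: \<rho>_def intro: cosparse_punctured_mono)
    moreover have "\<forall>\<^sub>\<approx>z\<in>punctured \<rho>. z \<in> punctured \<rho>" by (rule eventually_in_cosparse) auto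
    ultimately show ?thesis by eventually_elim (use XY[OF ab True] in auto)
  next
    case False
    then show ?thesis using unip ab by (simp add: unip_iff)
  qed
  then have "\<forall>\<^sub>\<approx>z\<in>punctured \<rho>. \<forall>a\<in>{..<n}. \<forall>b\<in>{..<n}. G z $$ (a, b) = F z $$ (a, b)"
    by (intro eventually_ball_finite ballI) auto
  then have "\<forall>\<^sub>\<approx>z\<in>punctured \<rho>. G z = F z"
  proof eventually_elim
    case (elim z)
    have "G z \<in> carrier_mat n n" "F z \<in> carrier_mat n n" using unip[of z] by (simp_all add: unip_iff)
    then show ?case using elim by (intro eq_matI) auto
  qed
  then show ?thesis using pos unfolding germ_eq_def by blast
qed

lemma tri_entry_holomorphic:
  assumes W: "entries_holomorphic k r W \<rho>"
    and ab: "a < n" "b < n"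
  shows "(\<lambda>z. tri W z $$ (a, b)) holomorphic_on punctured \<rho>"
proof -
  have "(\<lambda>z. A_blk k \<mu> r A W z $$ (c, d)) holomorphic_on punctured \<rho>" if "c < n" "d < n" for c d
  proof -
    have e: "A_blk k \<mu> r A W z $$ (c, d) = (if \<beta> c = \<beta> d then z powi (- \<mu> (\<beta> c)) * block_diag k r A $$ (c, d)
     else if \<beta> c < \<beta> d then W (\<beta> c) (\<beta> d) z $$ (c - boffset r (\<beta> c), d - boffset r (\<beta> d)) else 0)" for z
      using A by (intro A_blk_index that) auto
    consider "\<beta> c = \<beta> d" | "\<beta> c < \<beta> d" | "\<beta> d < \<beta> c" by linarith
    then show ?thesis
      unfolding e by cases (use W that in \<open>auto simp: entries_holomorphic_def intro!: holomorphic_intros\<close>)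
  qed
  then show ?thesis
    unfolding tri_def triple_product_index[OF PQ_carrier(2) A_blk_carrier PQ_carrier(1) ab]
    by (intro holomorphic_intros) auto
qed

lemma tri_holomorphic:
  "entries_holomorphic k r U \<rho> \<Longrightarrow> entries_holomorphic k r V \<rho> \<Longrightarrow> tri_holomorphic \<rho>"
  unfolding tri_holomorphic_def by (auto intro: tri_entry_holomorphic)

definition sol :: "complex \<Rightarrow> complex mat" where
  "sol z = P * tri_sol z * Q"

lemma P_tri_Q: "P * tri W z * Q = A_blk k \<mu> r A W z"
proof -
  let ?M = "A_blk k \<mu> r A W z"
  have "P * tri W z * Q = (P * Q) * ?M * (P * Q)"
    unfolding tri_def using PQ_carrier A_blk_carrier[of k \<mu> r A W z]
    by (simp add: assoc_mult_mat[of _ n n _ n _ n] del: A_blk_carrier)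
  then show ?thesis unfolding PQ using A_blk_carrier[of k \<mu> r A W z] by (simp del: A_blk_carrier)
qed

text \<open>
  The correspondence of solutions between the two frames is bijective, so both assertions come
  from the triangular frame.
\<close>

theorem regular_solution_exists_unique:
  assumes \<rho>: "\<rho> > 0"
    and U: "entries_holomorphic k r U \<rho>"
    and V: "entries_holomorphic k r V \<rho>"
  shows "regular_gauge q k r D (A_blk k \<mu> r A U) (A_blk k \<mu> r A V) sol"
    and "regular_gauge q k r D (A_blk k \<mu> r A U) (A_blk k \<mu> r A V) G \<Longrightarrow> germ_eq G sol"
proof -
  have hol: "tri_holomorphic \<rho>" by (rule tri_holomorphic[OF U V])
  have reg: "regular_gauge q k r D (tri U) (tri V) tri_sol" by (rule tri_sol_regular[OF \<rho> hol])
  show "regular_gauge q k r D (A_blk k \<mu> r A U) (A_blk k \<mu> r A V) sol"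
    using regular_gauge_conj[OF Q P PQ QP _ _ reg] by (simp add: P_tri_Q sol_def[abs_def])
  assume G: "regular_gauge q k r D (A_blk k \<mu> r A U) (A_blk k \<mu> r A V) G"
  have Gc: "G z \<in> carrier_mat n n" for z using G by (auto simp: regular_gauge_def unip_iff)
  have "regular_gauge q k r D (tri U) (tri V) (\<lambda>z. Q * G z * P)"
    using regular_gauge_conj[OF P Q QP PQ _ _ G] by (simp add: tri_def[abs_def])
  then have "germ_eq (\<lambda>z. Q * G z * P) tri_sol" by (rule tri_unique[OF \<rho> hol _ reg])
  moreover have "G z = sol z" if "Q * G z * P = tri_sol z" for z
  proof -
    have "sol z = (P * Q) * G z * (P * Q)"
      unfolding sol_def that[symmetric] using PQ_carrier Gc[of z]
      by (simp add: assoc_mult_mat[of _ n n _ n _ n])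
    then show ?thesis unfolding PQ using Gc[of z] by simp
  qed
  ultimately show "germ_eq G sol"
    unfolding germ_eq_def by (auto elim!: eventually_mono)
qed

text \<open>
  \<open>sol\<close> is defined without reference to a radius, so \<open>gauge_sol_solves\<close> applies to it with every radius.
\<close>

theorem sol_meromorphic:
  assumes U: "\<And>\<rho>. entries_holomorphic k r U \<rho>"
    and V: "\<And>\<rho>. entries_holomorphic k r V \<rho>"
  shows "sol \<in> unip_over k r mero_Cstar"
proof -
  have hol: "tri_holomorphic \<rho>" for \<rho> by (rule tri_holomorphic[OF U V])
  have mero: "(\<lambda>z. tri_sol z $$ (a, b)) meromorphic_on - {0}" if ab: "a < n" "b < n" for a b
  proof (cases "\<beta> a < \<beta> b")
    case True
    have "T.gauge_sol a b analytic_on {z}" if "z \<noteq> 0" for z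
    proof -
      have \<rho>: "norm z + 1 > 0" using norm_ge_zero[of z] by linarith
      have "T.gauge_sol a b holomorphic_on punctured (norm q * (norm z + 1))"
        by (rule T.gauge_sol_solves[OF _ \<rho> ab less_imp_le[OF True], THEN conjunct1])
          (use hol[of "norm z + 1"] in \<open>simp add: tri_holomorphic_def\<close>)
      then have "T.gauge_sol a b holomorphic_on punctured (norm z + 1)"
        using T.punctured_mono_q[OF \<rho>] by (rule holomorphic_on_subset)
      then have "T.gauge_sol a b analytic_on punctured (norm z + 1)" by (simp add: analytic_on_open)
      then show ?thesis by (rule analytic_on_subset) (use that in auto)
    qed
    then have "T.gauge_sol a b analytic_on - {0}" by (subst analytic_on_analytic_at) auto
    moreover have "div_theta q (entry_div r D a b) analytic_on - {0}"
      using T.\<Theta>_hol[OF ab] by (subst analytic_on_open) auto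
    ultimately have "(\<lambda>z. T.gauge_sol a b z / div_theta q (entry_div r D a b) z) meromorphic_on - {0}"
      by (intro meromorphic_intros analytic_on_imp_meromorphic_on)
    then show ?thesis using ab True by (simp add: tri_sol_index T.unip_entry_def)
  next
    case False
    then have "tri_sol z $$ (a, b) = (if a = b then 1 else 0)" for z
      using ab by (simp add: tri_sol_index T.unip_entry_def)
    then show ?thesis by (simp add: meromorphic_on_const)
  qed
  have c: "tri_sol z \<in> carrier_mat n n" for z by (simp add: tri_sol_def)
  have "(\<lambda>z. sol z $$ (a, b)) meromorphic_on - {0}" if ab: "a < n" "b < n" for a b
    unfolding sol_def triple_product_index[OF PQ_carrier(1) c PQ_carrier(2) ab]
    using mero by (intro meromorphic_intros) auto
  moreover have "sol z \<in> unip k r" for z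
    unfolding sol_def by (rule unip_conj[OF Q P PQ tri_sol_unip])
  ultimately show ?thesis
    by (auto simp: unip_over_def mat_over_def mero_Cstar_def unip_iff)
qed

end

section \<open>The theorem for germs\<close>

lemma conv_laurent_holomorphic:
  assumes "f \<in> conv_laurent" shows "\<exists>\<rho>>0. f holomorphic_on punctured \<rho>"
proof -
  have "isolated_singularity_at f 0"
    using assms meromorphic_on_isolated_singularity by (auto simp: conv_laurent_eq)
  then show ?thesis unfolding isolated_singularity_at_def using analytic_imp_holomorphic by blast
qed

text \<open>
  Laurent polynomials are replaced by their global representatives, so that their holomorphy does
  not stop at the radius within which the given functions agree with them.
\<close>

lemma nice_representative:
  assumes U: "\<And>i j. i < j \<Longrightarrow> j < k \<Longrightarrow> U i j \<in> mat_over (r i) (r j) conv_laurent"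
    and A: "\<And>i. i < k \<Longrightarrow> A i \<in> carrier_mat (r i) (r i)"
  shows "\<exists>U'. (\<exists>\<rho>>0. (\<forall>z\<in>punctured \<rho>. A_blk k \<mu> r A U z = A_blk k \<mu> r A U' z) \<and>
      entries_holomorphic k r U' \<rho>) \<and>
      (poly_normal_form k \<mu> r U \<longrightarrow> (\<forall>\<rho>. entries_holomorphic k r U' \<rho>))"
proof -
  define n where "n = boffset r k"
  define u where "u = (\<lambda>W a b (z::complex). (W (bindex r a) (bindex r b) z :: complex mat) $$
     (a - boffset r (bindex r a), b - boffset r (bindex r b)))"
  define I where "I = {(a, b). a < n \<and> b < n \<and> bindex r a < bindex r b}"
  have "I \<subseteq> {..<n} \<times> {..<n}" by (auto simp: I_def)
  then have fin: "finite I" by (rule finite_subset) simp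
  show ?thesis
  proof (cases "poly_normal_form k \<mu> r U")
    case False
    have "\<exists>\<rho>>0. (\<lambda>(a, b) \<rho>. u U a b holomorphic_on punctured \<rho>) i \<rho>" if "i \<in> I" for i
    proof -
      obtain a b where i: "i = (a, b)" and ab: "a < n" "b < n" "bindex r a < bindex r b"
        using \<open>i \<in> I\<close> by (auto simp: I_def)
      have "u U a b \<in> conv_laurent"
        using U[OF ab(3) bindex_props(1)[OF ab(2)[unfolded n_def]]] bindex_props(4)[OF ab(1)[unfolded n_def]]
          bindex_props(4)[OF ab(2)[unfolded n_def]]
        by (auto simp: mat_over_def u_def)
      from conv_laurent_holomorphic[OF this] show ?thesis by (simp add: i)
    qed
    then have "\<exists>\<rho>>0. \<forall>i\<in>I. (\<lambda>(a, b) \<rho>. u U a b holomorphic_on punctured \<rho>) i \<rho>"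
      by (rule common_radius[OF fin]) (auto intro: holomorphic_on_subset)
    then obtain \<rho> where "\<rho> > 0" "\<forall>i\<in>I. (\<lambda>(a, b) \<rho>. u U a b holomorphic_on punctured \<rho>) i \<rho>" by blast
    then show ?thesis
      using False by (intro exI[of _ U] conjI exI[of _ \<rho>]) (auto simp: I_def u_def n_def entries_holomorphic_def)
  next
    case True
    have "\<exists>c. \<forall>\<^sub>F z in at 0. u U (fst i) (snd i) z = (\<Sum>l\<in>{\<mu> (bindex r (snd i))..<\<mu> (bindex r (fst i))}. c l * z powi l)"
      if "i \<in> I" for i
    proof -
      obtain a b where i: "i = (a, b)" and ab: "a < n" "b < n" "bindex r a < bindex r b"
        using \<open>i \<in> I\<close> by (auto simp: I_def)
      show ?thesis
        using True bindex_props[OF ab(1)[unfolded n_def]] bindex_props[OF ab(2)[unfolded n_def]] ab(3)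
        unfolding poly_normal_form_def i u_def by auto
    qed
    then obtain c where c: "\<And>i. i \<in> I \<Longrightarrow> \<forall>\<^sub>F z in at 0. u U (fst i) (snd i) z =
        (\<Sum>l\<in>{\<mu> (bindex r (snd i))..<\<mu> (bindex r (fst i))}. c i l * z powi l)"
      using bchoice[of I "\<lambda>i c. \<forall>\<^sub>F z in at 0. u U (fst i) (snd i) z =
        (\<Sum>l\<in>{\<mu> (bindex r (snd i))..<\<mu> (bindex r (fst i))}. c l * z powi l)"] by blast
    define U' where "U' = (\<lambda>i j z. mat (r i) (r j) (\<lambda>(x, y).
        \<Sum>l\<in>{\<mu> j..<\<mu> i}. c (boffset r i + x, boffset r j + y) l * z powi l))"
    have u': "u U' a b = (\<lambda>z. \<Sum>l\<in>{\<mu> (bindex r b)..<\<mu> (bindex r a)}. c (a, b) l * z powi l)" if "(a, b) \<in> I" for a b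
      using that bindex_props[of a r k] bindex_props[of b r k] by (auto simp: u_def U'_def I_def n_def fun_eq_iff)
    have hol: "u U' a b holomorphic_on punctured \<rho>" if "(a, b) \<in> I" for a b \<rho>
      unfolding u'[OF that] by (intro holomorphic_intros) auto
    have "\<forall>\<^sub>F z in at 0. \<forall>i\<in>I. u U (fst i) (snd i) z = u U' (fst i) (snd i) z"
      by (intro eventually_ball_finite fin ballI) (use c u' in auto)
    then obtain \<rho> where \<rho>: "\<rho> > 0" "\<And>z i. z \<in> punctured \<rho> \<Longrightarrow> i \<in> I \<Longrightarrow> u U (fst i) (snd i) z = u U' (fst i) (snd i) z"
      unfolding eventually_at by (auto simp: dist_commute)
    have "A_blk k \<mu> r A U z = A_blk k \<mu> r A U' z" if z: "z \<in> punctured \<rho>" for z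
    proof (rule eq_matI)
      fix a b assume "a < dim_row (A_blk k \<mu> r A U' z)" "b < dim_col (A_blk k \<mu> r A U' z)"
      then have ab: "a < boffset r k" "b < boffset r k" by (auto simp: A_blk_def of_blocks_def)
      show "A_blk k \<mu> r A U z $$ (a, b) = A_blk k \<mu> r A U' z $$ (a, b)"
        using \<rho>(2)[OF z, of "(a, b)"] ab A by (simp add: A_blk_index I_def n_def u_def)
    qed (auto simp: A_blk_def of_blocks_def)
    then show ?thesis
      using \<rho>(1) hol by (intro exI[of _ U'] conjI exI[of _ \<rho>]) (auto simp: I_def u_def n_def entries_holomorphic_def)
  qed
qed

theorem theorem3p7:
  fixes q :: complex and k :: nat and \<mu> :: "nat \<Rightarrow> int" and r :: "nat \<Rightarrow> nat"
    and A :: "nat \<Rightarrow> complex mat" and D :: "nat \<Rightarrow> nat \<Rightarrow> complex set multiset"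
    and U V :: "nat \<Rightarrow> nat \<Rightarrow> complex \<Rightarrow> complex mat"
  assumes "norm q > 1"
    and "k \<ge> 1"
    and "\<And>i j. i < j \<Longrightarrow> j < k \<Longrightarrow> \<mu> i > \<mu> j"
    and "\<And>i. i < k \<Longrightarrow> r i \<ge> 1"
    and "\<And>i. i < k \<Longrightarrow> A i \<in> carrier_mat (r i) (r i) \<and> invertible_mat (A i)"
    and "summation_divisor q k \<mu> D"
    and "allowed_divisor q k \<mu> A D"
    and "\<And>i j. i < j \<Longrightarrow> j < k \<Longrightarrow> U i j \<in> mat_over (r i) (r j) conv_laurent"
    and "\<And>i j. i < j \<Longrightarrow> j < k \<Longrightarrow> V i j \<in> mat_over (r i) (r j) conv_laurent"
  shows "\<exists>F. is_solution q k \<mu> r A D U V F \<and>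
           (\<forall>G. is_solution q k \<mu> r A D U V G \<longrightarrow> germ_eq G F) \<and>
           (poly_normal_form k \<mu> r U \<and> poly_normal_form k \<mu> r V \<longrightarrow>
              (\<exists>F'\<in>unip_over k r mero_Cstar. germ_eq F F'))"
proof -
  have A: "\<And>i. i < k \<Longrightarrow> A i \<in> carrier_mat (r i) (r i)" using assms(5) by blast
  obtain P Q where PQ: "block_diagonal k r P" "block_diagonal k r Q" "P * Q = 1\<^sub>m (boffset r k)" "Q * P = 1\<^sub>m (boffset r k)"
    "\<And>a b. a < boffset r k \<Longrightarrow> b < a \<Longrightarrow> (Q * block_diag k r A * P) $$ (a, b) = 0"
    "\<And>a. a < boffset r k \<Longrightarrow> (Q * block_diag k r A * P) $$ (a, a) \<in> spectrum (A (bindex r a))"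
    using triangularize_blocks[of k A r, OF A] by blast
  obtain U' \<rho>1 where U': "\<rho>1 > 0" "\<forall>z\<in>punctured \<rho>1. A_blk k \<mu> r A U z = A_blk k \<mu> r A U' z"
      "entries_holomorphic k r U' \<rho>1"
      "poly_normal_form k \<mu> r U \<longrightarrow> (\<forall>\<rho>. entries_holomorphic k r U' \<rho>)"
    using nice_representative[of k U r A \<mu>, OF assms(8) A] by blast
  obtain V' \<rho>2 where V': "\<rho>2 > 0" "\<forall>z\<in>punctured \<rho>2. A_blk k \<mu> r A V z = A_blk k \<mu> r A V' z"
      "entries_holomorphic k r V' \<rho>2"
      "poly_normal_form k \<mu> r V \<longrightarrow> (\<forall>\<rho>. entries_holomorphic k r V' \<rho>)"
    using nice_representative[of k V r A \<mu>, OF assms(9) A] by blast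
  interpret gauge_problem q k \<mu> r A D P Q U' V'
    by unfold_locales (fact assms(1,5,6,7) PQ)+
  define \<rho> where "\<rho> = min \<rho>1 \<rho>2"
  have \<rho>: "\<rho> > 0" using U' V' by (simp add: \<rho>_def)
  have sol_iff: "is_solution q k \<mu> r A D U V F \<longleftrightarrow> regular_gauge q k r D (A_blk k \<mu> r A U') (A_blk k \<mu> r A V') F" for F
  proof -
    have "is_solution q k \<mu> r A D U V F \<longleftrightarrow> regular_gauge q k r D (A_blk k \<mu> r A U) (A_blk k \<mu> r A V) F"
      by (rule is_solution_iff_regular_gauge[OF q]) (rule D_carrier)
    also have "\<dots> \<longleftrightarrow> regular_gauge q k r D (A_blk k \<mu> r A U') (A_blk k \<mu> r A V') F"
      by (rule regular_gauge_cong[OF \<rho>]) (use U'(2) V'(2) in \<open>simp add: \<rho>_def\<close>)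
    finally show ?thesis .
  qed
  have hol: "entries_holomorphic k r U' \<rho>" "entries_holomorphic k r V' \<rho>"
    using U'(3) V'(3) by (auto simp: \<rho>_def intro: entries_holomorphic_mono)
  show ?thesis
  proof (intro exI[of _ sol] conjI allI impI)
    show "is_solution q k \<mu> r A D U V sol"
      unfolding sol_iff by (rule regular_solution_exists_unique(1)[OF \<rho> hol])
    show "germ_eq G sol" if "is_solution q k \<mu> r A D U V G" for G
      using that unfolding sol_iff by (rule regular_solution_exists_unique(2)[OF \<rho> hol])
    assume "poly_normal_form k \<mu> r U \<and> poly_normal_form k \<mu> r V"
    then have "entries_holomorphic k r U' \<rho>" "entries_holomorphic k r V' \<rho>" for \<rho>
      using U'(4) V'(4) by simp_all
    then have "sol \<in> unip_over k r mero_Cstar" by (rule sol_meromorphic)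
    moreover have "germ_eq sol sol" unfolding germ_eq_def by (intro exI[of _ 1]) simp
    ultimately show "\<exists>F'\<in>unip_over k r mero_Cstar. germ_eq sol F'" by blast
  qed
qed

end
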